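(* Let $p>0$ and $b_1,b_2\in\mathbb{R}$ be constants with $|b_1|+|b_2|>0$, and let $q\in C^0([0,1];\mathbb{R})$. Let $A:D\to L^2([0,1])$ be the Sturm-Liouville operator $(Af)(z)=-p\frac{d^2f}{dz^2}(z)+q(z)f(z)$, where $D$ is the set of all $f\in H^2(0,1)$ with $b_1f(0)+b_2\frac{df}{dz}(0)=f(1)=0$, with eigenvalues $\lambda_1<\lambda_2<\dots$ and orthonormal eigenfunctions $\phi_1,\phi_2,\dots$, and suppose that $\sum_{n=N}^{\infty}\lambda_n^{-1}\max_{0\le z\le 1}(|\phi_n(z)|)<+\infty$ for certain $N>0$ with $\lambda_N>0$. Let $c\ge 0$ be sufficiently large so that the closed-loop system $$\frac{\partial x}{\partial t}(t,z)=p\frac{\partial^2x}{\partial z^2}(t,z)-q(z)x(t,z),\qquad b_1x(t,0)+b_2\frac{\partial x}{\partial z}(t,0)=x(t,1)-u(t)=0,$$ with $u(t)=\int_0^1k(s)x(t,s)\,ds$ is exponentially stable in the $L^2$ norm, where $k(s)=K(1,s)$ and $K$ is the backstepping kernel corresponding to $c$ (as described in the context). Then there exist constants $M,\sigma,T>0$ such that for every increasing sequence $\{\tau_i\ge 0,\ i=0,1,2,\dots\}$ with $\tau_0=0$, $\sup_{i\ge 0}(\tau_{i+1}-\tau_i)\le T$, $\lim_{i\to+\infty}\tau_i=+\infty$ and for every $x_0\in L^2([0,1])$, the unique function $x:\mathbb{R}_+\times[0,1]\to\mathbb{R}$ for which the mapping $\mathbb{R}_+\ni t\mapsto x[t]\in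 L^2([0,1])$ is continuous, with $x\in C^1(I\times[0,1])$ where $I=\mathbb{R}_+\setminus\{\tau_i,\ i=0,1,2,\dots\}$, satisfying $x[t]\in C^2([0,1])$ for all $t>0$, $x(0,z)=x_0(z)$ for all $z\in[0,1]$, and $$\frac{\partial x}{\partial t}(t,z)=p\frac{\partial^2x}{\partial z^2}(t,z)-q(z)x(t,z),\quad\text{for all }(t,z)\in I\times(0,1),$$ $$b_1x(t,0)+b_2\frac{\partial x}{\partial z}(t,0)=x(t,1)-u(t)=0,\quad\text{for all }t\in I,$$ $$u(t)=\int_0^1k(s)x(\tau_i,s)\,ds,\quad\text{for }t\in[\tau_i,\tau_{i+1})\text{ and for all integers }i\ge 0,$$ satisfies the estimate $$\|x[t]\|_2\le M\exp(-\sigma t)\|x_0\|_2,\quad\text{for all }t\ge 0.$$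
   Context: Notation: $\mathbb{R}_+=[0,+\infty)$; $x[t]$ denotes the profile $z\mapsto x(t,z)$; $\|f\|_2=\left(\int_0^1|f(z)|^2dz\right)^{1/2}$ for $f\in L^2([0,1])$. $H^2(0,1)$ is the Sobolev space of continuously differentiable functions on $[0,1]$ with measurable, square integrable second derivative. Eigenvalues: it is known that all eigenvalues of $A$ are real and form an infinite increasing sequence $\lambda_1<\lambda_2<\dots$ with $\lim_{n\to\infty}\lambda_n=+\infty$; to each $\lambda_n$ corresponds exactly one (normalized, up to sign) eigenfunction $\phi_n\in C^2([0,1];\mathbb{R})$ with $A\phi_n=\lambda_n\phi_n$ satisfying the boundary conditions of $D$; the $\phi_n$ form an orthonormal basis of $L^2([0,1])$. Backstepping kernel: it is known that for every $c\ge 0$ there exist functions $K,L\in C^2([0,1]^2)$ such that the Volterra transformation $$y(t,z)=x(t,z)-\int_0^zK(z,s)x(t,s)\,ds,\quad (t,z)\in\mathbb{R}_+\times[0,1],$$ with inverse $$x(t,z)=y(t,z)+\int_0^zL(z,s)y(t,s)\,ds,\quad (t,z)\in\mathbb{R}_+\times[0,1],$$ maps the solutions of the control system $$\frac{\partial x}{\partial t}(t,z)=p\frac{\partial^2x}{\partial z^2}(t,z)-q(z)x(t,z),\qquad b_1x(t,0)+b_2\frac{\partial x}{\partial z}(t,0)=x(t,1)-u(t)=0$$ (with state $x[t]$ and control input $u(t)$) to the solutions of $$\frac{\partial y}{\partial t}(t,z)-p\frac{\partial^2y}{\partial z^2}(t,z)+c\,y(t,z)=0,\qquad b_1y(t,0)+b_2\frac{\partial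 y}{\partial z}(t,0)=y(t,1)-u(t)+\int_0^1k(s)x(t,s)\,ds=0,$$ where $k(z)=K(1,z)$ for all $z\in[0,1]$. For the given $c$, $K$, $L$ and $k$ denote such functions. It is known that for $c\ge 0$ sufficiently large the closed-loop system with the continuous-time feedback $u(t)=\int_0^1k(s)x(t,s)\,ds$ is exponentially stable in the $L^2$ norm. *)

theory Defs
  imports "HOL-Analysis.Analysis"
begin

section \<open>Function spaces on the unit interval\<close>

text \<open>
  Profiles on \<open>[0,1]\<close> are total functions on the reals whose values outside \<open>[0,1]\<close> are irrelevant.
  The spatial derivative is taken within \<open>[0,1]\<close>, hence is one-sided at the two end points.
\<close>

definition dz :: "(real \<Rightarrow> real) \<Rightarrow> real \<Rightarrow> real" where
  "dz f z = vector_derivative f (at z within {0..1})"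

definition C1_01 :: "(real \<Rightarrow> real) \<Rightarrow> bool" where
  "C1_01 f \<longleftrightarrow> f differentiable_on {0..1} \<and> continuous_on {0..1} (dz f)"

definition C2_01 :: "(real \<Rightarrow> real) \<Rightarrow> bool" where
  "C2_01 f \<longleftrightarrow> C1_01 f \<and> C1_01 (dz f)"

definition L2_01 :: "(real \<Rightarrow> real) set" where
  "L2_01 = {f. f \<in> borel_measurable (lebesgue_on {0..1}) \<and>
               integrable (lebesgue_on {0..1}) (\<lambda>z. (f z)\<^sup>2)}"

definition inner_01 :: "(real \<Rightarrow> real) \<Rightarrow> (real \<Rightarrow> real) \<Rightarrow> real" where
  "inner_01 f g = (\<integral>z. f z * g z \<partial>lebesgue_on {0..1})"

definition norm_01 :: "(real \<Rightarrow> real) \<Rightarrow> real" where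
  "norm_01 f = sqrt (\<integral>z. \<bar>f z\<bar>\<^sup>2 \<partial>lebesgue_on {0..1})"

definition is_weak_dz2 :: "(real \<Rightarrow> real) \<Rightarrow> (real \<Rightarrow> real) \<Rightarrow> bool" where
  "is_weak_dz2 f g \<longleftrightarrow> g \<in> L2_01 \<and>
     (\<forall>z\<in>{0..1}. dz f z = dz f 0 + (\<integral>s. g s \<partial>lebesgue_on {0..z}))"

definition H2_01 :: "(real \<Rightarrow> real) set" where
  "H2_01 = {f. C1_01 f \<and> (\<exists>g. is_weak_dz2 f g)}"

text \<open>Determined up to a null set for functions in \<open>H2_01\<close>.\<close>

definition weak_dz2 :: "(real \<Rightarrow> real) \<Rightarrow> real \<Rightarrow> real" where
  "weak_dz2 f = (SOME g. is_weak_dz2 f g)"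


section \<open>The Sturm--Liouville operator\<close>

definition sl_domain :: "real \<Rightarrow> real \<Rightarrow> (real \<Rightarrow> real) set" where
  "sl_domain b1 b2 = {f \<in> H2_01. b1 * f 0 + b2 * dz f 0 = 0 \<and> f 1 = 0}"

definition sl_op :: "real \<Rightarrow> (real \<Rightarrow> real) \<Rightarrow> (real \<Rightarrow> real) \<Rightarrow> real \<Rightarrow> real" where
  "sl_op p q f z = - p * weak_dz2 f z + q z * f z"

definition sl_eigen_eq ::
  "real \<Rightarrow> (real \<Rightarrow> real) \<Rightarrow> real \<Rightarrow> real \<Rightarrow> real \<Rightarrow> (real \<Rightarrow> real) \<Rightarrow> bool" where
  "sl_eigen_eq p q b1 b2 l f \<longleftrightarrow> f \<in> sl_domain b1 b2 \<and>
     (AE z in lebesgue_on {0..1}. sl_op p q f z = l * f z)"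

definition sl_eigenvalue ::
  "real \<Rightarrow> (real \<Rightarrow> real) \<Rightarrow> real \<Rightarrow> real \<Rightarrow> real \<Rightarrow> bool" where
  "sl_eigenvalue p q b1 b2 l \<longleftrightarrow>
     (\<exists>f. sl_eigen_eq p q b1 b2 l f \<and> \<not> (AE z in lebesgue_on {0..1}. f z = 0))"

text \<open>
  The indices of \<open>lam\<close> and \<open>phi\<close> start at 1; the values at index 0 play no role.  That the eigenvalues
  of the operator can be listed in this way, with eigenfunctions of this kind, is the classical
  Sturm--Liouville theorem.
\<close>

definition sl_eigensystem ::
  "real \<Rightarrow> (real \<Rightarrow> real) \<Rightarrow> real \<Rightarrow> real \<Rightarrow> (nat \<Rightarrow> real) \<Rightarrow> (nat \<Rightarrow> real \<Rightarrow> real) \<Rightarrow> bool" where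
  "sl_eigensystem p q b1 b2 lam phi \<longleftrightarrow>
     strict_mono_on {1..} lam \<and>
     lam ` {1..} = {l. sl_eigenvalue p q b1 b2 l} \<and>
     filterlim lam at_top sequentially \<and>
     (\<forall>n\<ge>1. C2_01 (phi n) \<and> sl_eigen_eq p q b1 b2 (lam n) (phi n)) \<and>
     (\<forall>m\<ge>1. \<forall>n\<ge>1. inner_01 (phi m) (phi n) = (if m = n then 1 else 0)) \<and>
     (\<forall>f\<in>L2_01.
        (\<lambda>m. norm_01 (\<lambda>z. f z - (\<Sum>n=1..m. inner_01 f (phi n) * phi n z))) \<longlonglongrightarrow> 0)"


section \<open>Parabolic equations with boundary input\<close>

text \<open>
  The sets \<open>U\<close> and \<open>V\<close> will be relatively open subsets of the line or compact intervals, so that the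
  partial derivatives within them are unique; \<open>C1\<close> and \<open>C2\<close> are understood up to the boundary.
\<close>

definition has_partials_on ::
  "real set \<Rightarrow> real set \<Rightarrow> (real \<Rightarrow> real \<Rightarrow> real) \<Rightarrow> (real \<Rightarrow> real \<Rightarrow> real) \<Rightarrow>
   (real \<Rightarrow> real \<Rightarrow> real) \<Rightarrow> bool" where
  "has_partials_on U V f f1 f2 \<longleftrightarrow>
     (\<forall>t\<in>U. \<forall>z\<in>V. ((\<lambda>s. f s z) has_real_derivative f1 t z) (at t within U) \<and>
                    (f t has_real_derivative f2 t z) (at z within V))"

definition C1_on_Times :: "real set \<Rightarrow> real set \<Rightarrow> (real \<Rightarrow> real \<Rightarrow> real) \<Rightarrow> bool" where
  "C1_on_Times U V f \<longleftrightarrow> continuous_on (U \<times> V) (\<lambda>(t, z). f t z) \<and>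
     (\<exists>f1 f2. has_partials_on U V f f1 f2 \<and>
        continuous_on (U \<times> V) (\<lambda>(t, z). f1 t z) \<and> continuous_on (U \<times> V) (\<lambda>(t, z). f2 t z))"

definition C2_on_Times :: "real set \<Rightarrow> real set \<Rightarrow> (real \<Rightarrow> real \<Rightarrow> real) \<Rightarrow> bool" where
  "C2_on_Times U V f \<longleftrightarrow> continuous_on (U \<times> V) (\<lambda>(t, z). f t z) \<and>
     (\<exists>f1 f2. has_partials_on U V f f1 f2 \<and> C1_on_Times U V f1 \<and> C1_on_Times U V f2)"

text \<open>
  Classical solutions, on an open set \<open>I\<close> of times, of
  \<open>x\<^sub>t = p x\<^sub>z\<^sub>z - q x\<close>, \<open>b1 x(t,0) + b2 x\<^sub>z(t,0) = 0\<close>, \<open>x(t,1) = v(t)\<close>.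
\<close>

definition parabolic_solution ::
  "real \<Rightarrow> (real \<Rightarrow> real) \<Rightarrow> real \<Rightarrow> real \<Rightarrow> real set \<Rightarrow> (real \<Rightarrow> real) \<Rightarrow>
   (real \<Rightarrow> real \<Rightarrow> real) \<Rightarrow> bool" where
  "parabolic_solution p q b1 b2 I v x \<longleftrightarrow>
     C1_on_Times I {0..1} x \<and>
     (\<forall>t\<in>I. C2_01 (x t)) \<and>
     (\<forall>t\<in>I. \<forall>z\<in>{0<..<1}.
        deriv (\<lambda>s. x s z) t = p * dz (dz (x t)) z - q z * x t z) \<and>
     (\<forall>t\<in>I. b1 * x t 0 + b2 * dz (x t) 0 = 0 \<and> x t 1 - v t = 0)"

definition L2_trajectory :: "(real \<Rightarrow> real \<Rightarrow> real) \<Rightarrow> bool" where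
  "L2_trajectory x \<longleftrightarrow> (\<forall>t\<ge>0. x t \<in> L2_01) \<and>
     (\<forall>t\<ge>0. ((\<lambda>s. norm_01 (\<lambda>z. x s z - x t z)) \<longlongrightarrow> 0) (at t within {0..}))"


section \<open>Backstepping transformation\<close>

definition volterra :: "(real \<Rightarrow> real \<Rightarrow> real) \<Rightarrow> (real \<Rightarrow> real) \<Rightarrow> real \<Rightarrow> real" where
  "volterra K f z = (\<integral>s. K z s * f s \<partial>lebesgue_on {0..z})"

text \<open>
  The transformation \<open>y = x - volterra K x\<close>, whose inverse is \<open>x = y + volterra L y\<close>, carries the
  solutions of the control system with input \<open>u\<close> to the solutions of
  \<open>y\<^sub>t = p y\<^sub>z\<^sub>z - c y\<close>, \<open>b1 y(t,0) + b2 y\<^sub>z(t,0) = 0\<close>,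
  \<open>y(t,1) = u(t) - \<integral> K(1,s) x(t,s) ds\<close>.  As the transformation acts on each profile separately, this is
  required on every open set of positive times; sampled-data solutions are classical only away from
  the sampling instants.
\<close>

definition backstepping_kernels ::
  "real \<Rightarrow> (real \<Rightarrow> real) \<Rightarrow> real \<Rightarrow> real \<Rightarrow> real \<Rightarrow>
   (real \<Rightarrow> real \<Rightarrow> real) \<Rightarrow> (real \<Rightarrow> real \<Rightarrow> real) \<Rightarrow> bool" where
  "backstepping_kernels p q b1 b2 c K L \<longleftrightarrow>
     C2_on_Times {0..1} {0..1} K \<and> C2_on_Times {0..1} {0..1} L \<and>
     (\<forall>f\<in>L2_01. \<forall>g\<in>L2_01.
        (\<forall>z\<in>{0..1}. g z = f z - volterra K f z) \<longleftrightarrow>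
        (\<forall>z\<in>{0..1}. f z = g z + volterra L g z)) \<and>
     (\<forall>I u x. open I \<and> I \<subseteq> {0<..} \<and> (\<forall>t\<in>I. x t \<in> L2_01) \<longrightarrow>
        (parabolic_solution p q b1 b2 I u x \<longleftrightarrow>
         parabolic_solution p (\<lambda>_. c) b1 b2 I
           (\<lambda>t. u t - (\<integral>s. K 1 s * x t s \<partial>lebesgue_on {0..1}))
           (\<lambda>t z. x t z - volterra K (x t) z)))"


section \<open>Closed-loop systems\<close>

definition continuous_time_solution ::
  "real \<Rightarrow> (real \<Rightarrow> real) \<Rightarrow> real \<Rightarrow> real \<Rightarrow> (real \<Rightarrow> real) \<Rightarrow> (real \<Rightarrow> real \<Rightarrow> real) \<Rightarrow> bool" where
  "continuous_time_solution p q b1 b2 k x \<longleftrightarrow>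
     L2_trajectory x \<and>
     parabolic_solution p q b1 b2 {0<..} (\<lambda>t. \<integral>s. k s * x t s \<partial>lebesgue_on {0..1}) x"

definition continuous_time_exp_stable ::
  "real \<Rightarrow> (real \<Rightarrow> real) \<Rightarrow> real \<Rightarrow> real \<Rightarrow> (real \<Rightarrow> real) \<Rightarrow> bool" where
  "continuous_time_exp_stable p q b1 b2 k \<longleftrightarrow>
     (\<exists>M>0. \<exists>\<sigma>>0. \<forall>x. continuous_time_solution p q b1 b2 k x \<longrightarrow>
        (\<forall>t\<ge>0. norm_01 (x t) \<le> M * exp (- \<sigma> * t) * norm_01 (x 0)))"

definition sampled_solution ::
  "real \<Rightarrow> (real \<Rightarrow> real) \<Rightarrow> real \<Rightarrow> real \<Rightarrow> (real \<Rightarrow> real) \<Rightarrow> (nat \<Rightarrow> real) \<Rightarrow>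
   (real \<Rightarrow> real) \<Rightarrow> (real \<Rightarrow> real \<Rightarrow> real) \<Rightarrow> bool" where
  "sampled_solution p q b1 b2 k \<tau> x0 x \<longleftrightarrow>
     L2_trajectory x \<and>
     (\<forall>t>0. C2_01 (x t)) \<and>
     (\<forall>z\<in>{0..1}. x 0 z = x0 z) \<and>
     (\<exists>u. (\<forall>i. \<forall>t\<in>{\<tau> i..<\<tau> (Suc i)}. u t = (\<integral>s. k s * x (\<tau> i) s \<partial>lebesgue_on {0..1})) \<and>
          parabolic_solution p q b1 b2 ({0..} - range \<tau>) u x)"

end

theory Submission
  imports Defs
begin

text \<open>
  The sampled-data solution is the continuous-time closed loop perturbed by the boundary disturbance
  \<open>w(t) = \<integral> k(s) (x(\<tau>\<^sub>i,s) - x(t,s)) ds\<close>.  Expanding \<open>x\<close> in eigenfunctions, the coefficients obey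
  \<open>x\<^sub>n' = - \<lambda>\<^sub>n x\<^sub>n - p \<phi>\<^sub>n'(1) u\<close>.  The gain of the input over a short time is small because a function
  with value 1 at \<open>z = 1\<close> lifts the boundary input, and therefore \<open>w\<close> is small compared with
  \<open>x(\<tau>\<^sub>i)\<close> when the sampling is fast, uniformly in the sampling schedule.

  In the backstepping variable \<open>y\<close> the disturbance is the boundary value \<open>y(t,1)\<close>.  Stability of the
  continuous-time loop excludes unstable modes of \<open>y\<^sub>t = p y\<^sub>z\<^sub>z - c y\<close>, and this gives a
  positive solution \<open>\<phi>\<close> of \<open>p \<phi>'' = c \<phi>\<close> with the boundary condition at 0 (when that condition is not of
  Dirichlet type).  The weighted norm of the primitive of \<open>\<phi> y\<close> is then a Lyapunov functional in which the
  disturbance enters boundedly: over a long time interval \<open>y\<close> must be small in \<open>L\<^sup>2\<close> at some instant.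
  Propagating this to the next sampling time shows that \<open>\<parallel>x\<parallel>\<^sup>2\<close> is halved within time windows of fixed
  length.

  Existence is obtained from a smoothing eigenfunction series added to a lift of the constant input;
  uniqueness follows from the equations for the coefficients.
\<close>

section \<open>The space \<open>L\<^sup>2([0,1])\<close>\<close>

text \<open>The obstacle is that a boundary disturbance is unbounded in \<open>L2\<close>:
  differentiating the squared norm of \<open>y\<close> produces the flux \<open>y_z(t,1)\<close>
  times \<open>w(t)\<close>, which the norm cannot control. A primitive of \<open>y\<close> sees the
  same \<open>w\<close> as a Neumann datum, paired with the primitive itself. The price is a
  functional weaker than the norm: it cannot bound the norm at a prescribed instant, but its
  dissipation is the squared norm, so the norm cannot stay large for long. Nothing quantitative is
  known about \<open>c\<close>; when \<open>b2\<close> is nonzero, stability of the continuous loop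
  is the only source of the positivity of \<open>\<phi>\<close>, through separated solutions that
  would fail to decay. Positivity allows division by \<open>\<phi>\<close>, after which the
  zero-order term vanishes or acts as damping. The constants must not be circular. The window length
  is fixed first, then the growth \<open>C\<close> over it, valid for every schedule whether fast or
  slow, then the tolerated feedback error, and the bound \<open>T\<close> on the sampling period
  last.\<close>

abbreviation "M01 \<equiv> lebesgue_on {0..1::real}"

lemma inner_01_cong:
  assumes "\<And>z. z \<in> {0..1} \<Longrightarrow> f z = f' z" "\<And>z. z \<in> {0..1} \<Longrightarrow> g z = g' z"
  shows "inner_01 f g = inner_01 f' g'"
  unfolding inner_01_def by (rule Bochner_Integration.integral_cong) (use assms in auto)

lemma norm_01_cong:
  assumes "\<And>z. z \<in> {0..1} \<Longrightarrow> f z = g z"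
  shows "norm_01 f = norm_01 g"
  unfolding norm_01_def by (intro arg_cong[where f=sqrt] Bochner_Integration.integral_cong) (use assms in auto)

lemma norm_01_eq_inner: "norm_01 f = sqrt (inner_01 f f)"
  by (simp add: norm_01_def inner_01_def power2_eq_square)

lemma inner_01_self_nonneg: "0 \<le> inner_01 f f"
  by (simp add: inner_01_def)

lemma norm_01_nonneg [simp]: "0 \<le> norm_01 f"
  by (simp add: norm_01_eq_inner inner_01_self_nonneg)

lemma norm_01_squared: "(norm_01 f)\<^sup>2 = inner_01 f f"
  by (simp add: norm_01_eq_inner inner_01_self_nonneg)

lemma L2_01_measurable: "f \<in> L2_01 \<Longrightarrow> f \<in> borel_measurable M01"
  by (simp add: L2_01_def)

lemma L2_01_mult_integrable:
  assumes "f \<in> L2_01" "g \<in> L2_01"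
  shows "integrable M01 (\<lambda>z. f z * g z)"
proof (rule Bochner_Integration.integrable_bound)
  show "integrable M01 (\<lambda>z. (f z)\<^sup>2 + (g z)\<^sup>2)"
    using assms by (auto simp: L2_01_def)
  show "(\<lambda>z. f z * g z) \<in> borel_measurable M01"
    using assms by (auto simp: L2_01_def)
  have "\<bar>f z * g z\<bar> \<le> (f z)\<^sup>2 + (g z)\<^sup>2" for z
  proof -
    have "2 * \<bar>f z * g z\<bar> \<le> (f z)\<^sup>2 + (g z)\<^sup>2"
      using sum_squares_bound[of "\<bar>f z\<bar>" "\<bar>g z\<bar>"] by (simp add: abs_mult mult.assoc)
    then show ?thesis using abs_ge_zero[of "f z * g z"] by linarith
  qed
  then show "AE z in M01. norm (f z * g z) \<le> norm ((f z)\<^sup>2 + (g z)\<^sup>2)"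
    by auto
qed

lemma L2_01_scale: "f \<in> L2_01 \<Longrightarrow> (\<lambda>z. a * f z) \<in> L2_01"
  by (auto simp: L2_01_def power_mult_distrib)

lemma L2_01_add:
  assumes "f \<in> L2_01" "g \<in> L2_01"
  shows "(\<lambda>z. f z + g z) \<in> L2_01"
proof -
  have "integrable M01 (\<lambda>z. (f z)\<^sup>2 + (g z)\<^sup>2 + 2 * (f z * g z))"
    using assms L2_01_mult_integrable[OF assms] by (auto simp: L2_01_def)
  then show ?thesis
    using assms by (auto simp: L2_01_def power2_sum algebra_simps)
qed

lemma L2_01_diff:
  assumes "f \<in> L2_01" "g \<in> L2_01"
  shows "(\<lambda>z. f z - g z) \<in> L2_01"
  using L2_01_add[OF assms(1) L2_01_scale[OF assms(2), of "-1"]] by simp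

lemma L2_01_zero: "(\<lambda>z. 0) \<in> L2_01"
  by (simp add: L2_01_def)

lemma L2_01_sum:
  assumes "\<And>i. i \<in> A \<Longrightarrow> f i \<in> L2_01"
  shows "(\<lambda>z. \<Sum>i\<in>A. f i z) \<in> L2_01"
  using assms by (induction A rule: infinite_finite_induct) (auto simp: L2_01_zero L2_01_add)

lemma continuous_on_imp_L2_01:
  assumes "continuous_on {0..1} f"
  shows "f \<in> L2_01"
proof -
  have "integrable M01 f" "integrable M01 (\<lambda>z. (f z)\<^sup>2)"
    using assms by (intro continuous_imp_integrable_real continuous_intros; simp)+
  then show ?thesis by (simp add: L2_01_def borel_measurable_integrable)
qed

lemma inner_01_commute: "inner_01 f g = inner_01 g f"
  by (simp add: inner_01_def mult.commute)

lemma inner_01_add_left: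
  assumes "f \<in> L2_01" "g \<in> L2_01" "h \<in> L2_01"
  shows "inner_01 (\<lambda>z. f z + g z) h = inner_01 f h + inner_01 g h"
  using assms by (simp add: inner_01_def distrib_right L2_01_mult_integrable)

lemma inner_01_diff_left:
  assumes "f \<in> L2_01" "g \<in> L2_01" "h \<in> L2_01"
  shows "inner_01 (\<lambda>z. f z - g z) h = inner_01 f h - inner_01 g h"
  using assms by (simp add: inner_01_def left_diff_distrib L2_01_mult_integrable)

lemma inner_01_scale_left: "inner_01 (\<lambda>z. a * f z) h = a * inner_01 f h"
  by (simp add: inner_01_def mult.assoc)

lemma inner_01_sum_left:
  assumes "\<And>i. i \<in> A \<Longrightarrow> f i \<in> L2_01" "h \<in> L2_01"
  shows "inner_01 (\<lambda>z. \<Sum>i\<in>A. f i z) h = (\<Sum>i\<in>A. inner_01 (f i) h)"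
  using assms by (simp add: inner_01_def sum_distrib_right L2_01_mult_integrable)

lemma inner_01_diff_right:
  assumes "f \<in> L2_01" "g \<in> L2_01" "h \<in> L2_01"
  shows "inner_01 h (\<lambda>z. f z - g z) = inner_01 h f - inner_01 h g"
  using inner_01_diff_left[OF assms] by (simp add: inner_01_commute)

lemma inner_01_add_right:
  assumes "f \<in> L2_01" "g \<in> L2_01" "h \<in> L2_01"
  shows "inner_01 h (\<lambda>z. f z + g z) = inner_01 h f + inner_01 h g"
  using inner_01_add_left[OF assms] by (simp add: inner_01_commute)

lemma inner_01_scale_right: "inner_01 h (\<lambda>z. a * f z) = a * inner_01 h f"
  using inner_01_scale_left[of a f h] by (simp add: inner_01_commute)

lemma inner_01_square_diff:
  assumes "f \<in> L2_01" "g \<in> L2_01"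
  shows "inner_01 (\<lambda>z. f z - g z) (\<lambda>z. f z - g z) = inner_01 f f - 2 * inner_01 f g + inner_01 g g"
  using assms by (simp add: inner_01_diff_left inner_01_diff_right L2_01_diff inner_01_commute[of g f])

text \<open>This is the discriminant of the nonnegative quadratic in \<open>a\<close> given by the
  squared norm of \<open>f - a g\<close>. Elements of \<open>L2_01\<close> are functions rather than
  classes, so \<open>inner_01 g g = 0\<close> does not give \<open>g = 0\<close> and the degenerate
  case is argued separately.\<close>

lemma inner_01_Cauchy_Schwarz_square:
  assumes "f \<in> L2_01" "g \<in> L2_01"
  shows "(inner_01 f g)\<^sup>2 \<le> inner_01 f f * inner_01 g g"
proof -
  have pos: "0 \<le> inner_01 f f - 2 * a * inner_01 f g + a\<^sup>2 * inner_01 g g" for a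
    using inner_01_self_nonneg[of "\<lambda>z. f z - a * g z"]
      inner_01_square_diff[OF assms(1) L2_01_scale[OF assms(2)], of a]
    by (simp add: inner_01_scale_left inner_01_scale_right power2_eq_square algebra_simps)
  show ?thesis
  proof (cases "inner_01 g g = 0")
    case True
    have "inner_01 f g = 0"
    proof (rule ccontr)
      assume n: "inner_01 f g \<noteq> 0"
      \<comment> \<open>For vanishing \<open>inner_01 g g\<close> the quadratic is affine in
        \<open>a\<close>; this \<open>a\<close> is where it takes the value -1.\<close>
      have "0 \<le> inner_01 f f - 2 * ((inner_01 f f + 1) / (2 * inner_01 f g)) * inner_01 f g"
        using pos[of "(inner_01 f f + 1) / (2 * inner_01 f g)"] True by simp
      also have "\<dots> = -1" using n by (simp add: field_simps)
      finally show False by simp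
    qed
    then show ?thesis using True by simp
  next
    case False
    then have gp: "inner_01 g g > 0" using inner_01_self_nonneg[of g] by simp
    have "0 \<le> inner_01 f f - (inner_01 f g)\<^sup>2 / inner_01 g g"
      using pos[of "inner_01 f g / inner_01 g g"] False
      by (simp add: power2_eq_square field_simps)
    then show ?thesis using gp by (simp add: field_simps)
  qed
qed

lemma inner_01_Cauchy_Schwarz:
  assumes "f \<in> L2_01" "g \<in> L2_01"
  shows "\<bar>inner_01 f g\<bar> \<le> norm_01 f * norm_01 g"
  using real_sqrt_le_mono[OF inner_01_Cauchy_Schwarz_square[OF assms]]
  by (simp add: norm_01_eq_inner real_sqrt_mult)

lemma norm_01_triangle:
  assumes "f \<in> L2_01" "g \<in> L2_01"
  shows "norm_01 (\<lambda>z. f z + g z) \<le> norm_01 f + norm_01 g"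
proof (rule power2_le_imp_le)
  have "(norm_01 (\<lambda>z. f z + g z))\<^sup>2 = inner_01 f f + 2 * inner_01 f g + inner_01 g g"
    using assms by (simp add: norm_01_squared inner_01_add_left L2_01_add
      inner_01_add_right inner_01_commute[of g f])
  also have "\<dots> \<le> (norm_01 f + norm_01 g)\<^sup>2"
    using inner_01_Cauchy_Schwarz[OF assms] by (simp add: power2_sum norm_01_squared)
  finally show "(norm_01 (\<lambda>z. f z + g z))\<^sup>2 \<le> (norm_01 f + norm_01 g)\<^sup>2" .
qed simp

lemma norm_01_scale: "norm_01 (\<lambda>z. a * f z) = \<bar>a\<bar> * norm_01 f"
proof -
  have "inner_01 (\<lambda>z. a * f z) (\<lambda>z. a * f z) = a\<^sup>2 * inner_01 f f"
    by (simp add: inner_01_scale_left inner_01_scale_right power2_eq_square)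
  then show ?thesis by (simp add: norm_01_eq_inner real_sqrt_mult)
qed

lemma norm_01_diff_commute: "norm_01 (\<lambda>z. f z - g z) = norm_01 (\<lambda>z. g z - f z)"
  by (simp add: norm_01_def power2_commute)

lemma norm_01_reverse_triangle:
  assumes "f \<in> L2_01" "g \<in> L2_01"
  shows "\<bar>norm_01 f - norm_01 g\<bar> \<le> norm_01 (\<lambda>z. f z - g z)"
proof -
  have "norm_01 f \<le> norm_01 (\<lambda>z. f z - g z) + norm_01 g"
    using norm_01_triangle[OF L2_01_diff[OF assms] assms(2)] by simp
  moreover have "norm_01 g \<le> norm_01 (\<lambda>z. g z - f z) + norm_01 f"
    using norm_01_triangle[OF L2_01_diff[OF assms(2,1)] assms(1)] by simp
  ultimately show ?thesis using norm_01_diff_commute[of f g] by linarith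
qed

lemma norm_01_bound:
  assumes "f \<in> borel_measurable M01" "\<And>z. z \<in> {0..1} \<Longrightarrow> \<bar>f z\<bar> \<le> B"
  shows "f \<in> L2_01" "norm_01 f \<le> B"
proof -
  have B: "B \<ge> 0" using assms(2)[of 0] by simp
  have le: "(f z)\<^sup>2 \<le> B\<^sup>2" if "z \<in> {0..1}" for z
    using assms(2)[OF that] B by (metis abs_ge_zero power2_abs power_mono)
  have i: "integrable M01 (\<lambda>z. (f z)\<^sup>2)"
    by (rule Bochner_Integration.integrable_bound[where f="\<lambda>z. B\<^sup>2"])
      (use assms le in \<open>auto intro!: continuous_imp_integrable_real AE_I2\<close>)
  then show "f \<in> L2_01" using assms by (simp add: L2_01_def)
  have "inner_01 f f \<le> (\<integral>z. B\<^sup>2 \<partial>M01)"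
    unfolding inner_01_def
    by (rule integral_mono) (use i le in \<open>auto simp: power2_eq_square intro!: continuous_imp_integrable_real\<close>)
  also have "\<dots> = B\<^sup>2" by (simp add: measure_restrict_space)
  finally show "norm_01 f \<le> B"
    using B by (simp add: norm_01_eq_inner real_le_lsqrt)
qed

lemma inner_01_continuous:
  assumes "continuous_on {0..1} f" "continuous_on {0..1} g"
  shows "inner_01 f g = integral {0..1} (\<lambda>z. f z * g z)"
  unfolding inner_01_def
  by (rule lebesgue_integral_eq_integral) (use assms in \<open>auto intro!: continuous_imp_integrable_real continuous_intros\<close>)

text \<open>A zero norm determines a function only almost everywhere. Continuity upgrades this to
  every point, which pointwise uniqueness of solutions requires.\<close>

lemma continuous_norm_01_eq_0:
  assumes "continuous_on {0..1} f" "norm_01 f = 0" "z \<in> {0..1}"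
  shows "f z = 0"
proof -
  have "integral {0..1} (\<lambda>z. f z * f z) = 0"
    using assms inner_01_continuous[OF assms(1,1)] by (simp add: norm_01_eq_inner)
  moreover have "((\<lambda>z. f z * f z) has_integral integral {0..1} (\<lambda>z. f z * f z)) {0..1}"
    using assms by (intro integrable_integral integrable_continuous_real continuous_intros)
  ultimately have "f z * f z = 0"
    using has_integral_0_cbox_imp_0[of 0 1 "\<lambda>z. f z * f z" z] assms
    by (auto intro!: continuous_intros)
  then show ?thesis by simp
qed

lemma inner_01_tendsto:
  assumes "\<forall>\<^sub>F t in F. f t \<in> L2_01" "g \<in> L2_01" "h \<in> L2_01"
    "((\<lambda>t. norm_01 (\<lambda>z. f t z - g z)) \<longlongrightarrow> 0) F"
  shows "((\<lambda>t. inner_01 (f t) h) \<longlongrightarrow> inner_01 g h) F"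
proof -
  have "((\<lambda>t. inner_01 (f t) h - inner_01 g h) \<longlongrightarrow> 0) F"
  proof (rule Lim_null_comparison)
    show "\<forall>\<^sub>F t in F. norm (inner_01 (f t) h - inner_01 g h) \<le> norm_01 (\<lambda>z. f t z - g z) * norm_01 h"
      using assms(1)
    proof eventually_elim
      case (elim t)
      then show ?case
        using inner_01_Cauchy_Schwarz[OF L2_01_diff[OF elim assms(2)] assms(3)]
        by (simp add: inner_01_diff_left assms(2,3))
    qed
    show "((\<lambda>t. norm_01 (\<lambda>z. f t z - g z) * norm_01 h) \<longlongrightarrow> 0) F"
      using tendsto_mult[OF assms(4) tendsto_const[of "norm_01 h"]] by simp
  qed
  then show ?thesis by (simp add: LIM_zero_iff)
qed

section \<open>Derivatives on the unit interval\<close>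

lemma has_real_derivative_transform:
  fixes f g :: "real \<Rightarrow> real"
  assumes "(f has_real_derivative d) (at z within S)" "z \<in> S" "\<And>z. z \<in> S \<Longrightarrow> g z = f z"
  shows "(g has_real_derivative d) (at z within S)"
  using assms has_vector_derivative_transform[of z S g f d]
  by (simp add: has_real_derivative_iff_has_vector_derivative)

lemma dz_eqI:
  assumes "(f has_real_derivative d) (at z within {0..1})" "z \<in> {0..1}"
  shows "dz f z = d"
  unfolding dz_def
  by (rule vector_derivative_within_cbox[where a=0 and b=1, simplified])
    (use assms in \<open>auto simp: has_real_derivative_iff_has_vector_derivative\<close>)

lemma differentiable_on_dz:
  assumes "f differentiable_on {0..1}" "z \<in> {0..1}"
  shows "(f has_real_derivative dz f z) (at z within {0..1})"
proof -
  obtain d where "(f has_real_derivative d) (at z within {0..1})"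
    using assms unfolding differentiable_on_def real_differentiable_def by blast
  then show ?thesis using dz_eqI[of f d z] assms by simp
qed

lemma C2_01D:
  assumes "C2_01 f"
  shows "\<And>z. z \<in> {0..1} \<Longrightarrow> (f has_real_derivative dz f z) (at z within {0..1})"
    "\<And>z. z \<in> {0..1} \<Longrightarrow> (dz f has_real_derivative dz (dz f) z) (at z within {0..1})"
    "continuous_on {0..1} f" "continuous_on {0..1} (dz f)" "continuous_on {0..1} (dz (dz f))"
  using assms unfolding C2_01_def C1_01_def
  by (auto intro: differentiable_on_dz differentiable_imp_continuous_on)

lemma C2_01I:
  assumes 1: "\<And>z. z \<in> {0..1} \<Longrightarrow> (f has_real_derivative f1 z) (at z within {0..1})"
    and 2: "\<And>z. z \<in> {0..1} \<Longrightarrow> (f1 has_real_derivative f2 z) (at z within {0..1})"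
    and 3: "continuous_on {0..1} f2"
  shows "C2_01 f" "\<And>z. z \<in> {0..1} \<Longrightarrow> dz f z = f1 z" "\<And>z. z \<in> {0..1} \<Longrightarrow> dz (dz f) z = f2 z"
proof -
  show d1: "dz f z = f1 z" if "z \<in> {0..1}" for z
    using dz_eqI[OF 1[OF that] that] .
  have h2: "(dz f has_real_derivative f2 z) (at z within {0..1})" if "z \<in> {0..1}" for z
    by (rule has_real_derivative_transform[OF 2[OF that] that d1])
  show d2: "dz (dz f) z = f2 z" if "z \<in> {0..1}" for z
    using dz_eqI[OF h2[OF that] that] .
  have "f differentiable_on {0..1}" "dz f differentiable_on {0..1}"
    using 1 h2 unfolding differentiable_on_def real_differentiable_def by blast+
  moreover have "continuous_on {0..1} (dz f)"
    using h2 by (meson DERIV_continuous_on)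
  moreover have "continuous_on {0..1} (dz (dz f))"
    using 3 by (rule continuous_on_cong[THEN iffD1, rotated 2]) (auto simp: d2)
  ultimately show "C2_01 f"
    by (simp add: C2_01_def C1_01_def)
qed

text \<open>Agreement holds on the unit interval alone, and \<open>dz f\<close> and
  \<open>dz g\<close> may differ outside it, so equality has to be transferred once for each
  derivative.\<close>

lemma C2_01_cong:
  assumes "\<And>z. z \<in> {0..1} \<Longrightarrow> f z = g z" "C2_01 f"
  shows "C2_01 g" "\<And>z. z \<in> {0..1} \<Longrightarrow> dz g z = dz f z" "\<And>z. z \<in> {0..1} \<Longrightarrow> dz (dz g) z = dz (dz f) z"
proof -
  note D = C2_01D[OF assms(2)]
  have g: "(g has_real_derivative dz f z) (at z within {0..1})" if "z \<in> {0..1}" for z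
    by (rule has_real_derivative_transform[OF D(1)[OF that] that]) (simp add: assms(1))
  note I = C2_01I[OF g D(2,5)]
  show "C2_01 g" "\<And>z. z \<in> {0..1} \<Longrightarrow> dz g z = dz f z" "\<And>z. z \<in> {0..1} \<Longrightarrow> dz (dz g) z = dz (dz f) z"
    using I by auto
qed

lemma C2_01_lincomb:
  assumes "C2_01 f" "C2_01 g"
  shows "C2_01 (\<lambda>z. a * f z + b * g z)"
    "\<And>z. z \<in> {0..1} \<Longrightarrow> dz (\<lambda>z. a * f z + b * g z) z = a * dz f z + b * dz g z"
    "\<And>z. z \<in> {0..1} \<Longrightarrow> dz (dz (\<lambda>z. a * f z + b * g z)) z = a * dz (dz f) z + b * dz (dz g) z"
proof -
  note D = C2_01D[OF assms(1)] and E = C2_01D[OF assms(2)]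
  have 1: "((\<lambda>z. a * f z + b * g z) has_real_derivative a * dz f z + b * dz g z) (at z within {0..1})"
    if "z \<in> {0..1}" for z
    using D(1)[OF that] E(1)[OF that] by (auto intro!: derivative_eq_intros)
  have 2: "((\<lambda>z. a * dz f z + b * dz g z) has_real_derivative a * dz (dz f) z + b * dz (dz g) z) (at z within {0..1})"
    if "z \<in> {0..1}" for z
    using D(2)[OF that] E(2)[OF that] by (auto intro!: derivative_eq_intros)
  have 3: "continuous_on {0..1} (\<lambda>z. a * dz (dz f) z + b * dz (dz g) z)"
    using D(5) E(5) by (intro continuous_intros)
  show "C2_01 (\<lambda>z. a * f z + b * g z)"
    "\<And>z. z \<in> {0..1} \<Longrightarrow> dz (\<lambda>z. a * f z + b * g z) z = a * dz f z + b * dz g z"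
    "\<And>z. z \<in> {0..1} \<Longrightarrow> dz (dz (\<lambda>z. a * f z + b * g z)) z = a * dz (dz f) z + b * dz (dz g) z"
    using C2_01I[OF 1 2 3] by auto
qed

text \<open>The integrand is the derivative of the Wronskian. The upper limit \<open>a\<close> is
  free because the Lyapunov functional applies the identity on \<open>{0..z}\<close>.\<close>

lemma Green_01:
  assumes "\<And>z. z \<in> {0..1} \<Longrightarrow> (f has_real_derivative f1 z) (at z within {0..1})"
    and "\<And>z. z \<in> {0..1} \<Longrightarrow> (f1 has_real_derivative f2 z) (at z within {0..1})"
    and "\<And>z. z \<in> {0..1} \<Longrightarrow> (g has_real_derivative g1 z) (at z within {0..1})"
    and "\<And>z. z \<in> {0..1} \<Longrightarrow> (g1 has_real_derivative g2 z) (at z within {0..1})"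
    and "a \<in> {0..1}"
  shows "((\<lambda>z. f2 z * g z - f z * g2 z) has_integral
           (f1 a * g a - f a * g1 a) - (f1 0 * g 0 - f 0 * g1 0)) {0..a}"
proof -
  have d: "((\<lambda>z. f1 z * g z - f z * g1 z) has_real_derivative f2 z * g z - f z * g2 z) (at z within {0..1})"
    if "z \<in> {0..1}" for z
    using assms(1-4)[OF that] by (auto intro!: derivative_eq_intros)
  have "((\<lambda>z. f1 z * g z - f z * g1 z) has_vector_derivative f2 z * g z - f z * g2 z) (at z within {0..a})"
    if "z \<in> {0..a}" for z
  proof -
    have "z \<in> {0..1}" "{0..a} \<subseteq> {0..1}" using that assms(5) by auto
    then show ?thesis
      using d has_vector_derivative_within_subset
      unfolding has_real_derivative_iff_has_vector_derivative by blast
  qed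
  then show ?thesis
    using fundamental_theorem_of_calculus[of 0 a "\<lambda>z. f1 z * g z - f z * g1 z"] assms(5) by auto
qed

section \<open>Differential inequalities\<close>

text \<open>The exceptional set absorbs the sampling instants, where a trajectory is continuous but
  has no time derivative in general.\<close>

lemma nonneg_derivative_except_finite:
  fixes f :: "real \<Rightarrow> real"
  assumes "a \<le> b" "finite S" "continuous_on {a..b} f"
    and "\<And>t. t \<in> {a<..<b} - S \<Longrightarrow> (f has_real_derivative f' t) (at t)"
    and "\<And>t. t \<in> {a<..<b} - S \<Longrightarrow> 0 \<le> f' t"
  shows "f a \<le> f b"
proof -
  define g where "g = (\<lambda>t. if t \<in> {a<..<b} - S then f' t else 0)"
  have "(g has_integral f b - f a) {a..b}"
    by (rule fundamental_theorem_of_calculus_interior_strong[OF assms(2,1) _ assms(3)])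
      (use assms(4) in \<open>auto simp: g_def has_real_derivative_iff_has_vector_derivative\<close>)
  moreover have "0 \<le> g t" for t using assms(5) by (simp add: g_def)
  ultimately have "0 \<le> f b - f a" by (rule has_integral_nonneg)
  then show ?thesis by simp
qed

lemma derivative_bound_except_finite:
  fixes f g :: "real \<Rightarrow> real"
  assumes "a \<le> b" "finite S" "continuous_on {a..b} f" "continuous_on {a..b} g"
    and "\<And>t. t \<in> {a<..<b} - S \<Longrightarrow> (f has_real_derivative f' t) (at t)"
    and "\<And>t. t \<in> {a<..<b} - S \<Longrightarrow> (g has_real_derivative g' t) (at t)"
    and "\<And>t. t \<in> {a<..<b} - S \<Longrightarrow> \<bar>f' t\<bar> \<le> g' t"
  shows "\<bar>f b - f a\<bar> \<le> g b - g a"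
proof -
  have "g a - f a \<le> g b - f b"
    by (rule nonneg_derivative_except_finite[where f="\<lambda>t. g t - f t" and f'="\<lambda>t. g' t - f' t", OF assms(1,2)])
      (use assms(3-7) in \<open>auto intro!: continuous_intros derivative_eq_intros dest: abs_le_D1 simp: greaterThanLessThan_iff\<close>)
  moreover have "g a + f a \<le> g b + f b"
  proof (rule nonneg_derivative_except_finite[where f="\<lambda>t. g t + f t" and f'="\<lambda>t. g' t + f' t", OF assms(1,2)])
    show "0 \<le> g' t + f' t" if "t \<in> {a<..<b} - S" for t
      using assms(7)[OF that] by linarith
  qed (use assms(3-6) in \<open>auto intro!: continuous_intros derivative_eq_intros\<close>)
  ultimately show ?thesis by linarith
qed

text \<open>The integral of \<open>\<lambda>r. exp (- a * r)\<close> from \<open>0\<close> to \<open>s\<close>.\<close>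

definition exp_integral :: "real \<Rightarrow> real \<Rightarrow> real" where
  "exp_integral a s = (if a = 0 then s else (1 - exp (- a * s)) / a)"

lemma mult_exp_integral: "a * exp_integral a s = 1 - exp (- a * s)"
  by (simp add: exp_integral_def)

lemma exp_integral_nonneg: "0 \<le> s \<Longrightarrow> 0 \<le> exp_integral a s"
  by (auto simp: exp_integral_def zero_le_divide_iff zero_le_mult_iff mult_le_0_iff)

lemma exp_integral_has_derivative: "(exp_integral a has_real_derivative exp (- a * s)) (at s)"
proof (cases "a = 0")
  case True
  then show ?thesis by (simp add: exp_integral_def[abs_def])
next
  case False
  then have "((\<lambda>s. (1 - exp (- a * s)) / a) has_real_derivative exp (- a * s)) (at s)"
    by (auto intro!: derivative_eq_intros)
  then show ?thesis using False by (simp add: exp_integral_def[abs_def])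
qed

text \<open>Variation of constants for a bounded input. Stating the gain through
  \<open>exp_integral\<close> avoids dividing by \<open>l\<close>, so a zero eigenvalue is no
  special case.\<close>

lemma linear_ode_bound:
  fixes y v :: "real \<Rightarrow> real"
  assumes "a \<le> b" "finite S" "continuous_on {a..b} y"
    and "\<And>t. t \<in> {a<..<b} - S \<Longrightarrow> (y has_real_derivative - l * y t + c * v t) (at t)"
    and "\<And>t. t \<in> {a<..<b} - S \<Longrightarrow> \<bar>v t\<bar> \<le> U"
  shows "\<bar>y b - exp (- l * (b - a)) * y a\<bar> \<le> U * (\<bar>c\<bar> * exp_integral l (b - a))"
proof -
  define f where "f = (\<lambda>t. exp (l * t) * y t)"
  \<comment> \<open>\<open>g\<close> is the majorant of \<open>f\<close>: its derivative is
    \<open>U * \<bar>c\<bar> * exp (l * t)\<close>, the largest modulus that the derivative of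
    \<open>f\<close> can have.\<close>
  define g where "g = (\<lambda>t. U * \<bar>c\<bar> * exp (l * a) * exp_integral (- l) (t - a))"
  have fg: "\<bar>f b - f a\<bar> \<le> g b - g a"
  proof (rule derivative_bound_except_finite[OF assms(1,2)])
    show "continuous_on {a..b} f"
      unfolding f_def by (intro continuous_intros assms(3))
    have g': "(g has_real_derivative U * \<bar>c\<bar> * exp (l * t)) (at t)" for t
      unfolding g_def by (auto intro!: derivative_eq_intros DERIV_chain2[OF exp_integral_has_derivative]
          simp: exp_add[symmetric] algebra_simps)
    show "continuous_on {a..b} g"
      by (intro continuous_at_imp_continuous_on ballI DERIV_isCont[OF g'])
    show "(g has_real_derivative U * \<bar>c\<bar> * exp (l * t)) (at t)" for t
      by (rule g')
    show "(f has_real_derivative exp (l * t) * (c * v t)) (at t)" if "t \<in> {a<..<b} - S" for t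
      unfolding f_def using assms(4)[OF that] by (auto intro!: derivative_eq_intros simp: algebra_simps)
    show "\<bar>exp (l * t) * (c * v t)\<bar> \<le> U * \<bar>c\<bar> * exp (l * t)" if "t \<in> {a<..<b} - S" for t
      using mult_right_mono[OF assms(5)[OF that], of "\<bar>c\<bar> * exp (l * t)"] by (simp add: abs_mult algebra_simps)
  qed
  have shift: "exp (- l * b) * exp (l * a) * exp_integral (- l) (b - a) = exp_integral l (b - a)"
    by (cases "l = 0") (auto simp: exp_integral_def field_simps simp flip: exp_add)
  have "\<bar>y b - exp (- l * (b - a)) * y a\<bar> = exp (- l * b) * \<bar>f b - f a\<bar>"
  proof -
    have "y b - exp (- l * (b - a)) * y a = exp (- l * b) * (f b - f a)"
      by (simp add: f_def right_diff_distrib mult.assoc[symmetric] flip: exp_add)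
    then show ?thesis by (simp add: abs_mult)
  qed
  also have "\<dots> \<le> exp (- l * b) * (g b - g a)"
    using fg by simp
  also have "\<dots> = U * \<bar>c\<bar> * (exp (- l * b) * exp (l * a) * exp_integral (- l) (b - a))"
    by (simp add: g_def) (simp add: exp_integral_def)
  finally show ?thesis using shift by (simp add: mult.assoc)
qed

section \<open>Trajectories of parabolic equations\<close>

text \<open>The equation is assumed at interior points only. Both sides are continuous in
  \<open>z\<close>, so it persists at the end points, and integrals over the closed interval can use
  it.\<close>

lemma parabolic_time_derivative:
  assumes "parabolic_solution p q b1 b2 I v x" "open I" "continuous_on {0..1} q"
  obtains x1 where "continuous_on (I \<times> {0..1}) (\<lambda>(t, z). x1 t z)"
    "\<And>t z. t \<in> I \<Longrightarrow> z \<in> {0..1} \<Longrightarrow> ((\<lambda>s. x s z) has_real_derivative x1 t z) (at t)"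
    "\<And>t z. t \<in> I \<Longrightarrow> z \<in> {0..1} \<Longrightarrow> x1 t z = p * dz (dz (x t)) z - q z * x t z"
proof -
  obtain x1 x2 where x1: "has_partials_on I {0..1} x x1 x2" "continuous_on (I \<times> {0..1}) (\<lambda>(t, z). x1 t z)"
    using assms(1) unfolding parabolic_solution_def C1_on_Times_def by blast
  have d: "((\<lambda>s. x s z) has_real_derivative x1 t z) (at t)" if "t \<in> I" "z \<in> {0..1}" for t z
    using x1(1) that assms(2) unfolding has_partials_on_def by (metis at_within_open)
  have eq: "x1 t z = p * dz (dz (x t)) z - q z * x t z" if "t \<in> I" "z \<in> {0..1}" for t z
  proof -
    let ?g = "\<lambda>z. x1 t z - (p * dz (dz (x t)) z - q z * x t z)"
    have C: "C2_01 (x t)" using assms(1) that unfolding parabolic_solution_def by blast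
    have "continuous_on {0..1} (\<lambda>z. (\<lambda>(t, z). x1 t z) (t, z))"
      by (rule continuous_on_compose2[OF x1(2)]) (use that in \<open>auto intro!: continuous_intros\<close>)
    then have "continuous_on {0..1} ?g"
      using C2_01D[OF C] assms(3) by (auto intro!: continuous_intros)
    moreover have "?g s = 0" if "s \<in> {0<..<1}" for s
    proof -
      have "deriv (\<lambda>t. x t s) t = x1 t s"
        using d[OF \<open>t \<in> I\<close>, of s] that by (auto intro: DERIV_imp_deriv)
      then show ?thesis using assms(1) that \<open>t \<in> I\<close> unfolding parabolic_solution_def by auto
    qed
    ultimately have "?g z = 0"
      using continuous_constant_on_closure[of "{0<..<1::real}" ?g 0 z] that by simp
    then show ?thesis by simp
  qed
  show thesis by (rule that[OF x1(2) d eq])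
qed

lemma integral_has_parameter_derivative:
  fixes x x1 :: "real \<Rightarrow> real \<Rightarrow> real" and w :: "real \<Rightarrow> real"
  assumes "open I" "t \<in> I"
    and "continuous_on (I \<times> {a..b}) (\<lambda>(t, z). x1 t z)"
    and "\<And>t z. t \<in> I \<Longrightarrow> z \<in> {a..b} \<Longrightarrow> ((\<lambda>s. x s z) has_real_derivative x1 t z) (at t)"
    and "\<And>t. t \<in> I \<Longrightarrow> continuous_on {a..b} (x t)"
    and "continuous_on {a..b} w"
  shows "((\<lambda>s. integral {a..b} (\<lambda>z. x s z * w z)) has_real_derivative
           integral {a..b} (\<lambda>z. x1 t z * w z)) (at t)"
proof -
  obtain d where d: "d > 0" "ball t d \<subseteq> I" using assms(1,2) open_contains_ball by blast
  \<comment> \<open>Differentiation under the integral works on a convex set of parameters;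
    \<open>I\<close> is merely open, so a ball around \<open>t\<close> takes its place.\<close>
  have "((\<lambda>s. integral (cbox a b) (\<lambda>z. x s z * w z)) has_real_derivative
           integral (cbox a b) (\<lambda>z. x1 t z * w z)) (at t within ball t d)"
  proof (rule leibniz_rule_field_derivative)
    show "((\<lambda>s. x s z * w z) has_real_derivative x1 s z * w z) (at s within ball t d)"
      if "s \<in> ball t d" "z \<in> cbox a b" for s z
    proof -
      have "s \<in> I" using that d by auto
      then have "((\<lambda>s. x s z) has_real_derivative x1 s z) (at s within ball t d)"
        using assms(4)[of s z] that has_field_derivative_at_within by auto
      then show ?thesis by (auto intro!: derivative_eq_intros)
    qed
    show "(\<lambda>z. x s z * w z) integrable_on cbox a b" if "s \<in> ball t d" for s
      using assms(5)[of s] that d assms(6) by (auto intro!: integrable_continuous_real continuous_intros)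
    have "continuous_on (ball t d \<times> {a..b}) (\<lambda>u. (\<lambda>(t, z). x1 t z) u * w (snd u))"
      using d by (intro continuous_intros continuous_on_subset[OF assms(3)]
          continuous_on_compose2[OF assms(6)]) auto
    then show "continuous_on (ball t d \<times> cbox a b) (\<lambda>(s, z). x1 s z * w z)"
      by (simp add: case_prod_unfold)
  qed (use d in auto)
  then show ?thesis using d by (simp add: at_within_open[of t "ball t d"])
qed

lemma parabolic_solutionD:
  assumes "parabolic_solution p q b1 b2 I v x" "t \<in> I"
  shows "C2_01 (x t)" "b1 * x t 0 + b2 * dz (x t) 0 = 0" "x t 1 = v t"
  using assms unfolding parabolic_solution_def by auto

text \<open>Both pairs of value and derivative are orthogonal to the nonzero vector
  \<open>(b1, b2)\<close> of the plane, hence parallel.\<close>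

lemma separated_boundary_Wronskian:
  fixes b1 b2 :: real
  assumes "\<bar>b1\<bar> + \<bar>b2\<bar> > 0" "b1 * f + b2 * f' = 0" "b1 * g + b2 * g' = 0"
  shows "f' * g - f * g' = 0"
proof -
  have "b1 * (f' * g - f * g') = f' * (b1 * g + b2 * g') - g' * (b1 * f + b2 * f')"
    "b2 * (f' * g - f * g') = g * (b1 * f + b2 * f') - f * (b1 * g + b2 * g')"
    by (simp_all add: algebra_simps)
  then have "b1 * (f' * g - f * g') = 0" "b2 * (f' * g - f * g') = 0"
    using assms(2,3) by simp_all
  then show ?thesis using assms(1) by auto
qed

lemma L2_trajectory_inner_continuous:
  assumes "L2_trajectory x" "g \<in> L2_01"
  shows "continuous_on {0..} (\<lambda>t. inner_01 (x t) g)"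
  unfolding continuous_on_def
proof
  fix t :: real assume t: "t \<in> {0..}"
  have L: "x s \<in> L2_01" if "s \<ge> 0" for s using assms that by (auto simp: L2_trajectory_def)
  show "((\<lambda>s. inner_01 (x s) g) \<longlongrightarrow> inner_01 (x t) g) (at t within {0..})"
  proof (rule inner_01_tendsto)
    show "\<forall>\<^sub>F s in at t within {0..}. x s \<in> L2_01"
      unfolding eventually_at using L by (intro exI[of _ 1]) auto
    show "((\<lambda>s. norm_01 (\<lambda>z. x s z - x t z)) \<longlongrightarrow> 0) (at t within {0..})"
      using assms(1) t by (auto simp: L2_trajectory_def)
  qed (use assms L t in auto)
qed

lemma L2_trajectory_norm_continuous:
  assumes "L2_trajectory x"
  shows "continuous_on {0..} (\<lambda>t. norm_01 (x t))"
  unfolding continuous_on_def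
proof
  fix t :: real assume t: "t \<in> {0..}"
  have L: "x s \<in> L2_01" if "s \<ge> 0" for s using assms that by (auto simp: L2_trajectory_def)
  have "((\<lambda>s. norm_01 (x s) - norm_01 (x t)) \<longlongrightarrow> 0) (at t within {0..})"
  proof (rule Lim_null_comparison)
    show "\<forall>\<^sub>F s in at t within {0..}. norm (norm_01 (x s) - norm_01 (x t)) \<le> norm_01 (\<lambda>z. x s z - x t z)"
      unfolding eventually_at using norm_01_reverse_triangle[OF L L] t
      by (intro exI[of _ 1]) auto
    show "((\<lambda>s. norm_01 (\<lambda>z. x s z - x t z)) \<longlongrightarrow> 0) (at t within {0..})"
      using assms t by (auto simp: L2_trajectory_def)
  qed
  then show "((\<lambda>s. norm_01 (x s)) \<longlongrightarrow> norm_01 (x t)) (at t within {0..})"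
    by (simp add: LIM_zero_iff)
qed

section \<open>Expansions in eigenfunctions\<close>

text \<open>The eigenpairs are renumbered from 0, and the eigenvalue equation is classical and
  pointwise; \<open>eigensystem_sturm_liouville\<close> provides the passage from the weak
  formulation.\<close>

locale sturm_liouville =
  fixes p b1 b2 :: real and q :: "real \<Rightarrow> real" and l :: "nat \<Rightarrow> real" and e :: "nat \<Rightarrow> real \<Rightarrow> real"
  assumes p_pos: "p > 0"
    and b_nontrivial: "\<bar>b1\<bar> + \<bar>b2\<bar> > 0"
    and q_cont: "continuous_on {0..1} q"
    and e_C2: "C2_01 (e n)"
    and e_eq: "z \<in> {0..1} \<Longrightarrow> p * dz (dz (e n)) z = (q z - l n) * e n z"
    and e_0: "b1 * e n 0 + b2 * dz (e n) 0 = 0"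
    and e_1: "e n 1 = 0"
    and e_orth: "inner_01 (e m) (e n) = (if m = n then 1 else 0)"
    and e_complete: "f \<in> L2_01 \<Longrightarrow>
      (\<lambda>m. norm_01 (\<lambda>z. f z - (\<Sum>n<m. inner_01 f (e n) * e n z))) \<longlonglongrightarrow> 0"
    and l_mono: "strict_mono l"
    and l_lim: "filterlim l at_top sequentially"
    and e_summable: "\<exists>N. l N > 0 \<and> summable (\<lambda>n. inverse (l (n + N)) * (SUP z\<in>{0..1}. \<bar>e (n + N) z\<bar>))"
begin

abbreviation "fcoeff f n \<equiv> inner_01 f (e n)"

lemmas e_D = C2_01D[OF e_C2]

lemma e_L2: "e n \<in> L2_01"
  by (rule continuous_on_imp_L2_01) (rule e_D)

lemma partial_sum_L2: "(\<lambda>z. \<Sum>n<m. a n * e n z) \<in> L2_01"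
  by (intro L2_01_sum L2_01_scale e_L2)

lemma coeff_partial_sum: "fcoeff (\<lambda>z. \<Sum>n<m. a n * e n z) k = (if k < m then a k else 0)"
  by (simp add: inner_01_sum_left L2_01_scale e_L2 inner_01_scale_left e_orth if_distrib cong: if_cong)

section \<open>Parseval identities for the eigenbasis\<close>

lemma Parseval_partial:
  assumes "f \<in> L2_01"
  shows "(norm_01 (\<lambda>z. f z - (\<Sum>n<m. fcoeff f n * e n z)))\<^sup>2 = inner_01 f f - (\<Sum>n<m. (fcoeff f n)\<^sup>2)"
proof -
  let ?S = "\<lambda>z. \<Sum>n<m. fcoeff f n * e n z"
  have "inner_01 ?S f = (\<Sum>n<m. (fcoeff f n)\<^sup>2)"
    using assms by (simp add: inner_01_sum_left L2_01_scale e_L2 inner_01_scale_left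
      inner_01_commute[of "e _"] power2_eq_square)
  moreover have "inner_01 ?S ?S = (\<Sum>n<m. fcoeff f n * inner_01 (e n) ?S)"
    by (subst inner_01_sum_left) (simp_all add: L2_01_scale e_L2 inner_01_scale_left partial_sum_L2)
  moreover have "\<dots> = (\<Sum>n<m. (fcoeff f n)\<^sup>2)"
    by (rule sum.cong) (simp_all add: inner_01_commute[of "e _" "?S"] coeff_partial_sum power2_eq_square)
  ultimately show ?thesis
    using inner_01_square_diff[OF assms partial_sum_L2[of "fcoeff f" m]]
    by (simp add: norm_01_squared inner_01_commute[of f ?S])
qed

lemma Parseval:
  assumes "f \<in> L2_01"
  shows "(\<lambda>n. (fcoeff f n)\<^sup>2) sums inner_01 f f"
proof -
  have "(\<lambda>m. inner_01 f f - (norm_01 (\<lambda>z. f z - (\<Sum>n<m. fcoeff f n * e n z)))\<^sup>2) \<longlonglongrightarrow> inner_01 f f - 0\<^sup>2"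
    by (intro tendsto_intros e_complete assms)
  then show ?thesis by (simp add: Parseval_partial assms sums_def)
qed

lemma Parseval_inner:
  assumes "f \<in> L2_01" "g \<in> L2_01"
  shows "(\<lambda>n. fcoeff f n * fcoeff g n) sums inner_01 f g"
proof -
  have "(\<lambda>n. ((fcoeff (\<lambda>z. f z + g z) n)\<^sup>2 - (fcoeff f n)\<^sup>2 - (fcoeff g n)\<^sup>2) / 2) sums
      ((inner_01 (\<lambda>z. f z + g z) (\<lambda>z. f z + g z) - inner_01 f f - inner_01 g g) / 2)"
    by (intro sums_divide sums_diff Parseval L2_01_add assms)
  then show ?thesis
    using assms by (simp add: inner_01_add_left inner_01_add_right L2_01_add e_L2 power2_sum
        inner_01_commute[of g f])
qed

lemma continuous_eq_of_coeff:
  assumes "continuous_on {0..1} f" "continuous_on {0..1} g" "\<And>n. fcoeff f n = fcoeff g n" "z \<in> {0..1}"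
  shows "f z = g z"
proof -
  have L: "f \<in> L2_01" "g \<in> L2_01" using assms continuous_on_imp_L2_01 by auto
  have "(\<lambda>n. 0) sums inner_01 (\<lambda>z. f z - g z) (\<lambda>z. f z - g z)"
    using Parseval[OF L2_01_diff[OF L]] by (simp add: inner_01_diff_left L e_L2 assms(3))
  then have "norm_01 (\<lambda>z. f z - g z) = 0"
    using sums_unique2[OF _ sums_zero] by (simp add: norm_01_eq_inner)
  then show ?thesis
    using continuous_norm_01_eq_0[OF continuous_on_diff[OF assms(1,2)] _ assms(4)] by simp
qed

text \<open>The factor with which the value of a profile at \<open>z = 1\<close> enters its
  \<open>n\<close>-th coefficient equation; it is the boundary term left over by Green's
  identity.\<close>

definition "input_coeff n = - p * dz (e n) 1"

text \<open>In Green's identity against \<open>e n\<close> the Wronskian at 0 vanishes because both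
  functions satisfy the same boundary condition. At 1 the flux of \<open>f\<close> is multiplied by
  \<open>e n 1 = 0\<close>, so only \<open>f 1\<close> survives.\<close>

lemma coeff_sl_operator:
  assumes "C2_01 f" "b1 * f 0 + b2 * dz f 0 = 0"
  shows "fcoeff (\<lambda>z. p * dz (dz f) z - q z * f z) n = - l n * fcoeff f n + input_coeff n * f 1"
proof -
  note D = C2_01D[OF assms(1)]
  have "((\<lambda>z. dz (dz f) z * e n z - f z * dz (dz (e n)) z) has_integral
      (dz f 1 * e n 1 - f 1 * dz (e n) 1) - (dz f 0 * e n 0 - f 0 * dz (e n) 0)) {0..1}"
    by (rule Green_01) (use D e_D in auto)
  then have "((\<lambda>z. dz (dz f) z * e n z - f z * dz (dz (e n)) z) has_integral - f 1 * dz (e n) 1) {0..1}"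
    using separated_boundary_Wronskian[OF b_nontrivial assms(2) e_0[of n]] by (simp add: e_1)
  from has_integral_mult_right[OF this, of p]
  have "((\<lambda>z. p * (dz (dz f) z * e n z) - f z * (p * dz (dz (e n)) z)) has_integral input_coeff n * f 1) {0..1}"
    by (simp add: input_coeff_def algebra_simps)
  moreover have "((\<lambda>z. l n * (f z * e n z)) has_integral l n * fcoeff f n) {0..1}"
    unfolding inner_01_continuous[OF D(3) e_D(3)]
    by (intro has_integral_mult_right integrable_integral integrable_continuous_real continuous_intros D e_D)
  ultimately have "((\<lambda>z. p * (dz (dz f) z * e n z) - f z * (p * dz (dz (e n)) z) - l n * (f z * e n z)) has_integral
      input_coeff n * f 1 - l n * fcoeff f n) {0..1}"
    by (rule has_integral_diff)
  then have "((\<lambda>z. (p * dz (dz f) z - q z * f z) * e n z) has_integral input_coeff n * f 1 - l n * fcoeff f n) {0..1}"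
    by (rule has_integral_eq[rotated]) (simp add: e_eq algebra_simps)
  moreover have "fcoeff (\<lambda>z. p * dz (dz f) z - q z * f z) n = integral {0..1} (\<lambda>z. (p * dz (dz f) z - q z * f z) * e n z)"
    by (intro inner_01_continuous continuous_intros D e_D q_cont)
  ultimately show ?thesis by (simp add: integral_unique)
qed

lemma coeff_has_derivative:
  assumes "parabolic_solution p q b1 b2 I v x" "open I" "t \<in> I"
  shows "((\<lambda>s. fcoeff (x s) n) has_real_derivative - l n * fcoeff (x t) n + input_coeff n * v t) (at t)"
proof -
  obtain x1 where x1: "continuous_on (I \<times> {0..1}) (\<lambda>(t, z). x1 t z)"
    "\<And>t z. t \<in> I \<Longrightarrow> z \<in> {0..1} \<Longrightarrow> ((\<lambda>s. x s z) has_real_derivative x1 t z) (at t)"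
    "\<And>t z. t \<in> I \<Longrightarrow> z \<in> {0..1} \<Longrightarrow> x1 t z = p * dz (dz (x t)) z - q z * x t z"
    using parabolic_time_derivative[OF assms(1,2) q_cont] by blast
  note S = parabolic_solutionD[OF assms(1)]
  note D = C2_01D[OF S(1)]
  have "((\<lambda>s. integral {0..1} (\<lambda>z. x s z * e n z)) has_real_derivative
           integral {0..1} (\<lambda>z. x1 t z * e n z)) (at t)"
    by (rule integral_has_parameter_derivative[OF assms(2,3) x1(1,2)]) (use D(3) e_D in auto)
  moreover have "integral {0..1} (\<lambda>z. x1 t z * e n z) = integral {0..1} (\<lambda>z. (p * dz (dz (x t)) z - q z * x t z) * e n z)"
    by (rule integral_cong) (simp add: x1(3) assms(3))
  moreover have "\<dots> = fcoeff (\<lambda>z. p * dz (dz (x t)) z - q z * x t z) n"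
    by (rule inner_01_continuous[symmetric]) (intro continuous_intros D e_D q_cont assms)+
  moreover have "\<dots> = - l n * fcoeff (x t) n + input_coeff n * v t"
    using coeff_sl_operator[OF S(1,2)[OF assms(3)]] S(3)[OF assms(3)] by simp
  ultimately have "((\<lambda>s. integral {0..1} (\<lambda>z. x s z * e n z)) has_real_derivative
    - l n * fcoeff (x t) n + input_coeff n * v t) (at t)" by simp
  then show ?thesis
    by (rule has_field_derivative_transform_within_open[OF _ assms(2,3)])
      (simp add: inner_01_continuous D(3) e_D)
qed

lemma coeff_evolution_bound:
  assumes "L2_trajectory x" "parabolic_solution p q b1 b2 I v x" "open I"
    and "0 \<le> a" "a \<le> b" "finite S" "{a<..<b} - S \<subseteq> I"
    and "\<And>t. t \<in> {a<..<b} - S \<Longrightarrow> \<bar>v t\<bar> \<le> U"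
  shows "\<bar>fcoeff (x b) n - exp (- l n * (b - a)) * fcoeff (x a) n\<bar> \<le> U * (\<bar>input_coeff n\<bar> * exp_integral (l n) (b - a))"
proof (rule linear_ode_bound[OF assms(5,6)])
  show "continuous_on {a..b} (\<lambda>t. fcoeff (x t) n)"
    by (rule continuous_on_subset[OF L2_trajectory_inner_continuous[OF assms(1) e_L2]]) (use assms in auto)
  show "((\<lambda>s. fcoeff (x s) n) has_real_derivative - l n * fcoeff (x t) n + input_coeff n * v t) (at t)"
    if "t \<in> {a<..<b} - S" for t
    by (rule coeff_has_derivative[OF assms(2,3)]) (use assms that in auto)
qed (rule assms(8))

end

section \<open>Twofold antiderivatives\<close>

text \<open>The remainder kernel is extended by zero to the whole interval, which makes the
  remainder an inner product. Weak convergence of second derivatives then passes to the limit at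
  each \<open>z\<close>.\<close>

lemma Taylor_01:
  assumes "\<And>z. z \<in> {0..1} \<Longrightarrow> (f has_real_derivative f1 z) (at z within {0..1})"
    and "\<And>z. z \<in> {0..1} \<Longrightarrow> (f1 has_real_derivative f2 z) (at z within {0..1})"
    and "continuous_on {0..1} f2" "z \<in> {0..1}"
  shows "f z = f 0 + f1 0 * z + inner_01 f2 (\<lambda>s. max 0 (z - s))"
proof -
  have d: "((\<lambda>s. f1 s * (z - s) + f s) has_real_derivative f2 s * (z - s)) (at s within {0..1})"
    if "s \<in> {0..1}" for s
    using assms(1,2)[OF that] by (auto intro!: derivative_eq_intros)
  have "((\<lambda>s. f2 s * (z - s)) has_integral (f1 z * (z - z) + f z) - (f1 0 * (z - 0) + f 0)) {0..z}"
  proof (rule fundamental_theorem_of_calculus)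
    show "((\<lambda>s. f1 s * (z - s) + f s) has_vector_derivative f2 s * (z - s)) (at s within {0..z})"
      if "s \<in> {0..z}" for s
    proof -
      have "s \<in> {0..1}" "{0..z} \<subseteq> {0..1}" using that assms(4) by auto
      then show ?thesis
        using d has_vector_derivative_within_subset
        unfolding has_real_derivative_iff_has_vector_derivative by blast
    qed
  qed (use assms(4) in simp)
  then have "((\<lambda>s. f2 s * max 0 (z - s)) has_integral f z - (f1 0 * z + f 0)) {0..z}"
    by (subst has_integral_cong[where g="\<lambda>s. f2 s * (z - s)"]) auto
  then have "((\<lambda>s. f2 s * max 0 (z - s)) has_integral f z - (f1 0 * z + f 0) + 0) {0..1}"
  proof (rule has_integral_combine[of 0 z 1, rotated 2])
    show "((\<lambda>s. f2 s * max 0 (z - s)) has_integral 0) {z..1}"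
      by (rule has_integral_is_0) auto
  qed (use assms(4) in auto)
  then show ?thesis
    by (subst inner_01_continuous) (auto simp: integral_unique intro!: assms(3) continuous_intros)
qed

text \<open>The converse of \<open>Taylor_01\<close>: a limit that satisfies the Taylor formula with
  a continuous \<open>g\<close> is recognised as twice continuously differentiable.\<close>

lemma twofold_antiderivative:
  fixes g :: "real \<Rightarrow> real" and a d :: real
  defines "f \<equiv> \<lambda>z. a + d * z + inner_01 g (\<lambda>s. max 0 (z - s))"
  assumes "continuous_on {0..1} g"
  shows "C2_01 f" "dz f 0 = d" "\<And>z. z \<in> {0..1} \<Longrightarrow> dz (dz f) z = g z"
proof -
  define A where "A = (\<lambda>z. integral {0..z} g)"
  define B where "B = (\<lambda>z. integral {0..z} A)"
  have A: "(A has_real_derivative g z) (at z within {0..1})" if "z \<in> {0..1}" for z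
    unfolding A_def by (rule integral_has_real_derivative[OF assms(2) that])
  have cA: "continuous_on {0..1} A" using A by (rule DERIV_continuous_on)
  have B: "(B has_real_derivative A z) (at z within {0..1})" if "z \<in> {0..1}" for z
    unfolding B_def by (rule integral_has_real_derivative[OF cA that])
  have AB0: "A 0 = 0" "B 0 = 0" by (simp_all add: A_def B_def)
  have eq: "B z = inner_01 g (\<lambda>s. max 0 (z - s))" if "z \<in> {0..1}" for z
    using Taylor_01[OF B A assms(2) that] by (simp add: AB0)
  have 1: "((\<lambda>z. a + d * z + B z) has_real_derivative d + A z) (at z within {0..1})" if "z \<in> {0..1}" for z
    using B[OF that] by (auto intro!: derivative_eq_intros)
  have 2: "((\<lambda>z. d + A z) has_real_derivative g z) (at z within {0..1})" if "z \<in> {0..1}" for z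
    using A[OF that] by (auto intro!: derivative_eq_intros)
  note I = C2_01I[OF 1 2 assms(2)]
  have eq': "a + d * z + B z = f z" if "z \<in> {0..1}" for z using eq that by (simp add: f_def)
  note J = C2_01_cong[OF eq' I(1)]
  show "C2_01 f" by (rule J(1))
  show "dz f 0 = d" using J(2)[of 0] I(2)[of 0] by (simp add: AB0)
  show "dz (dz f) z = g z" if "z \<in> {0..1}" for z using J(3)[of z] I(3)[of z] that by simp
qed

lemma uniform_limit_imp_norm_01:
  assumes "uniform_limit {0..1} S f F" "\<And>n. continuous_on {0..1} (S n)" "continuous_on {0..1} f"
  shows "((\<lambda>n. norm_01 (\<lambda>z. S n z - f z)) \<longlongrightarrow> 0) F"
proof (rule tendstoI)
  fix r :: real assume r: "r > 0"
  have "\<forall>\<^sub>F n in F. \<forall>z\<in>{0..1}. dist (S n z) (f z) < r / 2"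
    using uniform_limitD[OF assms(1), of "r / 2"] r by simp
  then show "\<forall>\<^sub>F n in F. dist (norm_01 (\<lambda>z. S n z - f z)) 0 < r"
  proof eventually_elim
    case (elim n)
    have "norm_01 (\<lambda>z. S n z - f z) \<le> r / 2"
    proof (rule norm_01_bound(2))
      show "(\<lambda>z. S n z - f z) \<in> borel_measurable M01"
        using assms(2,3) by (intro L2_01_measurable continuous_on_imp_L2_01 continuous_intros)
    qed (use elim in \<open>auto simp: dist_real_def intro: less_imp_le\<close>)
    then show ?case using r by simp
  qed
qed

lemma summable_abs_mult:
  fixes a b :: "nat \<Rightarrow> real"
  assumes "summable (\<lambda>n. (a n)\<^sup>2)" "summable (\<lambda>n. (b n)\<^sup>2)"
  shows "summable (\<lambda>n. \<bar>a n * b n\<bar>)"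
    "(\<Sum>n. \<bar>a n * b n\<bar>)\<^sup>2 \<le> (\<Sum>n. (a n)\<^sup>2) * (\<Sum>n. (b n)\<^sup>2)"
proof -
  have "norm (\<bar>a n * b n\<bar>) \<le> (a n)\<^sup>2 + (b n)\<^sup>2" for n
  proof -
    have "2 * \<bar>a n * b n\<bar> \<le> (a n)\<^sup>2 + (b n)\<^sup>2"
      using sum_squares_bound[of "\<bar>a n\<bar>" "\<bar>b n\<bar>"] by (simp add: abs_mult mult.assoc)
    then show ?thesis using abs_ge_zero[of "a n * b n"] by simp
  qed
  then show S: "summable (\<lambda>n. \<bar>a n * b n\<bar>)"
    by (intro summable_comparison_test'[OF summable_add[OF assms]])
  have "(\<lambda>m. (\<Sum>n<m. \<bar>a n * b n\<bar>)\<^sup>2) \<longlonglongrightarrow> (\<Sum>n. \<bar>a n * b n\<bar>)\<^sup>2"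
    using summable_LIMSEQ[OF S] by (intro tendsto_intros)
  moreover have "(\<lambda>m. (\<Sum>n<m. (a n)\<^sup>2) * (\<Sum>n<m. (b n)\<^sup>2)) \<longlonglongrightarrow> (\<Sum>n. (a n)\<^sup>2) * (\<Sum>n. (b n)\<^sup>2)"
    by (intro tendsto_mult summable_LIMSEQ assms)
  moreover have "(\<Sum>n<m. \<bar>a n * b n\<bar>)\<^sup>2 \<le> (\<Sum>n<m. (a n)\<^sup>2) * (\<Sum>n<m. (b n)\<^sup>2)" for m
    using Cauchy_Schwarz_ineq_sum[of "\<lambda>n. \<bar>a n\<bar>" "\<lambda>n. \<bar>b n\<bar>" "{..<m}"] by (simp add: abs_mult)
  ultimately show "(\<Sum>n. \<bar>a n * b n\<bar>)\<^sup>2 \<le> (\<Sum>n. (a n)\<^sup>2) * (\<Sum>n. (b n)\<^sup>2)"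
    by (meson LIMSEQ_le)
qed

context sturm_liouville
begin

section \<open>Growth of eigenvalues and eigenfunctions\<close>

definition "emax n = (SUP z\<in>{0..1}. \<bar>e n z\<bar>)"

lemma abs_e_le:
  assumes "z \<in> {0..1}"
  shows "\<bar>e n z\<bar> \<le> emax n"
proof -
  have "compact ((\<lambda>z. \<bar>e n z\<bar>) ` {0..1})"
    by (intro compact_continuous_image continuous_intros e_D) simp
  then have "bdd_above ((\<lambda>z. \<bar>e n z\<bar>) ` {0..1})"
    by (intro bounded_imp_bdd_above compact_imp_bounded)
  then show ?thesis unfolding emax_def by (rule cSUP_upper[OF assms])
qed

lemma norm_e: "norm_01 (e n) = 1"
  by (simp add: norm_01_eq_inner e_orth)

lemma emax_ge_1: "1 \<le> emax n"
  using norm_01_bound(2)[OF L2_01_measurable[OF e_L2[of n]], of "emax n"] abs_e_le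
  by (simp add: norm_e)

lemma abs_coeff_le: "f \<in> L2_01 \<Longrightarrow> \<bar>fcoeff f n\<bar> \<le> norm_01 f"
  using inner_01_Cauchy_Schwarz[of f "e n"] by (simp add: norm_e e_L2)

lemma l_ge: "l 0 \<le> l n"
  using l_mono by (simp add: strict_mono_less_eq)

lemma l_inj: "l m = l n \<longleftrightarrow> m = n"
  using l_mono by (simp add: strict_mono_eq)

text \<open>The tail is extended by finitely many terms, and absolute values cover negative
  eigenvalues. A term with \<open>l n = 0\<close> equals 0 by the convention for division by
  zero.\<close>

lemma summable_emax: "summable (\<lambda>n. emax n / \<bar>l n\<bar>)"
proof -
  obtain N where N: "l N > 0" "summable (\<lambda>n. inverse (l (n + N)) * emax (n + N))"
    using e_summable unfolding emax_def by blast
  have "l (n + N) > 0" for n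
  proof -
    have "l N \<le> l (n + N)" using l_mono by (simp add: strict_mono_less_eq)
    then show ?thesis using N(1) by simp
  qed
  then have "(\<lambda>n. inverse (l (n + N)) * emax (n + N)) = (\<lambda>n. emax (n + N) / \<bar>l (n + N)\<bar>)"
    by (intro ext) (simp add: divide_inverse abs_of_pos mult.commute)
  then show ?thesis
    using N(2) by (simp add: summable_iff_shift[of "\<lambda>n. emax n / \<bar>l n\<bar>" N])
qed

lemma C2_01_scale_e:
  "C2_01 (\<lambda>z. a * e m z)"
  "z \<in> {0..1} \<Longrightarrow> dz (\<lambda>z. a * e m z) z = a * dz (e m) z"
  "z \<in> {0..1} \<Longrightarrow> dz (dz (\<lambda>z. a * e m z)) z = a * dz (dz (e m)) z"
  using C2_01_lincomb(1)[OF e_C2 e_C2, of a m 0 m] C2_01_lincomb(2)[OF e_C2 e_C2, of z a m 0 m]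
    C2_01_lincomb(3)[OF e_C2 e_C2, of z a m 0 m] by simp_all

section \<open>Lifting of constant boundary inputs\<close>

text \<open>Eigenvalues are distinct, so at most one index is resonant. The disjunction
  \<open>a = 0 \<or> l m = 0\<close> lets the later computation treat the presence and the absence
  of resonance alike.\<close>

lemma resonant_part:
  obtains a m where "a = 0 \<or> l m = 0" "\<And>n. (if l n = 0 then c n else 0) = (if n = m then a else 0)"
proof (cases "\<exists>m. l m = 0")
  case True
  then obtain m where m: "l m = 0" by blast
  have "(if l n = 0 then c n else 0) = (if n = m then c m else 0)" for n
    using m l_inj[of n m] by auto
  then show thesis using that m by blast
next
  case False
  then show thesis using that[of 0 0] by auto
qed

text \<open>
  The term \<open>r\<close> is needed only when \<open>0\<close> is an eigenvalue, in which case a unit input resonates with the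
  corresponding eigenfunction.
\<close>

lemma lifting_exists:
  obtains h r where "C2_01 h" "b1 * h 0 + b2 * dz h 0 = 0" "h 1 = 1"
    "\<And>z. z \<in> {0..1} \<Longrightarrow> p * dz (dz h) z - q z * h z = r z"
    "C2_01 r" "b1 * r 0 + b2 * dz r 0 = 0" "r 1 = 0"
    "\<And>z. z \<in> {0..1} \<Longrightarrow> p * dz (dz r) z - q z * r z = 0"
proof -
  \<comment> \<open>The lift is sought as \<open>z\<^sup>2 + T z\<close>: the square has zero value
    and slope at 0 and value 1 at 1. Then \<open>f\<close> is the differential expression applied to
    the square, and \<open>T\<close> must satisfy \<open>p T'' - q T = r - f\<close> with
    homogeneous boundary conditions.\<close>
  define f where "f = (\<lambda>z. 2 * p - q z * z\<^sup>2)"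
  have f_cont: "continuous_on {0..1} f" unfolding f_def by (intro continuous_intros q_cont)
  have f_L2: "f \<in> L2_01" by (rule continuous_on_imp_L2_01[OF f_cont])
  define a where "a n = fcoeff f n / l n" for n
  obtain \<rho> m where m: "\<rho> = 0 \<or> l m = 0"
      "\<And>n. (if l n = 0 then fcoeff f n else 0) = (if n = m then \<rho> else 0)"
    by (rule resonant_part[of "fcoeff f"]) (rule that; assumption)
  define r where "r = (\<lambda>z. \<rho> * e m z)"
  have r_L2: "r \<in> L2_01" unfolding r_def by (intro L2_01_scale e_L2)
  have al: "a n * l n = fcoeff f n - (if n = m then \<rho> else 0)" for n
    using m(2)[of n] by (auto simp: a_def split: if_splits)
  define S where "S N z = (\<Sum>n<N. a n * e n z)" for N z
  define G where "G N z = q z * S N z - (\<Sum>n<N. fcoeff f n * e n z) + r z" for N z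
  define T where "T z = (\<Sum>n. a n * e n z)" for z
  define g where "g z = q z * T z - f z + r z" for z
  define D where "D N = (\<Sum>n<N. a n * dz (e n) 0)" for N
  have S_cont: "continuous_on {0..1} (S N)" for N
    unfolding S_def by (intro continuous_intros e_D)
  \<comment> \<open>The summability assumption on the eigenfunctions enters here: the coefficients
    of \<open>f\<close> are bounded, so \<open>emax n / \<bar>l n\<bar>\<close> majorises the series
    up to a factor.\<close>
  have lim: "uniform_limit {0..1} S T sequentially"
    unfolding S_def T_def
  proof (rule Weierstrass_m_test)
    show "norm (a n * e n z) \<le> norm_01 f * (emax n / \<bar>l n\<bar>)" if "z \<in> {0..1}" for n z
    proof -
      have "\<bar>fcoeff f n\<bar> * \<bar>e n z\<bar> \<le> norm_01 f * emax n"
        by (intro mult_mono abs_coeff_le f_L2 abs_e_le that) auto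
      then show ?thesis
        using divide_right_mono[of _ _ "\<bar>l n\<bar>"] by (fastforce simp: a_def abs_mult)
    qed
    show "summable (\<lambda>n. norm_01 f * (emax n / \<bar>l n\<bar>))"
      by (intro summable_mult summable_emax)
  qed
  have T_cont: "continuous_on {0..1} T"
    by (rule uniform_limit_theorem[OF _ lim]) (use S_cont in auto)
  have g_cont: "continuous_on {0..1} g"
    unfolding g_def r_def by (intro continuous_intros q_cont T_cont f_cont e_D)
  have T_L2: "T \<in> L2_01" and S_L2: "S N \<in> L2_01" for N
    using T_cont S_cont by (auto intro: continuous_on_imp_L2_01)
  have G_cont: "continuous_on {0..1} (G N)" for N
    unfolding G_def r_def by (intro continuous_intros q_cont S_cont e_D)

  \<comment> \<open>The second derivatives of the partial sums are \<open>G N / p\<close>.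
    Convergence when tested against continuous functions is enough, since the Taylor remainder is
    such a test.\<close>
  have G_lim: "(\<lambda>N. inner_01 (G N) w) \<longlonglongrightarrow> inner_01 g w" if w: "continuous_on {0..1} w" for w
  proof -
    have w_L2: "w \<in> L2_01" and qw_L2: "(\<lambda>z. q z * w z) \<in> L2_01"
      using w q_cont by (auto intro!: continuous_on_imp_L2_01 continuous_intros)
    have qL2: "(\<lambda>z. q z * F z) \<in> L2_01" if "continuous_on {0..1} F" for F
      using that q_cont by (auto intro!: continuous_on_imp_L2_01 continuous_intros)
    have sw: "inner_01 (\<lambda>z. q z * F z) w = inner_01 F (\<lambda>z. q z * w z)" for F
      by (simp add: inner_01_def mult_ac)
    have "inner_01 (G N) w = inner_01 (S N) (\<lambda>z. q z * w z) - inner_01 (\<lambda>z. \<Sum>n<N. fcoeff f n * e n z) w + inner_01 r w" for N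
      unfolding G_def
      by (simp add: inner_01_add_left inner_01_diff_left L2_01_diff qL2 S_cont partial_sum_L2 r_L2 w_L2 sw)
    moreover have "inner_01 g w = inner_01 T (\<lambda>z. q z * w z) - inner_01 f w + inner_01 r w"
      unfolding g_def
      by (simp add: inner_01_add_left inner_01_diff_left L2_01_diff qL2 T_cont f_L2 r_L2 w_L2 sw)
    moreover have "(\<lambda>N. inner_01 (S N) (\<lambda>z. q z * w z)) \<longlonglongrightarrow> inner_01 T (\<lambda>z. q z * w z)"
      by (rule inner_01_tendsto[OF _ T_L2 qw_L2 uniform_limit_imp_norm_01[OF lim S_cont T_cont]])
        (simp add: S_L2)
    moreover have "(\<lambda>N. inner_01 (\<lambda>z. \<Sum>n<N. fcoeff f n * e n z) w) \<longlonglongrightarrow> inner_01 f w"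
    proof (rule inner_01_tendsto[OF _ f_L2 w_L2])
      show "(\<lambda>N. norm_01 (\<lambda>z. (\<Sum>n<N. fcoeff f n * e n z) - f z)) \<longlonglongrightarrow> 0"
        using e_complete[OF f_L2] by (subst norm_01_diff_commute)
    qed (simp add: partial_sum_L2)
    ultimately show ?thesis by (simp add: tendsto_intros)
  qed

  \<comment> \<open>The condition \<open>N > m\<close> ensures that the resonant mode belongs to the
    partial sum, so that its coefficient of \<open>f\<close> cancels against
    \<open>r\<close>.\<close>
  have Taylor: "S N z = S N 0 + D N * z + inner_01 (G N) (\<lambda>s. max 0 (z - s)) / p"
    if "N > m" "z \<in> {0..1}" for N z
  proof -
    have 1: "(S N has_real_derivative (\<Sum>n<N. a n * dz (e n) z)) (at z within {0..1})" if "z \<in> {0..1}" for z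
      unfolding S_def using e_D(1)[OF that] by (auto intro!: derivative_eq_intros simp: mult.commute)
    have 2: "((\<lambda>z. \<Sum>n<N. a n * dz (e n) z) has_real_derivative G N z / p) (at z within {0..1})" if z: "z \<in> {0..1}" for z
    proof -
      have "((\<lambda>z. \<Sum>n<N. a n * dz (e n) z) has_real_derivative (\<Sum>n<N. a n * dz (dz (e n)) z)) (at z within {0..1})"
        using e_D(2)[OF that] by (auto intro!: derivative_eq_intros simp: mult.commute)
      moreover
      have "p * (\<Sum>n<N. a n * dz (dz (e n)) z) = G N z"
      proof -
        have "p * (\<Sum>n<N. a n * dz (dz (e n)) z) = (\<Sum>n<N. a n * (p * dz (dz (e n)) z))"
          by (simp add: sum_distrib_left mult_ac)
        also have "\<dots> = (\<Sum>n<N. q z * (a n * e n z) - (a n * l n) * e n z)"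
          using e_eq[OF z] by (intro sum.cong) (simp_all add: left_diff_distrib right_diff_distrib mult_ac)
        also have "\<dots> = (\<Sum>n<N. q z * (a n * e n z) - fcoeff f n * e n z + (if n = m then \<rho> * e m z else 0))"
          by (intro sum.cong) (simp_all add: al algebra_simps)
        also have "\<dots> = G N z"
          using \<open>N > m\<close> by (simp add: G_def S_def r_def sum.distrib sum_subtractf sum_distrib_left)
        finally show ?thesis .
      qed
      then have "(\<Sum>n<N. a n * dz (dz (e n)) z) = G N z / p" using p_pos by (simp add: field_simps)
      ultimately show ?thesis by simp
    qed
    have "S N z = S N 0 + D N * z + inner_01 (\<lambda>z. G N z / p) (\<lambda>s. max 0 (z - s))"
      unfolding D_def
      by (rule Taylor_01[OF 1 2 _ that(2)]) (use p_pos in \<open>auto intro!: continuous_intros G_cont\<close>)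
    also have "inner_01 (\<lambda>z. G N z / p) (\<lambda>s. max 0 (z - s)) = inner_01 (G N) (\<lambda>s. max 0 (z - s)) / p"
      using inner_01_scale_left[of "1 / p" "G N"] by simp
    finally show ?thesis .
  qed
  have ev: "\<forall>\<^sub>F N in sequentially. N > m" by (rule eventually_gt_at_top)
  have S_lim: "(\<lambda>N. S N z) \<longlonglongrightarrow> T z" if "z \<in> {0..1}" for z
    using tendsto_uniform_limitI[OF lim that] .
  have max_cont: "continuous_on {0..1} (\<lambda>s. max 0 (z - s))" for z :: real by (intro continuous_intros)
  \<comment> \<open>The slopes \<open>D N\<close> at 0 have no evident limit. The Taylor formula at
    \<open>z = 1\<close> expresses them through quantities known to converge, and this is the
    resulting limit.\<close>
  define d where "d = T 1 - T 0 - inner_01 g (\<lambda>s. max 0 (1 - s)) / p"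
  have D_lim: "D \<longlonglongrightarrow> d"
  proof (rule Lim_transform_eventually)
    show "(\<lambda>N. S N 1 - S N 0 - inner_01 (G N) (\<lambda>s. max 0 (1 - s)) / p) \<longlonglongrightarrow> d"
      unfolding d_def using p_pos by (intro tendsto_intros S_lim G_lim max_cont) auto
    show "\<forall>\<^sub>F N in sequentially. S N 1 - S N 0 - inner_01 (G N) (\<lambda>s. max 0 (1 - s)) / p = D N"
      using ev
    proof eventually_elim
      case (elim N)
      then show ?case using Taylor[of N 1] by simp
    qed
  qed
  have T_eq: "T z = T 0 + d * z + inner_01 (\<lambda>s. g s / p) (\<lambda>s. max 0 (z - s))" if z: "z \<in> {0..1}" for z
  proof -
    have "(\<lambda>N. S N z) \<longlonglongrightarrow> T 0 + d * z + inner_01 g (\<lambda>s. max 0 (z - s)) / p"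
    proof (rule Lim_transform_eventually)
      show "(\<lambda>N. S N 0 + D N * z + inner_01 (G N) (\<lambda>s. max 0 (z - s)) / p)
          \<longlonglongrightarrow> T 0 + d * z + inner_01 g (\<lambda>s. max 0 (z - s)) / p"
        using p_pos by (intro tendsto_intros S_lim G_lim max_cont D_lim) auto
      show "\<forall>\<^sub>F N in sequentially. S N 0 + D N * z + inner_01 (G N) (\<lambda>s. max 0 (z - s)) / p = S N z"
        using ev by eventually_elim (rule Taylor[OF _ z, symmetric])
    qed
    from LIMSEQ_unique[OF S_lim[OF z] this] show ?thesis
      using inner_01_scale_left[of "1 / p" g] by simp
  qed
  have gp_cont: "continuous_on {0..1} (\<lambda>s. g s / p)"
    using p_pos by (intro continuous_intros g_cont) auto
  note TA = twofold_antiderivative[OF gp_cont, where a="T 0" and d=d]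
  note TC = C2_01_cong[OF T_eq[symmetric] TA(1)]
  have T1: "T 1 = 0" unfolding T_def by (simp add: e_1)
  have dT0: "dz T 0 = d" using TC(2)[of 0] TA(2) by simp
  have Tbc: "b1 * T 0 + b2 * d = 0"
  proof -
    have "(\<lambda>N. b1 * S N 0 + b2 * D N) \<longlonglongrightarrow> b1 * T 0 + b2 * d"
      by (intro tendsto_intros S_lim D_lim) auto
    moreover have "b1 * S N 0 + b2 * D N = (\<Sum>n<N. a n * (b1 * e n 0 + b2 * dz (e n) 0))" for N
      by (simp add: S_def D_def sum_distrib_left sum.distrib algebra_simps)
    ultimately have "(\<lambda>N. 0) \<longlonglongrightarrow> b1 * T 0 + b2 * d" by (simp add: e_0)
    then show ?thesis using LIMSEQ_unique[OF tendsto_const] by metis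
  qed
  have sq1: "((\<lambda>z. z\<^sup>2) has_real_derivative 2 * z) (at z within {0..1})" for z :: real
    by (auto intro!: derivative_eq_intros)
  have sq2: "((\<lambda>z. 2 * z) has_real_derivative 2) (at z within {0..1})" for z :: real
    by (auto intro!: derivative_eq_intros)
  note sq = C2_01I[OF sq1 sq2 continuous_on_const]
  have sqC: "C2_01 (\<lambda>z. z\<^sup>2)" and sqd: "dz (\<lambda>z. z\<^sup>2) 0 = 0"
    "\<And>z. z \<in> {0..1} \<Longrightarrow> dz (dz (\<lambda>z. z\<^sup>2)) z = 2"
    using sq(1) sq(2)[of 0] sq(3) by auto
  have TC2: "C2_01 T" using TC(1) by auto
  have H: "C2_01 (\<lambda>z. z\<^sup>2 + T z)" "dz (\<lambda>z. z\<^sup>2 + T z) 0 = d"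
    "\<And>z. z \<in> {0..1} \<Longrightarrow> dz (dz (\<lambda>z. z\<^sup>2 + T z)) z = 2 + g z / p"
    using C2_01_lincomb(1)[OF sqC TC2, of 1 1] C2_01_lincomb(2)[OF sqC TC2, of 0 1 1]
      C2_01_lincomb(3)[OF sqC TC2, of _ 1 1] sqd dT0 TC(3) TA(3) by simp_all
  note R = C2_01_scale_e[where a=\<rho> and m=m, folded r_def]
  show thesis
  proof (rule that[OF H(1) _ _ _ R(1)])
    show "b1 * (0\<^sup>2 + T 0) + b2 * dz (\<lambda>z. z\<^sup>2 + T z) 0 = 0"
      using Tbc by (simp add: H(2))
    show "1\<^sup>2 + T 1 = 1" by (simp add: T1)
    show "p * dz (dz (\<lambda>z. z\<^sup>2 + T z)) z - q z * (z\<^sup>2 + T z) = r z" if "z \<in> {0..1}" for z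
    proof -
      have "p * dz (dz (\<lambda>z. z\<^sup>2 + T z)) z = p * 2 + g z"
        using H(3)[OF that] p_pos by (simp add: distrib_left)
      then show ?thesis by (simp add: g_def f_def algebra_simps)
    qed
    show "b1 * r 0 + b2 * dz r 0 = 0"
    proof -
      have "b1 * r 0 + b2 * dz r 0 = \<rho> * (b1 * e m 0 + b2 * dz (e m) 0)"
        using R(2)[of 0] by (simp add: r_def algebra_simps)
      then show ?thesis by (simp add: e_0)
    qed
    show "r 1 = 0" by (simp add: r_def e_1)
    show "p * dz (dz r) z - q z * r z = 0" if "z \<in> {0..1}" for z
    proof -
      have "p * dz (dz r) z = \<rho> * (p * dz (dz (e m)) z)" using R(3)[OF that] by simp
      also have "\<dots> = q z * r z - (\<rho> * l m) * e m z" using that by (simp add: e_eq r_def algebra_simps)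
      finally show ?thesis using m(1) by auto
    qed
  qed
qed

section \<open>Admissibility of the boundary input\<close>

text \<open>Since \<open>l 0\<close> is the least eigenvalue, this number dominates both
  \<open>exp (- l n * s)\<close> and \<open>\<bar>1 - exp (- l n * s)\<bar>\<close> for all
  \<open>n\<close> and all \<open>s\<close> in the unit interval.\<close>

definition "growth = 1 + exp \<bar>l 0\<bar>"

lemma exp_l_le:
  assumes "0 \<le> s" "s \<le> 1"
  shows "exp (- l n * s) \<le> exp \<bar>l 0\<bar>"
proof -
  have "- l n * s \<le> \<bar>l 0\<bar> * s" using l_ge[of n] assms by (intro mult_right_mono) auto
  also have "\<dots> \<le> \<bar>l 0\<bar> * 1" using assms by (intro mult_left_mono) auto
  finally show ?thesis by simp
qed

text \<open>Strong continuity of the semigroup at time 0, in coefficients: the series is continuous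
  in \<open>s\<close> by the uniform majorant \<open>(a n)\<^sup>2 * growth\<^sup>2\<close>, and it
  vanishes at \<open>s = 0\<close>.\<close>

lemma semigroup_small:
  assumes "summable (\<lambda>n. (a n)\<^sup>2)" "\<epsilon> > 0"
  obtains \<delta> where "0 < \<delta>" "\<delta> \<le> 1"
    "\<And>s. 0 \<le> s \<Longrightarrow> s \<le> \<delta> \<Longrightarrow> summable (\<lambda>n. (a n * (1 - exp (- l n * s)))\<^sup>2)"
    "\<And>s. 0 \<le> s \<Longrightarrow> s \<le> \<delta> \<Longrightarrow> (\<Sum>n. (a n * (1 - exp (- l n * s)))\<^sup>2) \<le> \<epsilon>"
proof -
  let ?f = "\<lambda>n s. (a n * (1 - exp (- l n * s)))\<^sup>2"
  have bound: "norm (?f n s) \<le> (a n)\<^sup>2 * growth\<^sup>2" if "s \<in> {0..1}" for n s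
  proof -
    have "\<bar>1 - exp (- l n * s)\<bar> \<le> growth"
    proof -
      have "exp (- l n * s) \<le> exp \<bar>l 0\<bar>" "0 \<le> exp (- l n * s)" "0 \<le> exp \<bar>l 0\<bar>"
        using exp_l_le[of s n] that by simp_all
      then show ?thesis unfolding growth_def abs_le_iff by linarith
    qed
    then have "\<bar>1 - exp (- l n * s)\<bar>\<^sup>2 \<le> growth\<^sup>2" by (intro power_mono) auto
    then show ?thesis by (simp add: power_mult_distrib mult_left_mono)
  qed
  have S: "summable (\<lambda>n. (a n)\<^sup>2 * growth\<^sup>2)" by (intro summable_mult2 assms)
  have lim: "uniform_limit {0..1} (\<lambda>N s. \<Sum>n<N. ?f n s) (\<lambda>s. \<Sum>n. ?f n s) sequentially"
    by (rule Weierstrass_m_test[OF bound S])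
  have "continuous_on {0..1} (\<lambda>s. \<Sum>n. ?f n s)"
    by (rule uniform_limit_theorem[OF _ lim]) (auto intro!: continuous_intros always_eventually)
  then have "\<exists>d>0. \<forall>s\<in>{0..1}. dist s 0 < d \<longrightarrow> dist (\<Sum>n. ?f n s) (\<Sum>n. ?f n 0) < \<epsilon>"
    using assms(2) unfolding continuous_on_iff by (auto dest!: bspec[where x=0])
  then obtain d where d: "d > 0" "\<And>s. s \<in> {0..1} \<Longrightarrow> dist s 0 < d \<Longrightarrow> dist (\<Sum>n. ?f n s) (\<Sum>n. ?f n 0) < \<epsilon>"
    by blast
  show thesis
  proof (rule that[of "min 1 (d / 2)"])
    fix s assume s: "0 \<le> s" "s \<le> min 1 (d / 2)"
    show "summable (\<lambda>n. ?f n s)"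
      by (rule summable_comparison_test'[OF S bound]) (use s in auto)
    show "(\<Sum>n. ?f n s) \<le> \<epsilon>"
      using d(2)[of s] s d(1) by (simp add: dist_real_def)
  qed (use d in auto)
qed

text \<open>The numbers \<open>input_coeff n\<close> may grow with \<open>n\<close>. The lift writes
  them as \<open>fcoeff r n + l n * fcoeff h n\<close>, and \<open>l n\<close> is compensated by the
  time integral, leaving the square summable \<open>fcoeff h n * (1 - exp (- l n * s))\<close> and a
  multiple of \<open>s\<close>.\<close>

lemma input_small:
  assumes "\<epsilon> > 0"
  obtains \<delta> where "0 < \<delta>" "\<delta> \<le> 1"
    "\<And>s. 0 \<le> s \<Longrightarrow> s \<le> \<delta> \<Longrightarrow> summable (\<lambda>n. (input_coeff n * exp_integral (l n) s)\<^sup>2)"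
    "\<And>s. 0 \<le> s \<Longrightarrow> s \<le> \<delta> \<Longrightarrow> (\<Sum>n. (input_coeff n * exp_integral (l n) s)\<^sup>2) \<le> \<epsilon>"
proof -
  obtain h r where hr: "C2_01 h" "b1 * h 0 + b2 * dz h 0 = 0" "h 1 = 1"
    "\<And>z. z \<in> {0..1} \<Longrightarrow> p * dz (dz h) z - q z * h z = r z"
    "C2_01 r" "b1 * r 0 + b2 * dz r 0 = 0" "r 1 = 0"
    "\<And>z. z \<in> {0..1} \<Longrightarrow> p * dz (dz r) z - q z * r z = 0"
    by (rule lifting_exists) (rule that; assumption)
  have L: "h \<in> L2_01" "r \<in> L2_01" using hr(1,5) C2_01D(3) continuous_on_imp_L2_01 by auto
  have h: "fcoeff r n = - l n * fcoeff h n + input_coeff n" for n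
    using coeff_sl_operator[OF hr(1,2), of n] hr(3)
      inner_01_cong[of "\<lambda>z. p * dz (dz h) z - q z * h z" r "e n" "e n", OF hr(4)] by simp
  \<comment> \<open>Hence \<open>r\<close> has components only at the eigenvalue 0, where
    \<open>exp_integral\<close> is the elapsed time.\<close>
  have r: "l n * fcoeff r n = 0" for n
    using coeff_sl_operator[OF hr(5,6), of n] hr(7)
      inner_01_cong[of "\<lambda>z. p * dz (dz r) z - q z * r z" "\<lambda>z. 0" "e n" "e n", OF hr(8)]
    by (simp add: inner_01_def)
  have eq: "input_coeff n * exp_integral (l n) s = fcoeff r n * s + fcoeff h n * (1 - exp (- l n * s))" for n s
  proof -
    have "input_coeff n * exp_integral (l n) s = fcoeff r n * exp_integral (l n) s + fcoeff h n * (l n * exp_integral (l n) s)"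
    proof -
      have "input_coeff n = fcoeff r n + l n * fcoeff h n" using h[of n] by simp
      then show ?thesis by (simp add: distrib_left distrib_right mult_ac)
    qed
    moreover have "fcoeff r n * exp_integral (l n) s = fcoeff r n * s"
      using r[of n] by (auto simp: exp_integral_def)
    ultimately show ?thesis by (simp add: mult_exp_integral)
  qed
  have sq: "(x + y)\<^sup>2 \<le> 2 * x\<^sup>2 + 2 * y\<^sup>2" for x y :: real
    using sum_squares_bound[of x y] by (simp add: power2_sum)
  note Ph = Parseval[OF L(1)] and Pr = Parseval[OF L(2)]
  obtain d where d: "0 < d" "d \<le> 1"
    "\<And>s. 0 \<le> s \<Longrightarrow> s \<le> d \<Longrightarrow> summable (\<lambda>n. (fcoeff h n * (1 - exp (- l n * s)))\<^sup>2)"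
    "\<And>s. 0 \<le> s \<Longrightarrow> s \<le> d \<Longrightarrow> (\<Sum>n. (fcoeff h n * (1 - exp (- l n * s)))\<^sup>2) \<le> \<epsilon> / 4"
    using semigroup_small[OF sums_summable[OF Ph], of "\<epsilon> / 4"] assms by auto
  let ?R = "inner_01 r r"
  \<comment> \<open>The second bound gives \<open>s * (?R + 1) \<le> \<epsilon> / 4\<close>. Both
    parts carry a factor 2 from squaring a sum, so each contributes at most half of
    \<open>\<epsilon>\<close>.\<close>
  define \<delta> where "\<delta> = min d (\<epsilon> / (4 * (?R + 1)))"
  have R: "?R \<ge> 0" by (rule inner_01_self_nonneg)
  show thesis
  proof (rule that[of \<delta>])
    show "0 < \<delta>" "\<delta> \<le> 1" using d R assms by (auto simp: \<delta>_def)
    fix s assume s: "0 \<le> s" "s \<le> \<delta>"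
    have sd: "s \<le> d" "s \<le> \<epsilon> / (4 * (?R + 1))" "s \<le> 1" using s d by (auto simp: \<delta>_def)
    let ?g = "\<lambda>n. 2 * s\<^sup>2 * (fcoeff r n)\<^sup>2 + 2 * (fcoeff h n * (1 - exp (- l n * s)))\<^sup>2"
    have g: "summable ?g"
      by (intro summable_add summable_mult sums_summable[OF Pr] d(3) s sd)
    have le: "(input_coeff n * exp_integral (l n) s)\<^sup>2 \<le> ?g n" for n
      using sq[of "fcoeff r n * s" "fcoeff h n * (1 - exp (- l n * s))"]
      unfolding eq by (simp add: power_mult_distrib mult_ac)
    show S: "summable (\<lambda>n. (input_coeff n * exp_integral (l n) s)\<^sup>2)"
      by (rule summable_comparison_test'[OF g]) (use le in auto)
    have "(\<Sum>n. (input_coeff n * exp_integral (l n) s)\<^sup>2) \<le> (\<Sum>n. ?g n)"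
      by (rule suminf_le[OF le S g])
    also have "\<dots> = 2 * s\<^sup>2 * ?R + 2 * (\<Sum>n. (fcoeff h n * (1 - exp (- l n * s)))\<^sup>2)"
      using sums_unique[OF Pr] d(3)[OF s(1) sd(1)]
      by (simp add: suminf_add[symmetric] suminf_mult summable_mult sums_summable[OF Pr])
    also have "\<dots> \<le> 2 * (s * (?R + 1)) + 2 * (\<epsilon> / 4)"
    proof -
      have "s\<^sup>2 * ?R \<le> s * ?R"
        using s sd R by (intro mult_right_mono) (auto simp: power2_eq_square mult_left_le)
      then have "s\<^sup>2 * ?R \<le> s * (?R + 1)" using s by (simp add: distrib_left)
      then show ?thesis using d(4)[OF s(1) sd(1)] by simp
    qed
    also have "\<dots> \<le> \<epsilon>"
    proof -
      have "s * (?R + 1) \<le> \<epsilon> / 4" using sd(2) R by (simp add: field_simps)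
      then show ?thesis by simp
    qed
    finally show "(\<Sum>n. (input_coeff n * exp_integral (l n) s)\<^sup>2) \<le> \<epsilon>" .
  qed
qed

end

section \<open>Smoothing series\<close>

lemma continuous_on_local:
  fixes f :: "'a::t2_space \<Rightarrow> 'b::topological_space"
  assumes "\<And>x. x \<in> S \<Longrightarrow> \<exists>U. open U \<and> x \<in> U \<and> continuous_on (S \<inter> U) f"
  shows "continuous_on S f"
  unfolding continuous_on_eq_continuous_within
proof
  fix x assume x: "x \<in> S"
  then obtain U where U: "open U" "x \<in> U" "continuous_on (S \<inter> U) f" using assms by blast
  have "at x within S = at x within (S \<inter> U)"
    by (rule at_within_nhd[OF U(2,1)]) auto
  then show "continuous (at x within S) f"
    using U x by (simp add: continuous_on_eq_continuous_within)
qed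

lemma continuous_on_slice:
  assumes "continuous_on (U \<times> V) (\<lambda>(t, z). f t z)" "t \<in> U"
  shows "continuous_on V (f t)"
proof -
  have "continuous_on V (\<lambda>z. (t, z))" by (intro continuous_intros)
  from continuous_on_compose2[OF assms(1) this] show ?thesis using assms(2) by auto
qed

lemma norm_01_continuous_of_joint:
  fixes x :: "real \<Rightarrow> real \<Rightarrow> real"
  assumes "continuous_on (U \<times> {0..1}) (\<lambda>(t, z). x t z)" "open U" "t \<in> U"
  shows "((\<lambda>s. norm_01 (\<lambda>z. x s z - x t z)) \<longlongrightarrow> 0) (at t within T)"
proof -
  have xt: "continuous_on {0..1} (x s)" if "s \<in> U" for s
    by (rule continuous_on_slice[OF assms(1) that])
  have "continuous_on (U \<times> {0..1}) (\<lambda>u. (\<lambda>(t, z). x t z) u - x t (snd u))"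
    by (intro continuous_intros assms(1) continuous_on_compose2[OF xt[OF assms(3)]]) auto
  then have "continuous_on (U \<times> cbox 0 1) (\<lambda>(s, z). (x s z - x t z) * (x s z - x t z))"
    by (simp add: case_prod_unfold continuous_on_mult)
  from integral_continuous_on_param[OF this]
  have "continuous_on U (\<lambda>s. sqrt (integral {0..1} (\<lambda>z. (x s z - x t z) * (x s z - x t z))))"
    by (auto intro!: continuous_intros)
  then have "isCont (\<lambda>s. sqrt (integral {0..1} (\<lambda>z. (x s z - x t z) * (x s z - x t z)))) t"
    using assms(2,3) by (simp add: continuous_on_eq_continuous_at)
  then have "((\<lambda>s. sqrt (integral {0..1} (\<lambda>z. (x s z - x t z) * (x s z - x t z)))) \<longlongrightarrow> 0) (at t)"
    by (simp add: isCont_def)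
  then have "((\<lambda>s. norm_01 (\<lambda>z. x s z - x t z)) \<longlongrightarrow> 0) (at t)"
  proof (rule Lim_transform_within_open[OF _ assms(2,3)])
    fix s assume "s \<in> U" "s \<noteq> t"
    then have "continuous_on {0..1} (\<lambda>z. x s z - x t z)"
      using xt assms(3) by (intro continuous_intros) auto
    then show "sqrt (integral {0..1} (\<lambda>z. (x s z - x t z) * (x s z - x t z))) = norm_01 (\<lambda>z. x s z - x t z)"
      by (simp add: norm_01_eq_inner inner_01_continuous)
  qed
  then show ?thesis by (rule tendsto_within_subset) simp
qed

context sturm_liouville
begin

text \<open>The exponential beats every power of \<open>l n\<close> with one further factor to
  spare, so the terms are eventually below those of the assumed summable series.\<close>

lemma weighted_emax_summable:
  assumes "t > 0"
  shows "summable (\<lambda>n. exp (- l n * t) * ((1 + \<bar>l n\<bar>) ^ k * emax n))"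
proof (rule summable_comparison_test_ev[OF _ summable_emax])
  have "filterlim (\<lambda>n. t * l n) at_top sequentially"
    by (rule filterlim_tendsto_pos_mult_at_top[OF tendsto_const assms l_lim])
  from filterlim_compose[OF tendsto_power_div_exp_0[of "Suc k"] this]
  have "(\<lambda>n. (t * l n) ^ Suc k / exp (t * l n)) \<longlonglongrightarrow> 0" .
  \<comment> \<open>The threshold compensates the estimate
    \<open>1 + \<bar>l n\<bar> \<le> 2 * l n\<close> raised to the power \<open>k\<close>, so that
    exactly \<open>1 / l n\<close> remains.\<close>
  then have "\<forall>\<^sub>F n in sequentially. (t * l n) ^ Suc k / exp (t * l n) < t ^ Suc k / 2 ^ k"
    using assms by (intro order_tendstoD) auto
  moreover have "\<forall>\<^sub>F n in sequentially. 1 \<le> l n"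
    using l_lim by (simp add: filterlim_at_top)
  ultimately show "\<forall>\<^sub>F n in sequentially. norm (exp (- l n * t) * ((1 + \<bar>l n\<bar>) ^ k * emax n)) \<le> emax n / \<bar>l n\<bar>"
  proof eventually_elim
    case (elim n)
    have e: "0 \<le> emax n" using emax_ge_1[of n] by simp
    have "t ^ Suc k * ((l n) ^ Suc k / exp (t * l n)) < t ^ Suc k * (1 / 2 ^ k)"
      using elim(1) unfolding power_mult_distrib by (simp del: power_Suc)
    then have *: "(l n) ^ Suc k / exp (t * l n) < 1 / 2 ^ k"
      using assms by (subst (asm) mult_less_cancel_left_pos) auto
    have "exp (- l n * t) * (1 + \<bar>l n\<bar>) ^ k \<le> exp (- l n * t) * (2 * l n) ^ k"
      using elim(2) by (intro mult_left_mono power_mono) auto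
    also have "\<dots> = 2 ^ k * ((l n) ^ Suc k / exp (t * l n)) / l n"
      using elim(2) by (simp add: exp_minus field_simps)
    also have "\<dots> \<le> 2 ^ k * (1 / 2 ^ k) / l n"
      using * elim(2) by (intro divide_right_mono mult_left_mono) auto
    finally have "exp (- l n * t) * (1 + \<bar>l n\<bar>) ^ k \<le> 1 / \<bar>l n\<bar>" using elim(2) by simp
    from mult_right_mono[OF this e]
    show ?case using e by (simp add: abs_mult mult.assoc)
  qed
qed

text \<open>The growth class on which the factors \<open>exp (- l n * t)\<close> regularise. It
  contains the eigenfunctions with their first two derivatives and is stable under multiplication by
  \<open>l n\<close>, hence under differentiation of the series in time.\<close>

definition tempered :: "(nat \<Rightarrow> real \<Rightarrow> real) \<Rightarrow> bool" where
  "tempered a \<longleftrightarrow> (\<forall>n. continuous_on {0..1} (a n)) \<and>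
     (\<exists>C k. \<forall>n. \<forall>z\<in>{0..1}. \<bar>a n z\<bar> \<le> C * ((1 + \<bar>l n\<bar>) ^ k * emax n))"

lemma temperedI:
  assumes "\<And>n. continuous_on {0..1} (a n)" "\<And>n z. z \<in> {0..1} \<Longrightarrow> \<bar>a n z\<bar> \<le> C * ((1 + \<bar>l n\<bar>) ^ k * emax n)"
  shows "tempered a"
  using assms unfolding tempered_def by blast

lemma tempered_mult_power:
  assumes "tempered a" "\<And>n. \<bar>d n\<bar> \<le> D * (1 + \<bar>l n\<bar>) ^ j"
  shows "tempered (\<lambda>n z. d n * a n z)"
proof -
  obtain C k where C: "\<And>n z. z \<in> {0..1} \<Longrightarrow> \<bar>a n z\<bar> \<le> C * ((1 + \<bar>l n\<bar>) ^ k * emax n)"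
    using assms(1) unfolding tempered_def by blast
  show ?thesis
  proof (rule temperedI)
    show "continuous_on {0..1} (\<lambda>z. d n * a n z)" for n
      using assms(1) unfolding tempered_def by (intro continuous_intros) auto
    show "\<bar>d n * a n z\<bar> \<le> (D * C) * ((1 + \<bar>l n\<bar>) ^ (j + k) * emax n)" if "z \<in> {0..1}" for n z
    proof -
      have "0 \<le> D * (1 + \<bar>l n\<bar>) ^ j" by (rule order_trans[OF abs_ge_zero assms(2)])
      then have "\<bar>d n\<bar> * \<bar>a n z\<bar> \<le> (D * (1 + \<bar>l n\<bar>) ^ j) * (C * ((1 + \<bar>l n\<bar>) ^ k * emax n))"
        by (intro mult_mono assms(2) C that) auto
      then show ?thesis by (simp add: abs_mult power_add mult_ac)
    qed
  qed
qed

lemma tempered_l: "tempered a \<Longrightarrow> tempered (\<lambda>n z. - l n * a n z)"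
  by (rule tempered_mult_power[where D=1 and j=1]) auto

lemma tempered_bounded: "tempered a \<Longrightarrow> (\<And>n. \<bar>d n\<bar> \<le> D) \<Longrightarrow> tempered (\<lambda>n z. d n * a n z)"
  by (rule tempered_mult_power[where D=D and j=0]) auto

lemma tempered_e: "tempered e"
  by (rule temperedI[where C=1 and k=0]) (auto intro!: e_D abs_e_le)

lemma e''_bound:
  obtains C where "C \<ge> 0" "\<And>n z. z \<in> {0..1} \<Longrightarrow> \<bar>dz (dz (e n)) z\<bar> \<le> C * ((1 + \<bar>l n\<bar>) * emax n)"
proof -
  have "bounded (q ` {0..1})"
    by (intro compact_imp_bounded compact_continuous_image q_cont) simp
  then obtain Q where Q: "\<And>z. z \<in> {0..1} \<Longrightarrow> \<bar>q z\<bar> \<le> Q"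
    unfolding bounded_iff by (metis image_eqI real_norm_def)
  have Q0: "Q \<ge> 0" using Q[of 0] by simp
  show thesis
  proof (rule that[of "(Q + 1) / p"])
    show "\<bar>dz (dz (e n)) z\<bar> \<le> (Q + 1) / p * ((1 + \<bar>l n\<bar>) * emax n)" if "z \<in> {0..1}" for n z
    proof -
      have "\<bar>q z - l n\<bar> \<le> Q + \<bar>l n\<bar>" using Q[OF that] by linarith
      also have "\<dots> \<le> (Q + 1) * (1 + \<bar>l n\<bar>)" using Q0 by (simp add: algebra_simps)
      finally have "\<bar>q z - l n\<bar> * \<bar>e n z\<bar> \<le> (Q + 1) * (1 + \<bar>l n\<bar>) * emax n"
        using Q0 by (intro mult_mono abs_e_le that) auto
      moreover have "dz (dz (e n)) z = (q z - l n) * e n z / p"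
        using e_eq[OF that, of n] p_pos by (simp add: field_simps)
      ultimately show ?thesis
        using p_pos by (simp add: abs_mult divide_right_mono mult.assoc)
    qed
  qed (use Q0 p_pos in auto)
qed

lemma tempered_e'': "tempered (\<lambda>n. dz (dz (e n)))"
proof -
  obtain C where C: "\<And>n z. z \<in> {0..1} \<Longrightarrow> \<bar>dz (dz (e n)) z\<bar> \<le> C * ((1 + \<bar>l n\<bar>) * emax n)"
    using e''_bound by metis
  show ?thesis
  proof (rule temperedI[where C=C and k=1])
    show "\<bar>dz (dz (e n)) z\<bar> \<le> C * ((1 + \<bar>l n\<bar>) ^ 1 * emax n)" if "z \<in> {0..1}" for n z
      using C[OF that] by simp
  qed (rule e_D(5))
qed

text \<open>The equation bounds the second derivative by \<open>emax\<close>. As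
  \<open>e n 1 = 0\<close>, the Taylor formula at 1 bounds the slope at 0, and a mean value estimate
  carries that bound to every \<open>z\<close>.\<close>

lemma tempered_e': "tempered (\<lambda>n. dz (e n))"
proof -
  obtain C where C: "C \<ge> 0" "\<And>n z. z \<in> {0..1} \<Longrightarrow> \<bar>dz (dz (e n)) z\<bar> \<le> C * ((1 + \<bar>l n\<bar>) * emax n)"
    using e''_bound by metis
  show ?thesis
  proof (rule temperedI[where C="2 * (1 + C)" and k=1])
    show "\<bar>dz (e n) z\<bar> \<le> 2 * (1 + C) * ((1 + \<bar>l n\<bar>) ^ 1 * emax n)" if z: "z \<in> {0..1}" for n z
    proof -
      let ?B = "C * ((1 + \<bar>l n\<bar>) * emax n)" and ?w = "\<lambda>s::real. max 0 (1 - s)"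
      have em: "emax n \<le> (1 + \<bar>l n\<bar>) * emax n" using emax_ge_1[of n] by (simp add: mult_le_cancel_right1)
      have w: "?w \<in> L2_01" by (intro continuous_on_imp_L2_01 continuous_intros)
      have w1: "norm_01 ?w \<le> 1" by (rule norm_01_bound(2)[OF L2_01_measurable[OF w]]) auto
      have e2: "dz (dz (e n)) \<in> L2_01" by (intro continuous_on_imp_L2_01 e_D)
      have "norm_01 (dz (dz (e n))) \<le> ?B"
        by (rule norm_01_bound(2)[OF L2_01_measurable[OF e2] C(2)])
      then have "norm_01 (dz (dz (e n))) * norm_01 ?w \<le> ?B * 1"
        by (intro mult_mono w1) (use C(1) emax_ge_1[of n] in auto)
      with inner_01_Cauchy_Schwarz[OF e2 w]
      have I: "\<bar>inner_01 (dz (dz (e n))) ?w\<bar> \<le> ?B" by simp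
      have "e n 1 = e n 0 + dz (e n) 0 * 1 + inner_01 (dz (dz (e n))) ?w"
        by (rule Taylor_01) (auto intro: e_D)
      then have "\<bar>dz (e n) 0\<bar> \<le> \<bar>e n 0\<bar> + ?B" using I by (simp add: e_1)
      then have 0: "\<bar>dz (e n) 0\<bar> \<le> emax n + ?B" using abs_e_le[of 0 n] by simp
      have "norm (dz (e n) z - dz (e n) 0) \<le> ?B * norm (z - 0)"
        by (rule field_differentiable_bound[where S="{0..1}" and f'="dz (dz (e n))"])
          (use C(2) z e_D in auto)
      also have "\<dots> \<le> ?B * 1"
        using z C(1) emax_ge_1[of n] by (intro mult_left_mono) auto
      finally have "\<bar>dz (e n) z\<bar> \<le> emax n + 2 * ?B" using 0 by simp
      also have "\<dots> \<le> 2 * (1 + C) * ((1 + \<bar>l n\<bar>) ^ 1 * emax n)"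
        using em emax_ge_1[of n] by (simp add: algebra_simps)
      finally show ?thesis .
    qed
  qed (rule e_D)
qed

text \<open>The semigroup applied termwise. The family \<open>a\<close> is arbitrary, so that the
  series of time and space derivatives are instances of the same construction.\<close>

definition "heat a t z = (\<Sum>n. exp (- l n * t) * a n z)"

lemma heat_majorant:
  assumes "tempered a" "0 < t0"
  obtains B where "summable B"
    "\<And>n t z. t0 \<le> t \<Longrightarrow> t \<le> t1 \<Longrightarrow> z \<in> {0..1} \<Longrightarrow> norm (exp (- l n * t) * a n z) \<le> B n"
proof -
  obtain C k where C: "\<And>n z. z \<in> {0..1} \<Longrightarrow> \<bar>a n z\<bar> \<le> C * ((1 + \<bar>l n\<bar>) ^ k * emax n)"
    using assms(1) unfolding tempered_def by blast
  \<comment> \<open>This factor pays for negative eigenvalues, whose exponentials increase with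
    \<open>t\<close> over the time window.\<close>
  let ?E = "exp (\<bar>l 0\<bar> * \<bar>t1 - t0\<bar>)"
  show thesis
  proof (rule that[of "\<lambda>n. ?E * C * (exp (- l n * t0) * ((1 + \<bar>l n\<bar>) ^ k * emax n))"])
    show "summable (\<lambda>n. ?E * C * (exp (- l n * t0) * ((1 + \<bar>l n\<bar>) ^ k * emax n)))"
      by (intro summable_mult weighted_emax_summable assms)
    fix n t and z :: real assume t: "t0 \<le> t" "t \<le> t1" and z: "z \<in> {0..1}"
    have "- l n * (t - t0) \<le> \<bar>l 0\<bar> * (t - t0)" using l_ge[of n] t by (intro mult_right_mono) auto
    also have "\<dots> \<le> \<bar>l 0\<bar> * \<bar>t1 - t0\<bar>" using t by (intro mult_left_mono) auto
    finally have E: "exp (- l n * (t - t0)) \<le> ?E" by simp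
    have "exp (- l n * t) = exp (- l n * (t - t0)) * exp (- l n * t0)"
      by (simp add: exp_add[symmetric] algebra_simps)
    then have "exp (- l n * t) \<le> ?E * exp (- l n * t0)" using E by simp
    then have "exp (- l n * t) * \<bar>a n z\<bar> \<le> (?E * exp (- l n * t0)) * (C * ((1 + \<bar>l n\<bar>) ^ k * emax n))"
      by (intro mult_mono C z) auto
    then show "norm (exp (- l n * t) * a n z) \<le> ?E * C * (exp (- l n * t0) * ((1 + \<bar>l n\<bar>) ^ k * emax n))"
      by (simp add: abs_mult mult_ac)
  qed
qed

lemma heat_uniform_limit:
  assumes "tempered a" "0 < t0"
  shows "uniform_limit ({t0..t1} \<times> {0..1}) (\<lambda>N u. \<Sum>n<N. exp (- l n * fst u) * a n (snd u))
    (\<lambda>u. heat a (fst u) (snd u)) sequentially"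
proof -
  obtain B where B: "summable B"
    "\<And>n t z. t0 \<le> t \<Longrightarrow> t \<le> t1 \<Longrightarrow> z \<in> {0..1} \<Longrightarrow> norm (exp (- l n * t) * a n z) \<le> B n"
    by (rule heat_majorant[OF assms]) (rule that; assumption)
  show ?thesis unfolding heat_def
    by (rule Weierstrass_m_test[OF _ B(1)]) (use B(2) in auto)
qed

lemma heat_summable:
  assumes "tempered a" "0 < t" "z \<in> {0..1}"
  shows "summable (\<lambda>n. exp (- l n * t) * a n z)"
proof -
  obtain B where B: "summable B"
    "\<And>n s z. t \<le> s \<Longrightarrow> s \<le> t \<Longrightarrow> z \<in> {0..1} \<Longrightarrow> norm (exp (- l n * s) * a n z) \<le> B n"
    by (rule heat_majorant[OF assms(1,2)]) (rule that; assumption)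
  show ?thesis by (rule summable_comparison_test'[OF B(1)]) (use B(2) assms in auto)
qed

lemma heat_continuous:
  assumes "tempered a"
  shows "continuous_on ({0<..} \<times> {0..1}) (\<lambda>(t, z). heat a t z)"
proof (rule continuous_on_local)
  fix u :: "real \<times> real" assume u: "u \<in> {0<..} \<times> {0..1}"
  let ?U = "{fst u / 2<..<2 * fst u} \<times> (UNIV :: real set)"
  have a: "continuous_on {0..1} (a n)" for n using assms unfolding tempered_def by blast
  have "continuous_on ({fst u / 2..2 * fst u} \<times> {0..1}) (\<lambda>u. heat a (fst u) (snd u))"
    by (rule uniform_limit_theorem[OF always_eventually heat_uniform_limit[OF assms]])
      (use u in \<open>auto intro!: continuous_intros continuous_on_compose2[OF a]\<close>)
  then have "continuous_on (({0<..} \<times> {0..1}) \<inter> ?U) (\<lambda>u. heat a (fst u) (snd u))"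
    by (rule continuous_on_subset) auto
  moreover have "open ?U" "u \<in> ?U" using u by (auto simp: mem_Times_iff intro!: open_Times)
  ultimately show "\<exists>U. open U \<and> u \<in> U \<and> continuous_on (({0<..} \<times> {0..1}) \<inter> U) (\<lambda>(t, z). heat a t z)"
    unfolding case_prod_unfold by blast
qed

lemma heat_continuous_space:
  assumes "tempered a" "t > 0"
  shows "continuous_on {0..1} (heat a t)"
  by (rule continuous_on_slice[OF heat_continuous[OF assms(1)]]) (simp add: assms(2))

lemma heat_uniform_limit_space:
  assumes "tempered a" "0 < t"
  shows "uniform_limit {0..1} (\<lambda>N z. \<Sum>n<N. exp (- l n * t) * a n z) (heat a t) sequentially"
proof -
  obtain B where B: "summable B"
    "\<And>n s z. t \<le> s \<Longrightarrow> s \<le> t \<Longrightarrow> z \<in> {0..1} \<Longrightarrow> norm (exp (- l n * s) * a n z) \<le> B n"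
    by (rule heat_majorant[OF assms(1,2)]) (rule that; assumption)
  show ?thesis unfolding heat_def
    by (rule Weierstrass_m_test[OF _ B(1)]) (use B(2) in auto)
qed

lemma heat_time_derivative:
  assumes "tempered a" "t > 0" "z \<in> {0..1}"
  shows "((\<lambda>s. heat a s z) has_real_derivative heat (\<lambda>n z. - l n * a n z) t z) (at t)"
  unfolding heat_def
proof (rule has_field_derivative_series'(2)[where S="{t/2..2*t}" and ?x0.0=t])
  let ?a' = "\<lambda>n z. - l n * a n z"
  show "((\<lambda>s. exp (- l n * s) * a n z) has_real_derivative exp (- l n * s) * (- l n * a n z)) (at s within {t/2..2*t})" for n s
    by (auto intro!: derivative_eq_intros)
  obtain B where B: "summable B"
    "\<And>n s z. t/2 \<le> s \<Longrightarrow> s \<le> 2*t \<Longrightarrow> z \<in> {0..1} \<Longrightarrow> norm (exp (- l n * s) * ?a' n z) \<le> B n"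
    using assms(2) by (rule heat_majorant[OF tempered_l[OF assms(1)], of "t/2" "2*t", OF half_gt_zero]) (rule that; assumption)
  have "uniform_limit {t/2..2*t} (\<lambda>N s. \<Sum>n<N. exp (- l n * s) * ?a' n z) (\<lambda>s. \<Sum>n. exp (- l n * s) * ?a' n z) sequentially"
    by (rule Weierstrass_m_test[OF _ B(1)]) (use B(2) assms in auto)
  then show "uniformly_convergent_on {t/2..2*t} (\<lambda>N s. \<Sum>n<N. exp (- l n * s) * ?a' n z)"
    by (auto simp: uniformly_convergent_on_def)
  show "summable (\<lambda>n. exp (- l n * t) * a n z)" by (rule heat_summable[OF assms])
qed (use assms in auto)

lemma heat_space_derivative:
  assumes "tempered a" "tempered a'" "t > 0" "z \<in> {0..1}"
    and "\<And>n z. z \<in> {0..1} \<Longrightarrow> (a n has_real_derivative a' n z) (at z within {0..1})"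
  shows "(heat a t has_real_derivative heat a' t z) (at z within {0..1})"
proof -
  have "\<exists>g. \<forall>z\<in>{0..1}. (\<lambda>n. exp (- l n * t) * a n z) sums g z \<and> (g has_real_derivative heat a' t z) (at z within {0..1})"
  proof (rule has_field_derivative_series[where f'="\<lambda>n z. exp (- l n * t) * a' n z"])
    show "((\<lambda>z. exp (- l n * t) * a n z) has_real_derivative exp (- l n * t) * a' n z) (at z within {0..1})"
      if "z \<in> {0..1}" for n z
      using assms(5)[OF that] by (auto intro!: derivative_eq_intros)
    show "summable (\<lambda>n. exp (- l n * t) * a n z)" by (rule heat_summable[OF assms(1,3,4)])
    show "uniform_limit {0..1} (\<lambda>N z. \<Sum>n<N. exp (- l n * t) * a' n z) (heat a' t) sequentially"
      by (rule heat_uniform_limit_space[OF assms(2,3)])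
  qed (use assms in auto)
  then obtain g where g: "\<And>z. z \<in> {0..1} \<Longrightarrow> (\<lambda>n. exp (- l n * t) * a n z) sums g z"
    "\<And>z. z \<in> {0..1} \<Longrightarrow> (g has_real_derivative heat a' t z) (at z within {0..1})" by blast
  show ?thesis
    by (rule has_real_derivative_transform[OF g(2)[OF assms(4)] assms(4)])
      (use sums_unique[OF g(1)] in \<open>simp add: heat_def\<close>)
qed

section \<open>Solutions with homogeneous boundary data\<close>

definition heat_flow :: "(nat \<Rightarrow> real) \<Rightarrow> real \<Rightarrow> real \<Rightarrow> real" where
  "heat_flow d = heat (\<lambda>n z. d n * e n z)"

lemma
  assumes "\<And>n. \<bar>d n\<bar> \<le> D"
  shows tempered_d: "tempered (\<lambda>n z. d n * e n z)"
    and tempered_d': "tempered (\<lambda>n z. d n * dz (e n) z)"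
    and tempered_d'': "tempered (\<lambda>n z. d n * dz (dz (e n)) z)"
  by (rule tempered_bounded[OF _ assms] tempered_e tempered_e' tempered_e'')+

lemma heat_flow_C2:
  assumes d: "\<And>n. \<bar>d n\<bar> \<le> D" and t: "t > 0"
  shows "C2_01 (heat_flow d t)"
    "\<And>z. z \<in> {0..1} \<Longrightarrow> dz (heat_flow d t) z = heat (\<lambda>n z. d n * dz (e n) z) t z"
    "\<And>z. z \<in> {0..1} \<Longrightarrow> p * dz (dz (heat_flow d t)) z - q z * heat_flow d t z
       = heat (\<lambda>n z. - l n * (d n * e n z)) t z"
    "b1 * heat_flow d t 0 + b2 * dz (heat_flow d t) 0 = 0"
    "heat_flow d t 1 = 0"
proof -
  note T = tempered_d[of d, OF d] tempered_d'[of d, OF d] tempered_d''[of d, OF d]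
  have 1: "(heat_flow d t has_real_derivative heat (\<lambda>n z. d n * dz (e n) z) t z) (at z within {0..1})" if "z \<in> {0..1}" for z
    unfolding heat_flow_def using e_D(1)
    by (intro heat_space_derivative[OF T(1,2) t that]) (auto intro!: derivative_eq_intros)
  have 2: "(heat (\<lambda>n z. d n * dz (e n) z) t has_real_derivative heat (\<lambda>n z. d n * dz (dz (e n)) z) t z) (at z within {0..1})" if "z \<in> {0..1}" for z
    using e_D(2)
    by (intro heat_space_derivative[OF T(2,3) t that]) (auto intro!: derivative_eq_intros)
  note I = C2_01I[OF 1 2 heat_continuous_space[OF T(3) t]]
  show "C2_01 (heat_flow d t)" using I(1) by auto
  show dd: "dz (heat_flow d t) z = heat (\<lambda>n z. d n * dz (e n) z) t z" if "z \<in> {0..1}" for z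
    using I(2)[of z] that by auto
  show "p * dz (dz (heat_flow d t)) z - q z * heat_flow d t z = heat (\<lambda>n z. - l n * (d n * e n z)) t z" if z: "z \<in> {0..1}" for z
  proof -
    have "(\<lambda>n. p * (exp (- l n * t) * (d n * dz (dz (e n)) z)) - q z * (exp (- l n * t) * (d n * e n z))) sums
      (p * heat (\<lambda>n z. d n * dz (dz (e n)) z) t z - q z * heat_flow d t z)"
      unfolding heat_flow_def heat_def
      by (intro sums_diff sums_mult summable_sums heat_summable[OF T(1) t z] heat_summable[OF T(3) t z])
    moreover have "p * (exp (- l n * t) * (d n * dz (dz (e n)) z)) - q z * (exp (- l n * t) * (d n * e n z))
       = exp (- l n * t) * (- l n * (d n * e n z))" for n
    proof -
      have "p * (exp (- l n * t) * (d n * dz (dz (e n)) z)) = exp (- l n * t) * d n * (p * dz (dz (e n)) z)" by simp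
      also have "\<dots> = exp (- l n * t) * d n * ((q z - l n) * e n z)" using e_eq[OF z] by simp
      finally show ?thesis by (simp add: algebra_simps)
    qed
    ultimately show ?thesis using I(3)[of z] z by (simp add: heat_def sums_iff)
  qed
  show "b1 * heat_flow d t 0 + b2 * dz (heat_flow d t) 0 = 0"
  proof -
    have "(\<lambda>n. b1 * (exp (- l n * t) * (d n * e n 0)) + b2 * (exp (- l n * t) * (d n * dz (e n) 0))) sums
      (b1 * heat_flow d t 0 + b2 * heat (\<lambda>n z. d n * dz (e n) z) t 0)"
      unfolding heat_flow_def heat_def
      by (intro sums_add sums_mult summable_sums heat_summable[OF T(1) t] heat_summable[OF T(2) t]) auto
    moreover have "b1 * (exp (- l n * t) * (d n * e n 0)) + b2 * (exp (- l n * t) * (d n * dz (e n) 0)) = 0" for n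
    proof -
      have "b1 * (exp (- l n * t) * (d n * e n 0)) + b2 * (exp (- l n * t) * (d n * dz (e n) 0))
        = exp (- l n * t) * d n * (b1 * e n 0 + b2 * dz (e n) 0)" by (simp add: algebra_simps)
      then show ?thesis by (simp add: e_0)
    qed
    ultimately show ?thesis using dd[of 0] by (simp add: sums_iff)
  qed
  show "heat_flow d t 1 = 0" by (simp add: heat_flow_def heat_def e_1)
qed

lemma heat_flow_coeff:
  assumes d: "\<And>n. \<bar>d n\<bar> \<le> D" and t: "t > 0"
  shows "fcoeff (heat_flow d t) k = exp (- l k * t) * d k"
proof -
  note T = tempered_d[of d, OF d]
  have "(\<lambda>N. fcoeff (\<lambda>z. \<Sum>n<N. exp (- l n * t) * (d n * e n z)) k) \<longlonglongrightarrow> fcoeff (heat_flow d t) k"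
  proof (rule inner_01_tendsto)
    show "(\<lambda>N. norm_01 (\<lambda>z. (\<Sum>n<N. exp (- l n * t) * (d n * e n z)) - heat_flow d t z)) \<longlonglongrightarrow> 0"
      unfolding heat_flow_def
      by (rule uniform_limit_imp_norm_01[OF heat_uniform_limit_space[OF T t]])
        (auto intro!: continuous_intros e_D heat_continuous_space[OF T t])
    show "\<forall>\<^sub>F N in sequentially. (\<lambda>z. \<Sum>n<N. exp (- l n * t) * (d n * e n z)) \<in> L2_01"
      by (auto intro!: always_eventually continuous_on_imp_L2_01 continuous_intros e_D)
    show "heat_flow d t \<in> L2_01"
      unfolding heat_flow_def by (intro continuous_on_imp_L2_01 heat_continuous_space[OF T t])
  qed (rule e_L2)
  moreover have "\<forall>\<^sub>F N in sequentially. fcoeff (\<lambda>z. \<Sum>n<N. exp (- l n * t) * (d n * e n z)) k = exp (- l k * t) * d k"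
    using eventually_gt_at_top[of k]
  proof eventually_elim
    case (elim N)
    then show ?case
      using coeff_partial_sum[of "\<lambda>n. exp (- l n * t) * d n" N k] by (simp add: mult.assoc)
  qed
  ultimately show ?thesis
    by (rule LIMSEQ_unique[OF _ tendsto_eventually])
qed

text \<open>The majorants of the series are available only away from \<open>t = 0\<close>. The
  initial value is therefore reached in the \<open>L2\<close> sense, by Parseval and
  \<open>semigroup_small\<close>.\<close>

lemma heat_flow_strongly_continuous:
  assumes "f \<in> L2_01"
  shows "((\<lambda>t. norm_01 (\<lambda>z. heat_flow (fcoeff f) t z - f z)) \<longlongrightarrow> 0) (at_right 0)"
proof (rule tendstoI)
  fix r :: real assume r: "r > 0"
  note T = tempered_d[of "fcoeff f", OF abs_coeff_le[OF assms]]
  obtain \<delta> where \<delta>: "0 < \<delta>" "\<delta> \<le> 1"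
    "\<And>s. 0 \<le> s \<Longrightarrow> s \<le> \<delta> \<Longrightarrow> summable (\<lambda>n. (fcoeff f n * (1 - exp (- l n * s)))\<^sup>2)"
    "\<And>s. 0 \<le> s \<Longrightarrow> s \<le> \<delta> \<Longrightarrow> (\<Sum>n. (fcoeff f n * (1 - exp (- l n * s)))\<^sup>2) \<le> (r / 2)\<^sup>2"
    using semigroup_small[OF sums_summable[OF Parseval[OF assms]], of "(r / 2)\<^sup>2"] r by auto
  have "dist (norm_01 (\<lambda>z. heat_flow (fcoeff f) t z - f z)) 0 < r" if t: "0 < t" "t < \<delta>" for t
  proof -
    have S: "heat_flow (fcoeff f) t \<in> L2_01"
      unfolding heat_flow_def by (intro continuous_on_imp_L2_01 heat_continuous_space[OF T t(1)])
    have "(\<lambda>n. (fcoeff (\<lambda>z. heat_flow (fcoeff f) t z - f z) n)\<^sup>2) sums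
      inner_01 (\<lambda>z. heat_flow (fcoeff f) t z - f z) (\<lambda>z. heat_flow (fcoeff f) t z - f z)"
      by (intro Parseval L2_01_diff S assms)
    moreover have "(fcoeff (\<lambda>z. heat_flow (fcoeff f) t z - f z) n)\<^sup>2 = (fcoeff f n * (1 - exp (- l n * t)))\<^sup>2" for n
    proof -
      have "fcoeff (\<lambda>z. heat_flow (fcoeff f) t z - f z) n = - (fcoeff f n * (1 - exp (- l n * t)))"
        unfolding inner_01_diff_left[OF S assms e_L2] heat_flow_coeff[of "fcoeff f", OF abs_coeff_le[OF assms] t(1)]
        by (simp add: right_diff_distrib mult.commute)
      then show ?thesis by (simp only: power2_minus)
    qed
    ultimately have "(norm_01 (\<lambda>z. heat_flow (fcoeff f) t z - f z))\<^sup>2 \<le> (r / 2)\<^sup>2"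
      using \<delta>(4)[of t] t by (simp add: norm_01_squared sums_iff)
    then have "norm_01 (\<lambda>z. heat_flow (fcoeff f) t z - f z) \<le> r / 2"
      using r by (simp add: power2_le_iff_abs_le)
    then show ?thesis using r by simp
  qed
  then show "\<forall>\<^sub>F t in at_right 0. dist (norm_01 (\<lambda>z. heat_flow (fcoeff f) t z - f z)) 0 < r"
    unfolding eventually_at_right_field using \<delta>(1) by blast
qed

end

section \<open>Sampling times\<close>

locale sampling =
  fixes \<tau> :: "nat \<Rightarrow> real"
  assumes tau_mono: "strict_mono \<tau>" and tau_0: "\<tau> 0 = 0" and tau_lim: "filterlim \<tau> at_top sequentially"
begin

definition "idx t = (LEAST i. t < \<tau> (Suc i))"

lemma tau_less: "\<tau> i < \<tau> (Suc i)"
  using tau_mono by (simp add: strict_mono_Suc_iff)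

lemma tau_less_iff: "\<tau> i < \<tau> j \<longleftrightarrow> i < j"
  using tau_mono by (simp add: strict_mono_less)

lemma tau_le_iff: "\<tau> i \<le> \<tau> j \<longleftrightarrow> i \<le> j"
  using tau_mono by (simp add: strict_mono_less_eq)

lemma tau_nonneg: "0 \<le> \<tau> i"
  using tau_le_iff[of 0 i] by (simp add: tau_0)

lemma idx_bounds:
  assumes "0 \<le> t"
  shows "\<tau> (idx t) \<le> t" "t < \<tau> (Suc (idx t))"
proof -
  have "\<forall>\<^sub>F i in sequentially. t < \<tau> i" using tau_lim by (simp add: filterlim_at_top_dense)
  then obtain N where "\<And>i. i \<ge> N \<Longrightarrow> t < \<tau> i" by (auto simp: eventually_sequentially)
  then have "t < \<tau> (Suc N)" by simp
  then show "t < \<tau> (Suc (idx t))" unfolding idx_def by (rule LeastI)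
  show "\<tau> (idx t) \<le> t"
  proof (cases "idx t")
    case 0
    then show ?thesis using assms by (simp add: tau_0)
  next
    case (Suc j)
    then have "\<not> t < \<tau> (Suc j)" unfolding idx_def using not_less_Least[of j "\<lambda>i. t < \<tau> (Suc i)"] by simp
    then show ?thesis using Suc by simp
  qed
qed

lemma idx_eqI:
  assumes "\<tau> i \<le> t" "t < \<tau> (Suc i)"
  shows "idx t = i"
  unfolding idx_def
proof (rule Least_equality)
  fix j assume "t < \<tau> (Suc j)"
  then have "\<tau> i < \<tau> (Suc j)" using assms by linarith
  then show "i \<le> j" by (simp add: tau_less_iff)
qed (rule assms)

lemma between_samples:
  assumes "\<tau> i < t" "t < \<tau> (Suc i)"
  shows "t \<in> {0..} - range \<tau>"
proof -
  have "t \<noteq> \<tau> j" for j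
  proof
    assume "t = \<tau> j"
    then have "i < j" "j < Suc i" using assms tau_less_iff by auto
    then show False by simp
  qed
  then show ?thesis using assms tau_nonneg[of i] by auto
qed

lemma nonsample_idx:
  assumes "t \<in> {0..} - range \<tau>"
  shows "\<tau> (idx t) < t" "t < \<tau> (Suc (idx t))"
proof -
  have "\<tau> (idx t) \<noteq> t" using assms by (metis DiffE rangeI)
  then show "\<tau> (idx t) < t" "t < \<tau> (Suc (idx t))" using idx_bounds[of t] assms by auto
qed

text \<open>Removing \<open>\<tau> 0 = 0\<close> takes away the closed end of the half line, and
  what remains is the union of the open sampling intervals.\<close>

lemma open_nonsample: "open ({0..} - range \<tau>)"
proof -
  have "{0..} - range \<tau> = (\<Union>i. {\<tau> i<..<\<tau> (Suc i)})"
    using nonsample_idx between_samples by fastforce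
  then show ?thesis by auto
qed

lemma nonsample_pos: "{0..} - range \<tau> \<subseteq> {0<..}"
  using tau_0 by (auto simp: less_le)

lemma finite_samples: "finite (range \<tau> \<inter> {a..b})"
proof (cases "b \<ge> 0")
  case True
  have "range \<tau> \<inter> {a..b} \<subseteq> \<tau> ` {..idx b}"
  proof clarify
    fix i assume "\<tau> i \<in> {a..b}"
    then have "\<tau> i < \<tau> (Suc (idx b))" using idx_bounds[OF True] by auto
    then show "\<tau> i \<in> \<tau> ` {..idx b}" by (auto simp: tau_less_iff)
  qed
  then show ?thesis by (rule finite_subset) simp
next
  case False
  have "range \<tau> \<inter> {a..b} = {}"
  proof (rule equals0I)
    fix s assume "s \<in> range \<tau> \<inter> {a..b}"
    then obtain i where "s = \<tau> i" "s \<le> b" by auto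
    then show False using False tau_nonneg[of i] by simp
  qed
  then show ?thesis by simp
qed

lemma idx_mono:
  assumes "0 \<le> s" "s \<le> t"
  shows "idx s \<le> idx t"
proof -
  have "\<tau> (idx s) < \<tau> (Suc (idx t))" using idx_bounds[of s] idx_bounds[of t] assms by linarith
  then show ?thesis by (simp add: tau_less_iff)
qed

lemma piecewise_continuous_on:
  assumes "\<And>i. continuous_on ({0<..} \<times> {0..1}) (\<lambda>(t, z). Y i t z)"
  shows "continuous_on (({0..} - range \<tau>) \<times> {0..1}) (\<lambda>(t, z). Y (idx t) (t - \<tau> (idx t)) (z::real) :: real)"
proof (rule continuous_on_local)
  fix u :: "real \<times> real" assume u: "u \<in> ({0..} - range \<tau>) \<times> {0..1}"
  define i where "i = idx (fst u)"
  \<comment> \<open>On this open strip the index is constantly \<open>i\<close>, so the jumps of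
    \<open>idx\<close> do not affect continuity.\<close>
  let ?U = "{\<tau> i<..<\<tau> (Suc i)} \<times> (UNIV :: real set)"
  let ?S = "(({0..} - range \<tau>) \<times> {0..1}) \<inter> ?U"
  have "continuous_on ?S (\<lambda>u. (fst u - \<tau> i, snd u))"
    by (intro continuous_intros)
  then have "continuous_on ?S (\<lambda>u. (\<lambda>(t, z). Y i t z) (fst u - \<tau> i, snd u))"
    by (rule continuous_on_compose2[OF assms]) auto
  then have "continuous_on ?S (\<lambda>(t, z). Y (idx t) (t - \<tau> (idx t)) z)"
    by (rule continuous_on_cong[THEN iffD1, rotated 2]) (auto simp: idx_eqI[of i])
  moreover have "open ?U" "u \<in> ?U"
    using nonsample_idx[of "fst u"] u by (auto simp: i_def mem_Times_iff intro!: open_Times)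
  ultimately show "\<exists>U. open U \<and> u \<in> U \<and>
      continuous_on ((({0..} - range \<tau>) \<times> {0..1}) \<inter> U) (\<lambda>(t, z). Y (idx t) (t - \<tau> (idx t)) z)"
    by blast
qed

end

section \<open>Solutions with constant boundary input\<close>

locale lifted_sturm_liouville = sturm_liouville +
  fixes h r :: "real \<Rightarrow> real"
  assumes h_C2: "C2_01 h" and h_0: "b1 * h 0 + b2 * dz h 0 = 0" and h_1: "h 1 = 1"
    and h_eq: "z \<in> {0..1} \<Longrightarrow> p * dz (dz h) z - q z * h z = r z"
    and r_C2: "C2_01 r" and r_0: "b1 * r 0 + b2 * dz r 0 = 0" and r_1: "r 1 = 0"
    and r_eq: "z \<in> {0..1} \<Longrightarrow> p * dz (dz r) z - q z * r z = 0"
begin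

lemmas h_D = C2_01D[OF h_C2] and r_D = C2_01D[OF r_C2]

definition "init f u n = fcoeff (\<lambda>z. f z - u * h z) n"

text \<open>For unit input \<open>h + t * r\<close> is a particular solution: its time derivative
  \<open>r\<close> is also what the spatial operator yields. Subtracting its \<open>u\<close>-fold
  leaves a homogeneous problem with datum \<open>f - u * h\<close>. At time 0 the datum itself is
  prescribed, because the series represents it only in \<open>L2\<close>.\<close>

definition sol :: "(real \<Rightarrow> real) \<Rightarrow> real \<Rightarrow> real \<Rightarrow> real \<Rightarrow> real" where
  "sol f u t z = (if t \<le> 0 then f z else u * (h z + t * r z) + heat_flow (init f u) t z)"

definition "sol_t f u t z = u * r z + heat (\<lambda>n z. - l n * (init f u n * e n z)) t z"

definition "sol_z f u t z = u * (dz h z + t * dz r z) + heat (\<lambda>n z. init f u n * dz (e n) z) t z"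

lemma h_L2: "h \<in> L2_01" and r_L2: "r \<in> L2_01"
  by (intro continuous_on_imp_L2_01 h_D r_D)+

lemma init_bound:
  assumes "f \<in> L2_01"
  shows "\<bar>init f u n\<bar> \<le> norm_01 (\<lambda>z. f z - u * h z)"
  unfolding init_def by (intro abs_coeff_le L2_01_diff L2_01_scale assms h_L2)

lemma sol_0 [simp]: "sol f u 0 = f"
  by (auto simp: sol_def)

lemma sol_pos: "t > 0 \<Longrightarrow> sol f u t = (\<lambda>z. u * (h z + t * r z) + heat_flow (init f u) t z)"
  by (auto simp: sol_def)

context
  fixes f :: "real \<Rightarrow> real" and u :: real
  assumes f: "f \<in> L2_01"
begin

lemma tempered_init:
  shows tempered_i: "tempered (\<lambda>n z. init f u n * e n z)"
    and tempered_i': "tempered (\<lambda>n z. init f u n * dz (e n) z)"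
    and tempered_il: "tempered (\<lambda>n z. - l n * (init f u n * e n z))"
  using tempered_d[of "init f u", OF init_bound[OF f]] tempered_d'[of "init f u", OF init_bound[OF f]]
    tempered_l[OF tempered_d[of "init f u", OF init_bound[OF f]]] by - assumption+

lemma sol_space:
  assumes "t > 0"
  shows "C2_01 (sol f u t)" "\<And>z. z \<in> {0..1} \<Longrightarrow> dz (sol f u t) z = sol_z f u t z"
    "\<And>z. z \<in> {0..1} \<Longrightarrow> p * dz (dz (sol f u t)) z - q z * sol f u t z = sol_t f u t z"
    "b1 * sol f u t 0 + b2 * dz (sol f u t) 0 = 0" "sol f u t 1 = u"
proof -
  let ?g = "\<lambda>z. u * h z + (u * t) * r z" and ?w = "heat_flow (init f u) t"
  note g = C2_01_lincomb[OF h_C2 r_C2, where a=u and b="u * t"]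
  note w = heat_flow_C2[of "init f u", OF init_bound[OF f] assms]
  note s = C2_01_lincomb[OF g(1) w(1), where a=1 and b=1]
  have eq: "sol f u t = (\<lambda>z. 1 * ?g z + 1 * ?w z)"
    using assms by (auto simp: sol_pos algebra_simps)
  show "C2_01 (sol f u t)" unfolding eq by (rule s(1))
  have d: "dz (sol f u t) z = u * dz h z + u * t * dz r z + dz ?w z" if "z \<in> {0..1}" for z
    unfolding eq using s(2)[OF that] g(2)[OF that] by simp
  show "dz (sol f u t) z = sol_z f u t z" if "z \<in> {0..1}" for z
    using d[OF that] w(2)[OF that] by (simp add: sol_z_def algebra_simps)
  have d2: "dz (dz (sol f u t)) z = u * dz (dz h) z + u * t * dz (dz r) z + dz (dz ?w) z" if "z \<in> {0..1}" for z
    unfolding eq using s(3)[OF that] g(3)[OF that] by simp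
  show "p * dz (dz (sol f u t)) z - q z * sol f u t z = sol_t f u t z" if z: "z \<in> {0..1}" for z
  proof -
    have "p * dz (dz (sol f u t)) z - q z * sol f u t z =
        u * (p * dz (dz h) z - q z * h z) + u * t * (p * dz (dz r) z - q z * r z)
          + (p * dz (dz ?w) z - q z * ?w z)"
      unfolding d2[OF z] using assms by (simp add: sol_pos algebra_simps)
    then show ?thesis by (simp add: h_eq[OF z] r_eq[OF z] w(3)[OF z] sol_t_def)
  qed
  have "b1 * sol f u t 0 + b2 * dz (sol f u t) 0 =
     u * (b1 * h 0 + b2 * dz h 0) + u * t * (b1 * r 0 + b2 * dz r 0) + (b1 * ?w 0 + b2 * dz ?w 0)"
    using d[of 0] assms by (simp add: sol_pos algebra_simps)
  then show "b1 * sol f u t 0 + b2 * dz (sol f u t) 0 = 0"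
    by (simp add: h_0 r_0 w(4))
  show "sol f u t 1 = u" using assms by (simp add: sol_pos h_1 r_1 w(5))
qed

lemma sol_continuous:
  shows "continuous_on ({0<..} \<times> {0..1}) (\<lambda>(t, z). sol f u t z)" (is ?A)
    and "continuous_on ({0<..} \<times> {0..1}) (\<lambda>(t, z). sol_t f u t z)" (is ?B)
    and "continuous_on ({0<..} \<times> {0..1}) (\<lambda>(t, z). sol_z f u t z)" (is ?C)
proof -
  let ?S = "{0<..} \<times> {0..1::real}"
  have sp: "continuous_on ?S (\<lambda>w. g (snd w))" if "continuous_on {0..1} g" for g :: "real \<Rightarrow> real"
    by (rule continuous_on_compose2[OF that]) (auto intro!: continuous_intros)
  have "continuous_on ?S (\<lambda>w. u * (h (snd w) + fst w * r (snd w)) +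
      (\<lambda>(t, z). heat (\<lambda>n z. init f u n * e n z) t z) w)"
    by (intro continuous_intros sp h_D r_D heat_continuous tempered_init)
  then show ?A
    by (rule continuous_on_cong[THEN iffD1, rotated 2]) (auto simp: sol_pos heat_flow_def)
  have "continuous_on ?S (\<lambda>w. u * r (snd w) +
      (\<lambda>(t, z). heat (\<lambda>n z. - l n * (init f u n * e n z)) t z) w)"
    by (intro continuous_intros sp h_D r_D heat_continuous tempered_init)
  then show ?B
    by (rule continuous_on_cong[THEN iffD1, rotated 2]) (auto simp: sol_t_def)
  have "continuous_on ?S (\<lambda>w. u * (dz h (snd w) + fst w * dz r (snd w)) +
      (\<lambda>(t, z). heat (\<lambda>n z. init f u n * dz (e n) z) t z) w)"
    by (intro continuous_intros sp h_D r_D heat_continuous tempered_init)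
  then show ?C
    by (rule continuous_on_cong[THEN iffD1, rotated 2]) (auto simp: sol_z_def)
qed

lemma sol_time:
  assumes "t > 0" "z \<in> {0..1}"
  shows "((\<lambda>s. sol f u s z) has_real_derivative sol_t f u t z) (at t)"
proof -
  have "((\<lambda>s. u * (h z + s * r z) + heat_flow (init f u) s z) has_real_derivative sol_t f u t z) (at t)"
    unfolding heat_flow_def sol_t_def using heat_time_derivative[OF tempered_i assms]
    by (auto intro!: derivative_eq_intros)
  then show ?thesis
    by (rule has_field_derivative_transform_within_open[of _ _ _ "{0<..}"])
      (use assms in \<open>auto simp: sol_pos\<close>)
qed

lemma sol_L2:
  assumes "t \<ge> 0"
  shows "sol f u t \<in> L2_01"
proof (cases "t = 0")
  case False
  then show ?thesis using assms continuous_on_imp_L2_01[OF C2_01D(3)[OF sol_space(1)]] by simp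
qed (simp add: f)

lemma sol_L2_continuous:
  assumes "t \<ge> 0"
  shows "((\<lambda>s. norm_01 (\<lambda>z. sol f u s z - sol f u t z)) \<longlongrightarrow> 0) (at t within {0..})"
proof (cases "t = 0")
  case False
  then show ?thesis using assms by (intro norm_01_continuous_of_joint[OF sol_continuous(1)]) auto
next
  case True
  let ?w = "\<lambda>z. f z - u * h z"
  have wL: "?w \<in> L2_01" by (intro L2_01_diff L2_01_scale f h_L2)
  have i: "init f u = fcoeff ?w" by (auto simp: init_def)
  have "((\<lambda>s. norm_01 (\<lambda>z. sol f u s z - f z)) \<longlongrightarrow> 0) (at_right 0)"
  proof (rule Lim_null_comparison)
    have "((\<lambda>s. norm_01 (\<lambda>z. heat_flow (fcoeff ?w) s z - ?w z) + \<bar>u * s\<bar> * norm_01 r) \<longlongrightarrow> 0 + \<bar>u * 0\<bar> * norm_01 r) (at_right 0)"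
      by (intro tendsto_intros heat_flow_strongly_continuous wL)
    then show "((\<lambda>s. norm_01 (\<lambda>z. heat_flow (fcoeff ?w) s z - ?w z) + \<bar>u * s\<bar> * norm_01 r) \<longlongrightarrow> 0) (at_right 0)"
      by simp
    have "norm (norm_01 (\<lambda>z. sol f u s z - f z)) \<le> norm_01 (\<lambda>z. heat_flow (fcoeff ?w) s z - ?w z) + \<bar>u * s\<bar> * norm_01 r"
      if s: "s > 0" for s
    proof -
      have "heat_flow (fcoeff ?w) s \<in> L2_01"
        using C2_01D(3)[OF heat_flow_C2(1)[of "fcoeff ?w", OF abs_coeff_le[OF wL] s]] by (rule continuous_on_imp_L2_01)
      then have "norm_01 (\<lambda>z. (heat_flow (fcoeff ?w) s z - ?w z) + (u * s) * r z) \<le>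
          norm_01 (\<lambda>z. heat_flow (fcoeff ?w) s z - ?w z) + norm_01 (\<lambda>z. (u * s) * r z)"
        by (intro norm_01_triangle L2_01_diff L2_01_scale r_L2 wL)
      moreover have "(\<lambda>z. sol f u s z - f z) = (\<lambda>z. (heat_flow (fcoeff ?w) s z - ?w z) + (u * s) * r z)"
        using s by (auto simp: sol_pos i algebra_simps)
      ultimately show ?thesis by (simp add: norm_01_scale)
    qed
    then show "\<forall>\<^sub>F s in at_right 0. norm (norm_01 (\<lambda>z. sol f u s z - f z)) \<le>
        norm_01 (\<lambda>z. heat_flow (fcoeff ?w) s z - ?w z) + \<bar>u * s\<bar> * norm_01 r"
      unfolding eventually_at_right_field by (intro exI[of _ 1]) auto
  qed
  then show ?thesis using True by (simp add: at_within_Ici_at_right)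
qed

end

end

section \<open>Sampled-data solutions\<close>

lemma sampled_solutionE:
  assumes "sampled_solution p q b1 b2 k \<tau> x0 x"
  obtains u where "L2_trajectory x" "\<And>t. t > 0 \<Longrightarrow> C2_01 (x t)" "\<And>z. z \<in> {0..1} \<Longrightarrow> x 0 z = x0 z"
    "\<And>i t. \<tau> i \<le> t \<Longrightarrow> t < \<tau> (Suc i) \<Longrightarrow> u t = inner_01 k (x (\<tau> i))"
    "parabolic_solution p q b1 b2 ({0..} - range \<tau>) u x"
  using assms unfolding sampled_solution_def inner_01_def by (metis atLeastLessThan_iff)

locale sampled_system = lifted_sturm_liouville + sampling +
  fixes k :: "real \<Rightarrow> real"
  assumes k_L2: "k \<in> L2_01"
begin

section \<open>Concatenation of solutions over the sampling intervals\<close>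

primrec state :: "(real \<Rightarrow> real) \<Rightarrow> nat \<Rightarrow> real \<Rightarrow> real" where
  "state x0 0 = x0"
| "state x0 (Suc i) = sol (state x0 i) (inner_01 k (state x0 i)) (\<tau> (Suc i) - \<tau> i)"

definition piece :: "(real \<Rightarrow> real) \<Rightarrow> nat \<Rightarrow> real \<Rightarrow> real \<Rightarrow> real" where
  "piece x0 i = sol (state x0 i) (inner_01 k (state x0 i))"

definition trajectory :: "(real \<Rightarrow> real) \<Rightarrow> real \<Rightarrow> real \<Rightarrow> real" where
  "trajectory x0 t = piece x0 (idx t) (t - \<tau> (idx t))"

context
  fixes x0 :: "real \<Rightarrow> real"
  assumes x0: "x0 \<in> L2_01"
begin

lemma state_L2: "state x0 i \<in> L2_01"
  by (induction i) (use x0 tau_less in \<open>auto intro!: sol_L2 simp: less_imp_le\<close>)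

text \<open>The right end point is included because the next piece starts from the state just
  reached. Left continuity and smoothness at sampling instants follow from this.\<close>

lemma trajectory_eq_piece:
  assumes "\<tau> i \<le> t" "t \<le> \<tau> (Suc i)"
  shows "trajectory x0 t = piece x0 i (t - \<tau> i)"
proof (cases "t = \<tau> (Suc i)")
  case True
  have "idx t = Suc i" using True tau_less[of "Suc i"] by (intro idx_eqI) auto
  then show ?thesis using True by (simp add: trajectory_def piece_def)
next
  case False
  then have "idx t = i" using assms by (intro idx_eqI) auto
  then show ?thesis by (simp add: trajectory_def)
qed

lemma trajectory_sample: "trajectory x0 (\<tau> i) = state x0 i"
  using trajectory_eq_piece[of i "\<tau> i"] tau_less[of i] by (simp add: piece_def)

lemma trajectory_C2:
  assumes "t > 0"
  shows "C2_01 (trajectory x0 t)"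
proof -
  \<comment> \<open>A sampling instant is assigned to the end of the preceding piece, where positive
    time has elapsed and smoothing has taken place.\<close>
  obtain i where i: "\<tau> i < t" "t \<le> \<tau> (Suc i)"
  proof (cases "\<tau> (idx t) < t")
    case True
    then show thesis using that[of "idx t"] idx_bounds[of t] assms by simp
  next
    case False
    then have t: "t = \<tau> (idx t)" using idx_bounds[of t] assms by simp
    then obtain j where "idx t = Suc j" using assms tau_0 by (cases "idx t") auto
    then show thesis using that[of j] t tau_less[of j] by simp
  qed
  then show ?thesis
    using trajectory_eq_piece[of i t] sol_space(1)[OF state_L2] by (simp add: piece_def)
qed

lemma trajectory_L2: "t \<ge> 0 \<Longrightarrow> trajectory x0 t \<in> L2_01"
  using idx_bounds[of t] by (simp add: trajectory_def piece_def sol_L2[OF state_L2])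

lemma trajectory_piece_continuous:
  assumes "\<tau> i \<le> t" "t \<le> \<tau> (Suc i)"
  shows "((\<lambda>s. norm_01 (\<lambda>z. trajectory x0 s z - trajectory x0 t z)) \<longlongrightarrow> 0) (at t within {\<tau> i..\<tau> (Suc i)})"
proof -
  have "((\<lambda>s. norm_01 (\<lambda>z. piece x0 i s z - piece x0 i (t - \<tau> i) z)) \<longlongrightarrow> 0) (at (t - \<tau> i) within {0..})"
    unfolding piece_def by (rule sol_L2_continuous[OF state_L2]) (use assms in simp)
  moreover have "filterlim (\<lambda>s. s - \<tau> i) (at (t - \<tau> i) within {0..}) (at t within {\<tau> i..\<tau> (Suc i)})"
    unfolding filterlim_at
    by (auto intro!: tendsto_intros simp: eventually_at_filter)
  ultimately have "((\<lambda>s. norm_01 (\<lambda>z. piece x0 i (s - \<tau> i) z - piece x0 i (t - \<tau> i) z)) \<longlongrightarrow> 0) (at t within {\<tau> i..\<tau> (Suc i)})"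
    by (rule filterlim_compose)
  then show ?thesis
    by (rule Lim_transform_within[OF _ zero_less_one])
      (use trajectory_eq_piece assms in auto)
qed

lemma trajectory_L2_trajectory: "L2_trajectory (trajectory x0)"
  unfolding L2_trajectory_def
proof (intro conjI allI impI)
  show "trajectory x0 t \<in> L2_01" if "0 \<le> t" for t by (rule trajectory_L2[OF that])
  fix t :: real assume t: "0 \<le> t"
  let ?F = "\<lambda>s. norm_01 (\<lambda>z. trajectory x0 s z - trajectory x0 t z)"
  let ?i = "idx t"
  note i = idx_bounds[OF t]
  have R: "(?F \<longlongrightarrow> 0) (at t within {\<tau> ?i..\<tau> (Suc ?i)})"
    by (rule trajectory_piece_continuous) (use i in auto)
  \<comment> \<open>Inside an interval and at 0 one piece describes a neighbourhood of
    \<open>t\<close>; at a later sampling instant the limits from two pieces are joined.\<close>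
  consider "\<tau> ?i < t" | "?i = 0" "t = 0" | j where "?i = Suc j" "t = \<tau> (Suc j)"
    using i t tau_0 by (cases ?i) (auto simp: less_le)
  then show "(?F \<longlongrightarrow> 0) (at t within {0..})"
  proof cases
    case 1
    have "at t within {0..} = at t within {\<tau> ?i..\<tau> (Suc ?i)}"
      by (rule at_within_nhd[of t "{\<tau> ?i<..<\<tau> (Suc ?i)}"]) (use 1 i tau_nonneg[of ?i] in auto)
    then show ?thesis using R by simp
  next
    case 2
    have "at t within {0..} = at t within {\<tau> ?i..\<tau> (Suc ?i)}"
      by (rule at_within_nhd[of t "{..<\<tau> (Suc ?i)}"]) (use 2 i tau_0 in auto)
    then show ?thesis using R by simp
  next
    case 3
    have L: "(?F \<longlongrightarrow> 0) (at t within {\<tau> j..\<tau> (Suc j)})"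
      by (rule trajectory_piece_continuous) (use 3 tau_less[of j] in auto)
    have "at t within {0..} = at t within ({\<tau> j..\<tau> (Suc j)} \<union> {\<tau> ?i..\<tau> (Suc ?i)})"
      by (rule at_within_nhd[of t "{\<tau> j<..<\<tau> (Suc ?i)}"]) (use 3 i tau_less[of j] tau_nonneg[of j] in auto)
    then show ?thesis using Lim_within_Un[of ?F 0 t] L R by simp
  qed
qed

lemma trajectory_sampled_solution: "sampled_solution p q b1 b2 k \<tau> x0 (trajectory x0)"
  unfolding sampled_solution_def
proof (intro conjI exI)
  let ?I = "{0..} - range \<tau>"
  let ?u = "\<lambda>t. inner_01 k (state x0 (idx t))"
  show "L2_trajectory (trajectory x0)" by (rule trajectory_L2_trajectory)
  show "\<forall>t>0. C2_01 (trajectory x0 t)" using trajectory_C2 by blast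
  show "\<forall>z\<in>{0..1}. trajectory x0 0 z = x0 z" using trajectory_sample[of 0] by (simp add: tau_0)
  show "\<forall>i. \<forall>t\<in>{\<tau> i..<\<tau> (Suc i)}. ?u t = (\<integral>s. k s * trajectory x0 (\<tau> i) s \<partial>lebesgue_on {0..1})"
    by (auto simp: idx_eqI trajectory_sample inner_01_def)
  let ?x1 = "\<lambda>i. sol_t (state x0 i) (inner_01 k (state x0 i))"
  let ?x2 = "\<lambda>i. sol_z (state x0 i) (inner_01 k (state x0 i))"
  have tpos: "t - \<tau> (idx t) > 0" if "t \<in> ?I" for t using nonsample_idx[OF that] by simp
  have td: "((\<lambda>s. trajectory x0 s z) has_real_derivative ?x1 (idx t) (t - \<tau> (idx t)) z) (at t)"
    if "t \<in> ?I" "z \<in> {0..1}" for t z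
  proof -
    let ?i = "idx t"
    have "((\<lambda>s. piece x0 ?i (s - \<tau> ?i) z) has_real_derivative ?x1 ?i (t - \<tau> ?i) z) (at t)"
      unfolding piece_def
      using DERIV_chain2[where f="\<lambda>s. sol (state x0 ?i) (inner_01 k (state x0 ?i)) s z" and g="\<lambda>s. s - \<tau> ?i",
          OF sol_time[OF state_L2 tpos[OF that(1)] that(2)] DERIV_diff[OF DERIV_ident DERIV_const]] by simp
    then show ?thesis
      by (rule has_field_derivative_transform_within_open[of _ _ _ "{\<tau> ?i<..<\<tau> (Suc ?i)}"])
        (use nonsample_idx[OF that(1)] in \<open>auto simp: trajectory_eq_piece[of ?i]\<close>)
  qed
  note S = sol_space[OF state_L2 tpos]
  have tr: "trajectory x0 t = sol (state x0 (idx t)) (inner_01 k (state x0 (idx t))) (t - \<tau> (idx t))" for t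
    by (simp add: trajectory_def piece_def)
  show "parabolic_solution p q b1 b2 ?I ?u (trajectory x0)"
    unfolding parabolic_solution_def
  proof (intro conjI ballI)
    show "C1_on_Times ?I {0..1} (trajectory x0)"
      unfolding C1_on_Times_def
    proof (intro conjI exI)
      show "continuous_on (?I \<times> {0..1}) (\<lambda>(t, z). trajectory x0 t z)"
        unfolding tr by (rule piecewise_continuous_on) (rule sol_continuous[OF state_L2])
      show "continuous_on (?I \<times> {0..1}) (\<lambda>(t, z). ?x1 (idx t) (t - \<tau> (idx t)) z)"
        by (rule piecewise_continuous_on) (rule sol_continuous[OF state_L2])
      show "continuous_on (?I \<times> {0..1}) (\<lambda>(t, z). ?x2 (idx t) (t - \<tau> (idx t)) z)"
        by (rule piecewise_continuous_on) (rule sol_continuous[OF state_L2])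
      show "has_partials_on ?I {0..1} (trajectory x0) (\<lambda>t z. ?x1 (idx t) (t - \<tau> (idx t)) z)
          (\<lambda>t z. ?x2 (idx t) (t - \<tau> (idx t)) z)"
        unfolding has_partials_on_def
      proof (intro ballI conjI)
        fix t z assume tz: "t \<in> ?I" "z \<in> {0..1::real}"
        show "((\<lambda>s. trajectory x0 s z) has_real_derivative ?x1 (idx t) (t - \<tau> (idx t)) z) (at t within ?I)"
          by (rule has_field_derivative_at_within[OF td[OF tz]])
        show "(trajectory x0 t has_real_derivative ?x2 (idx t) (t - \<tau> (idx t)) z) (at z within {0..1})"
          using C2_01D(1)[OF S(1)[OF tz(1)] tz(2)] S(2)[OF tz] by (simp add: tr)
      qed
    qed
    fix t assume t: "t \<in> ?I"
    show "C2_01 (trajectory x0 t)" unfolding tr by (rule S(1)[OF t])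
    show "b1 * trajectory x0 t 0 + b2 * dz (trajectory x0 t) 0 = 0" unfolding tr by (rule S(4)[OF t])
    show "trajectory x0 t 1 - ?u t = 0" unfolding tr using S(5)[OF t] by simp
    fix z :: real assume z: "z \<in> {0<..<1}"
    then have z': "z \<in> {0..1}" by auto
    show "deriv (\<lambda>s. trajectory x0 s z) t = p * dz (dz (trajectory x0 t)) z - q z * trajectory x0 t z"
      using DERIV_imp_deriv[OF td[OF t z']] S(3)[OF t z'] by (simp add: tr)
  qed
qed

end

text \<open>Induction over the sampling intervals: equal coefficients at \<open>\<tau> i\<close>
  force equal inputs, so the differences satisfy homogeneous equations. Continuity of the profiles
  turns equal coefficients into pointwise equality for \<open>t > 0\<close>, while at
  \<open>t = 0\<close> the datum is prescribed pointwise.\<close>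

lemma sampled_solution_unique:
  assumes "sampled_solution p q b1 b2 k \<tau> x0 x" "sampled_solution p q b1 b2 k \<tau> x0 y"
    and "t \<ge> 0" "z \<in> {0..1}"
  shows "y t z = x t z"
proof -
  obtain u where x: "L2_trajectory x" "\<And>t. t > 0 \<Longrightarrow> C2_01 (x t)" "\<And>z. z \<in> {0..1} \<Longrightarrow> x 0 z = x0 z"
    "\<And>i t. \<tau> i \<le> t \<Longrightarrow> t < \<tau> (Suc i) \<Longrightarrow> u t = inner_01 k (x (\<tau> i))"
    "parabolic_solution p q b1 b2 ({0..} - range \<tau>) u x"
    by (rule sampled_solutionE[OF assms(1)]) (rule that; assumption)
  obtain v where y: "L2_trajectory y" "\<And>t. t > 0 \<Longrightarrow> C2_01 (y t)" "\<And>z. z \<in> {0..1} \<Longrightarrow> y 0 z = x0 z"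
    "\<And>i t. \<tau> i \<le> t \<Longrightarrow> t < \<tau> (Suc i) \<Longrightarrow> v t = inner_01 k (y (\<tau> i))"
    "parabolic_solution p q b1 b2 ({0..} - range \<tau>) v y"
    by (rule sampled_solutionE[OF assms(2)]) (rule that; assumption)
  have L: "x t \<in> L2_01" "y t \<in> L2_01" if "t \<ge> 0" for t using x(1) y(1) that by (auto simp: L2_trajectory_def)
  have step: "fcoeff (x t) n = fcoeff (y t) n"
    if t: "\<tau> i \<le> t" "t \<le> \<tau> (Suc i)" and eq: "\<And>n. fcoeff (x (\<tau> i)) n = fcoeff (y (\<tau> i)) n" for i t n
  proof -
    have kxy: "inner_01 k (x (\<tau> i)) = inner_01 k (y (\<tau> i))"
      using Parseval_inner[OF k_L2 L(1)[OF tau_nonneg[of i]]] Parseval_inner[OF k_L2 L(2)[OF tau_nonneg[of i]]]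
      by (simp add: eq sums_iff)
    \<comment> \<open>With zero input the estimate of \<open>linear_ode_bound\<close> is an
      equality.\<close>
    have "\<bar>(fcoeff (x t) n - fcoeff (y t) n) - exp (- l n * (t - \<tau> i)) * (fcoeff (x (\<tau> i)) n - fcoeff (y (\<tau> i)) n)\<bar>
        \<le> 0 * (\<bar>0\<bar> * exp_integral (l n) (t - \<tau> i))"
    proof (rule linear_ode_bound[where S="{}" and v="\<lambda>t. 0" and y="\<lambda>t. fcoeff (x t) n - fcoeff (y t) n"])
      show "continuous_on {\<tau> i..t} (\<lambda>t. fcoeff (x t) n - fcoeff (y t) n)"
        using tau_nonneg[of i]
        by (intro continuous_intros continuous_on_subset[OF L2_trajectory_inner_continuous[OF _ e_L2]] x y) auto
      show "((\<lambda>t. fcoeff (x t) n - fcoeff (y t) n) has_real_derivative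
          - l n * (fcoeff (x s) n - fcoeff (y s) n) + 0 * 0) (at s)" if s: "s \<in> {\<tau> i<..<t} - {}" for s
      proof -
        have s': "s \<in> {0..} - range \<tau>" using s t by (intro between_samples[of i]) auto
        have "u s = v s" using x(4)[of i s] y(4)[of i s] s t kxy by auto
        then show ?thesis
          using DERIV_diff[OF coeff_has_derivative[OF x(5) open_nonsample s', of n]
              coeff_has_derivative[OF y(5) open_nonsample s', of n]]
          by (simp add: algebra_simps)
      qed
    qed (use t in auto)
    then show ?thesis by (simp add: eq)
  qed
  have "\<forall>n. fcoeff (x (\<tau> i)) n = fcoeff (y (\<tau> i)) n" for i
  proof (induction i)
    case 0
    then show ?case using x(3) y(3) by (auto intro!: inner_01_cong simp: tau_0)
  next
    case (Suc i)
    then show ?case using step[of i "\<tau> (Suc i)"] tau_less[of i] by simp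
  qed
  then have C: "fcoeff (x t) n = fcoeff (y t) n" for n
    using step[of "idx t" t] idx_bounds[OF assms(3)] by simp
  show ?thesis
  proof (cases "t = 0")
    case False
    then show ?thesis
      using continuous_eq_of_coeff[OF C2_01D(3)[OF y(2)] C2_01D(3)[OF x(2)] _ assms(4)] C assms(3) by simp
  qed (use x(3) y(3) assms in simp)
qed

end

section \<open>Evolution of sampled-data solutions\<close>

lemma square_sum_le: "(x + y)\<^sup>2 \<le> 2 * x\<^sup>2 + 2 * y\<^sup>2" for x y :: real
  using sum_squares_bound[of x y] by (simp add: power2_sum)

context sturm_liouville
begin

lemma growth_ge_1: "1 \<le> growth"
  by (simp add: growth_def)

text \<open>The squared norm of the state reached at time \<open>s\<close> from rest under unit
  constant input. As the exponentials are positive, each coefficient is largest in modulus for a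
  constant input, so this also bounds the response to any input of modulus at most 1.\<close>

definition "input_gain s = (\<Sum>n. (input_coeff n * exp_integral (l n) s)\<^sup>2)"

section \<open>Growth and feedback error over one short interval\<close>

context
  fixes x :: "real \<Rightarrow> real \<Rightarrow> real" and v :: "real \<Rightarrow> real" and I S :: "real set" and a b U :: real
  assumes traj: "L2_trajectory x" and sol: "parabolic_solution p q b1 b2 I v x" and I: "open I"
    and ab: "0 \<le> a" "a \<le> b" "b - a \<le> 1" and S: "finite S" "{a<..<b} - S \<subseteq> I"
    and v: "\<And>t. t \<in> {a<..<b} - S \<Longrightarrow> \<bar>v t\<bar> \<le> U"
    and summ: "summable (\<lambda>n. (input_coeff n * exp_integral (l n) (b - a))\<^sup>2)"
begin

lemma traj_L2: "t \<ge> 0 \<Longrightarrow> x t \<in> L2_01"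
  using traj by (auto simp: L2_trajectory_def)

lemma evolution_remainder:
  "\<bar>fcoeff (x b) n - exp (- l n * (b - a)) * fcoeff (x a) n\<bar> \<le> \<bar>U * (input_coeff n * exp_integral (l n) (b - a))\<bar>"
proof -
  have "U * (\<bar>input_coeff n\<bar> * exp_integral (l n) (b - a)) \<le> \<bar>U * (input_coeff n * exp_integral (l n) (b - a))\<bar>"
    using exp_integral_nonneg[of "b - a" "l n"] ab
    by (simp add: abs_mult mult_right_mono)
  then show ?thesis
    using coeff_evolution_bound[OF traj sol I ab(1,2) S v, of n] by linarith
qed

lemma evolution_norm:
  "inner_01 (x b) (x b) \<le> 2 * growth\<^sup>2 * inner_01 (x a) (x a) + 2 * U\<^sup>2 * input_gain (b - a)"
proof -
  let ?\<beta> = "\<lambda>n. input_coeff n * exp_integral (l n) (b - a)"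
  note Pa = Parseval[OF traj_L2[OF ab(1)]] and Pb = Parseval[OF traj_L2[OF order_trans[OF ab(1,2)]]]
  let ?g = "\<lambda>n. 2 * growth\<^sup>2 * (fcoeff (x a) n)\<^sup>2 + 2 * U\<^sup>2 * (?\<beta> n)\<^sup>2"
  have le: "(fcoeff (x b) n)\<^sup>2 \<le> ?g n" for n
  proof -
    let ?E = "exp (- l n * (b - a)) * fcoeff (x a) n"
    have "(fcoeff (x b) n - ?E)\<^sup>2 \<le> (U * ?\<beta> n)\<^sup>2"
      using evolution_remainder[of n] by (simp add: abs_le_square_iff)
    moreover have "?E\<^sup>2 \<le> growth\<^sup>2 * (fcoeff (x a) n)\<^sup>2"
    proof -
      have "exp (- l n * (b - a)) \<le> exp \<bar>l 0\<bar>" using exp_l_le[of "b - a" n] ab by simp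
      then have "exp (- l n * (b - a)) \<le> growth" unfolding growth_def by linarith
      then have "(exp (- l n * (b - a)))\<^sup>2 \<le> growth\<^sup>2" by (intro power_mono) auto
      then show ?thesis by (simp add: power_mult_distrib mult_right_mono)
    qed
    moreover have "(fcoeff (x b) n)\<^sup>2 \<le> 2 * ?E\<^sup>2 + 2 * (fcoeff (x b) n - ?E)\<^sup>2"
      using square_sum_le[of ?E "fcoeff (x b) n - ?E"] by simp
    ultimately show ?thesis by (simp add: power_mult_distrib)
  qed
  have g: "?g sums (2 * growth\<^sup>2 * inner_01 (x a) (x a) + 2 * U\<^sup>2 * input_gain (b - a))"
    unfolding input_gain_def by (intro sums_add sums_mult Pa summable_sums summ)
  show ?thesis by (rule sums_le[OF le Pb g])
qed

text \<open>The factor \<open>1 - exp (- l n * (b - a))\<close> is moved from the state to the fixed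
  function \<open>k\<close>. Its smallness is then uniform over all states of bounded norm, which
  fails for the states themselves.\<close>

lemma evolution_functional:
  assumes k: "k \<in> L2_01" and ks: "summable (\<lambda>n. (fcoeff k n * (1 - exp (- l n * (b - a))))\<^sup>2)"
  shows "(inner_01 k (x a) - inner_01 k (x b))\<^sup>2 \<le>
    2 * (\<Sum>n. (fcoeff k n * (1 - exp (- l n * (b - a))))\<^sup>2) * inner_01 (x a) (x a)
    + 2 * U\<^sup>2 * inner_01 k k * input_gain (b - a)"
proof -
  let ?\<beta> = "\<lambda>n. input_coeff n * exp_integral (l n) (b - a)"
  let ?d = "\<lambda>n. fcoeff k n * (1 - exp (- l n * (b - a)))"
  note La = traj_L2[OF ab(1)] and Lb = traj_L2[OF order_trans[OF ab(1,2)]]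
  note Pa = Parseval[OF La] and Pk = Parseval[OF k]
  have A: "summable (\<lambda>n. \<bar>?d n * fcoeff (x a) n\<bar>)"
    "(\<Sum>n. \<bar>?d n * fcoeff (x a) n\<bar>)\<^sup>2 \<le> (\<Sum>n. (?d n)\<^sup>2) * inner_01 (x a) (x a)"
    using summable_abs_mult[OF ks sums_summable[OF Pa]] sums_unique[OF Pa] by auto
  have B: "summable (\<lambda>n. \<bar>fcoeff k n * ?\<beta> n\<bar>)"
    "(\<Sum>n. \<bar>fcoeff k n * ?\<beta> n\<bar>)\<^sup>2 \<le> inner_01 k k * input_gain (b - a)"
    using summable_abs_mult[OF sums_summable[OF Pk] summ] sums_unique[OF Pk] by (auto simp: input_gain_def)
  have D: "(\<lambda>n. fcoeff k n * fcoeff (x a) n - fcoeff k n * fcoeff (x b) n) sums (inner_01 k (x a) - inner_01 k (x b))"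
    by (intro sums_diff Parseval_inner k La Lb)
  have le: "norm (fcoeff k n * fcoeff (x a) n - fcoeff k n * fcoeff (x b) n) \<le>
      \<bar>?d n * fcoeff (x a) n\<bar> + \<bar>U\<bar> * \<bar>fcoeff k n * ?\<beta> n\<bar>" for n
  proof -
    have "fcoeff k n * fcoeff (x a) n - fcoeff k n * fcoeff (x b) n = ?d n * fcoeff (x a) n
        - fcoeff k n * (fcoeff (x b) n - exp (- l n * (b - a)) * fcoeff (x a) n)"
      by (simp add: algebra_simps)
    moreover have "\<bar>fcoeff k n * (fcoeff (x b) n - exp (- l n * (b - a)) * fcoeff (x a) n)\<bar> \<le> \<bar>U\<bar> * \<bar>fcoeff k n * ?\<beta> n\<bar>"
      using mult_left_mono[OF evolution_remainder[of n], of "\<bar>fcoeff k n\<bar>"] by (simp add: abs_mult mult_ac)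
    ultimately show ?thesis by simp
  qed
  have "\<bar>inner_01 k (x a) - inner_01 k (x b)\<bar> \<le>
      (\<Sum>n. \<bar>?d n * fcoeff (x a) n\<bar>) + \<bar>U\<bar> * (\<Sum>n. \<bar>fcoeff k n * ?\<beta> n\<bar>)"
  proof -
    have "norm (\<Sum>n. fcoeff k n * fcoeff (x a) n - fcoeff k n * fcoeff (x b) n) \<le>
        (\<Sum>n. \<bar>?d n * fcoeff (x a) n\<bar> + \<bar>U\<bar> * \<bar>fcoeff k n * ?\<beta> n\<bar>)"
      by (rule norm_suminf_le[OF le]) (intro summable_add summable_mult A B)
    also have "\<dots> = (\<Sum>n. \<bar>?d n * fcoeff (x a) n\<bar>) + \<bar>U\<bar> * (\<Sum>n. \<bar>fcoeff k n * ?\<beta> n\<bar>)"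
      using A(1) B(1) by (simp add: suminf_add[symmetric] suminf_mult summable_mult)
    finally show ?thesis using sums_unique[OF D] by simp
  qed
  from power_mono[OF this abs_ge_zero, of 2]
  have "(inner_01 k (x a) - inner_01 k (x b))\<^sup>2 \<le>
      ((\<Sum>n. \<bar>?d n * fcoeff (x a) n\<bar>) + \<bar>U\<bar> * (\<Sum>n. \<bar>fcoeff k n * ?\<beta> n\<bar>))\<^sup>2"
    by simp
  also have "\<dots> \<le> 2 * (\<Sum>n. \<bar>?d n * fcoeff (x a) n\<bar>)\<^sup>2 + 2 * (\<bar>U\<bar> * (\<Sum>n. \<bar>fcoeff k n * ?\<beta> n\<bar>))\<^sup>2"
    by (rule square_sum_le)
  also have "\<dots> \<le> 2 * ((\<Sum>n. (?d n)\<^sup>2) * inner_01 (x a) (x a)) + 2 * (U\<^sup>2 * (inner_01 k k * input_gain (b - a)))"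
    using A(2) mult_left_mono[OF B(2), of "U\<^sup>2"] by (simp add: power_mult_distrib)
  finally show ?thesis by (simp add: mult_ac)
qed

end

lemma input_gain_small:
  assumes "\<epsilon> > 0"
  obtains \<delta> where "0 < \<delta>" "\<delta> \<le> 1"
    "\<And>s. 0 \<le> s \<Longrightarrow> s \<le> \<delta> \<Longrightarrow> summable (\<lambda>n. (input_coeff n * exp_integral (l n) s)\<^sup>2)"
    "\<And>s. 0 \<le> s \<Longrightarrow> s \<le> \<delta> \<Longrightarrow> input_gain s \<le> \<epsilon>"
proof -
  obtain \<delta> where \<delta>: "0 < \<delta>" "\<delta> \<le> 1"
    "\<And>s. 0 \<le> s \<Longrightarrow> s \<le> \<delta> \<Longrightarrow> summable (\<lambda>n. (input_coeff n * exp_integral (l n) s)\<^sup>2)"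
    "\<And>s. 0 \<le> s \<Longrightarrow> s \<le> \<delta> \<Longrightarrow> (\<Sum>n. (input_coeff n * exp_integral (l n) s)\<^sup>2) \<le> \<epsilon>"
    by (rule input_small[OF assms]) (rule that; assumption)
  show thesis
    by (rule that[OF \<delta>(1-3)]) (use \<delta>(4) in \<open>simp_all add: input_gain_def\<close>)
qed

text \<open>The window starts at a sampling instant, so every value held in it stems from a state
  inside it and is covered by \<open>m\<close>.\<close>

lemma sampled_input_bound:
  assumes "sampling \<tau>" "k \<in> L2_01" "L2_trajectory x"
    and u: "\<And>i t. \<tau> i \<le> t \<Longrightarrow> t < \<tau> (Suc i) \<Longrightarrow> u t = inner_01 k (x (\<tau> i))"
    and m: "\<And>s. \<tau> i \<le> s \<Longrightarrow> s \<le> b \<Longrightarrow> inner_01 (x s) (x s) \<le> m"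
    and t: "\<tau> i \<le> t" "t \<le> b"
  shows "\<bar>u t\<bar> \<le> sqrt (inner_01 k k * m)"
proof -
  interpret sampling \<tau> by fact
  have t0: "0 \<le> t" using t tau_nonneg[of i] by simp
  let ?j = "idx t"
  have "\<tau> i < \<tau> (Suc ?j)" using idx_bounds[OF t0] t by simp
  then have "\<tau> i \<le> \<tau> ?j" by (simp add: tau_less_iff tau_le_iff)
  then have "inner_01 (x (\<tau> ?j)) (x (\<tau> ?j)) \<le> m" using m idx_bounds[OF t0] t by auto
  moreover have "(u t)\<^sup>2 \<le> inner_01 k k * inner_01 (x (\<tau> ?j)) (x (\<tau> ?j))"
    using u[OF idx_bounds[OF t0]] inner_01_Cauchy_Schwarz_square[OF assms(2), of "x (\<tau> ?j)"] assms(3) tau_nonneg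
    by (auto simp: L2_trajectory_def)
  ultimately have "(u t)\<^sup>2 \<le> inner_01 k k * m"
    using inner_01_self_nonneg[of k] by (meson mult_left_mono order_trans)
  then show ?thesis by (metis real_sqrt_abs real_sqrt_le_mono)
qed

lemma inner_continuous: "L2_trajectory x \<Longrightarrow> continuous_on {0..} (\<lambda>t. inner_01 (x t) (x t))"
  using continuous_on_power[OF L2_trajectory_norm_continuous[of x], of 2] by (simp add: norm_01_squared)

text \<open>
  The input inside a short window is bounded by the maximum of the norm up to that window's end, and its
  gain over the window is small, so that the maximum is absorbed; the resulting growth factor per window
  does not depend on the number of sampling instants in it.
\<close>

lemma horizon_bound:
  assumes k: "k \<in> L2_01"
  obtains C where "C \<ge> 1"
    "\<And>\<tau> x0 x i s. sampling \<tau> \<Longrightarrow> sampled_solution p q b1 b2 k \<tau> x0 x \<Longrightarrow> \<tau> i \<le> s \<Longrightarrow> s \<le> \<tau> i + R \<Longrightarrow>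
       inner_01 (x s) (x s) \<le> C * inner_01 (x (\<tau> i)) (x (\<tau> i))"
proof -
  \<comment> \<open>The input over one step will contribute at most half of the maximal squared
    norm. Absorbing that half doubles the factor \<open>2 * growth\<^sup>2\<close> of
    \<open>evolution_norm\<close>.\<close>
  let ?\<kappa> = "inner_01 k k" and ?G = "4 * growth\<^sup>2"
  have \<kappa>: "?\<kappa> \<ge> 0" by (rule inner_01_self_nonneg)
  have G1: "?G \<ge> 1" using power_mono[OF growth_ge_1, of 2] by simp
  obtain \<delta> where \<delta>: "0 < \<delta>" "\<delta> \<le> 1"
    "\<And>s. 0 \<le> s \<Longrightarrow> s \<le> \<delta> \<Longrightarrow> summable (\<lambda>n. (input_coeff n * exp_integral (l n) s)\<^sup>2)"
    "\<And>s. 0 \<le> s \<Longrightarrow> s \<le> \<delta> \<Longrightarrow> input_gain s \<le> 1 / (4 * (?\<kappa> + 1))"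
    using input_gain_small[of "1 / (4 * (?\<kappa> + 1))"] \<kappa> by auto
  have main: "\<forall>s. \<tau> i \<le> s \<and> s \<le> \<tau> i + real n * \<delta> \<longrightarrow> inner_01 (x s) (x s) \<le> ?G ^ n * inner_01 (x (\<tau> i)) (x (\<tau> i))"
    if samp: "sampling \<tau>" and sampsol: "sampled_solution p q b1 b2 k \<tau> x0 x" for \<tau> x0 x i n
  proof -
    interpret sampling \<tau> by fact
    obtain u where x: "L2_trajectory x"
      "\<And>i t. \<tau> i \<le> t \<Longrightarrow> t < \<tau> (Suc i) \<Longrightarrow> u t = inner_01 k (x (\<tau> i))"
      "parabolic_solution p q b1 b2 ({0..} - range \<tau>) u x"
      by (rule sampled_solutionE[OF sampsol]) (rule that; assumption)
    let ?N = "\<lambda>s. inner_01 (x s) (x s)"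
    show ?thesis
    proof (induction n)
      case 0
      show ?case by (auto dest: antisym)
    next
      case (Suc n)
      let ?a = "\<tau> i + real n * \<delta>" and ?b = "\<tau> i + real (Suc n) * \<delta>"
      have a0: "0 \<le> ?a" "\<tau> i \<le> ?a" "?a \<le> ?b" using tau_nonneg[of i] \<delta>(1) by (auto simp: algebra_simps)
      have "continuous_on {\<tau> i..?b} ?N"
        by (rule continuous_on_subset[OF inner_continuous[OF x(1)]]) (use tau_nonneg[of i] in auto)
      \<comment> \<open>The maximum is taken from \<open>\<tau> i\<close> on and not merely over the
        last step, since a value held there may have been sampled at any earlier instant of the
        window.\<close>
      then obtain s where s: "s \<in> {\<tau> i..?b}" "\<And>t. t \<in> {\<tau> i..?b} \<Longrightarrow> ?N t \<le> ?N s"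
        using continuous_attains_sup[of "{\<tau> i..?b}" ?N] a0 by force
      let ?m = "?G ^ n * ?N (\<tau> i)"
      have m0: "?m \<ge> 0" using inner_01_self_nonneg[of "x (\<tau> i)"] by simp
      have "?N s \<le> ?G * ?m"
      proof (cases "s \<le> ?a")
        case True
        then have "?N s \<le> ?m" using Suc s(1) by auto
        also have "\<dots> \<le> ?G * ?m" using mult_right_mono[OF G1 m0] by simp
        finally show ?thesis .
      next
        case False
        have sa: "?a \<le> s" "s - ?a \<le> \<delta>" "0 \<le> s - ?a" using False s(1) by (auto simp: algebra_simps)
        have "?N s \<le> 2 * growth\<^sup>2 * ?N ?a + 2 * (sqrt (?\<kappa> * ?N s))\<^sup>2 * input_gain (s - ?a)"
        proof (rule evolution_norm[OF x(1,3) open_nonsample a0(1) sa(1) _ finite_samples[of ?a s]])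
          show "{?a<..<s} - range \<tau> \<inter> {?a..s} \<subseteq> {0..} - range \<tau>" using a0(1) by auto
          show "\<bar>u t\<bar> \<le> sqrt (?\<kappa> * ?N s)" if "t \<in> {?a<..<s} - range \<tau> \<inter> {?a..s}" for t
            by (rule sampled_input_bound[OF samp k x(1,2), where i=i and b=s])
              (use s a0 that in auto)
          show "summable (\<lambda>n. (input_coeff n * exp_integral (l n) (s - ?a))\<^sup>2)" using \<delta>(3) sa by blast
        qed (use sa \<delta> in auto)
        also have "\<dots> = 2 * growth\<^sup>2 * ?N ?a + 2 * ?N s * (?\<kappa> * input_gain (s - ?a))"
          using \<kappa> inner_01_self_nonneg[of "x s"] by simp
        also have "\<dots> \<le> 2 * growth\<^sup>2 * ?m + 2 * ?N s * (1 / 4)"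
        proof (intro add_mono mult_left_mono)
          show "?N ?a \<le> ?m" using Suc a0 by auto
          have "?\<kappa> * input_gain (s - ?a) \<le> ?\<kappa> * (1 / (4 * (?\<kappa> + 1)))"
            using \<delta>(4)[OF sa(3,2)] \<kappa> by (intro mult_left_mono) auto
          also have "\<dots> \<le> 1 / 4" using \<kappa> by (simp add: divide_simps)
          finally show "?\<kappa> * input_gain (s - ?a) \<le> 1 / 4" .
        qed (use inner_01_self_nonneg[of "x s"] in auto)
        finally show ?thesis by simp
      qed
      then show ?case using s(2) by (auto simp: mult.assoc intro: order_trans)
    qed
  qed
  obtain n :: nat where n: "R / \<delta> \<le> real n" using real_arch_simple by blast
  show thesis
  proof (rule that[of "?G ^ n"])
    show "1 \<le> ?G ^ n" using one_le_power[OF G1] .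
    fix \<tau> x0 x i s
    assume A: "sampling \<tau>" "sampled_solution p q b1 b2 k \<tau> x0 x" "\<tau> i \<le> s" "s \<le> \<tau> i + R"
    have "R \<le> real n * \<delta>" using n \<delta>(1) by (simp add: field_simps)
    then show "inner_01 (x s) (x s) \<le> ?G ^ n * inner_01 (x (\<tau> i)) (x (\<tau> i))"
      using main[OF A(1,2), of i n] A(3,4) by auto
  qed
qed

text \<open>Up to the next sampling instant the input is the constant computed from
  \<open>x (\<tau> i)\<close>, so both the drift of the state and the effect of the input are
  measured by that one state. Each is allotted \<open>\<epsilon> / 2\<close>.\<close>

lemma feedback_error_bound:
  assumes k: "k \<in> L2_01" and \<epsilon>: "\<epsilon> > 0"
  obtains \<delta> where "0 < \<delta>" "\<delta> \<le> 1"
    "\<And>\<tau> x0 x i t. sampling \<tau> \<Longrightarrow> sampled_solution p q b1 b2 k \<tau> x0 x \<Longrightarrow> \<tau> i \<le> t \<Longrightarrow> t < \<tau> (Suc i) \<Longrightarrow> t - \<tau> i \<le> \<delta> \<Longrightarrow>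
       (inner_01 k (x (\<tau> i)) - inner_01 k (x t))\<^sup>2 \<le> \<epsilon> * inner_01 (x (\<tau> i)) (x (\<tau> i))"
proof -
  let ?\<kappa> = "inner_01 k k"
  have \<kappa>: "?\<kappa> \<ge> 0" by (rule inner_01_self_nonneg)
  have pos: "\<epsilon> / (4 * (?\<kappa>\<^sup>2 + 1)) > 0" and pos': "\<epsilon> / 4 > 0"
    using \<epsilon> by (auto intro!: divide_pos_pos mult_pos_pos add_nonneg_pos)
  obtain d where d: "0 < d" "d \<le> 1"
    "\<And>s. 0 \<le> s \<Longrightarrow> s \<le> d \<Longrightarrow> summable (\<lambda>n. (input_coeff n * exp_integral (l n) s)\<^sup>2)"
    "\<And>s. 0 \<le> s \<Longrightarrow> s \<le> d \<Longrightarrow> input_gain s \<le> \<epsilon> / (4 * (?\<kappa>\<^sup>2 + 1))"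
    by (rule input_gain_small[OF pos]) (rule that; assumption)
  obtain d' where d': "0 < d'" "d' \<le> 1"
    "\<And>s. 0 \<le> s \<Longrightarrow> s \<le> d' \<Longrightarrow> summable (\<lambda>n. (fcoeff k n * (1 - exp (- l n * s)))\<^sup>2)"
    "\<And>s. 0 \<le> s \<Longrightarrow> s \<le> d' \<Longrightarrow> (\<Sum>n. (fcoeff k n * (1 - exp (- l n * s)))\<^sup>2) \<le> \<epsilon> / 4"
    by (rule semigroup_small[OF sums_summable[OF Parseval[OF k]] pos']) (rule that; assumption)
  show thesis
  proof (rule that[of "min d d'"])
    fix \<tau> x0 x i t
    assume A: "sampling \<tau>" "sampled_solution p q b1 b2 k \<tau> x0 x" "\<tau> i \<le> t" "t < \<tau> (Suc i)" "t - \<tau> i \<le> min d d'"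
    interpret sampling \<tau> by fact
    obtain u where x: "L2_trajectory x"
      "\<And>i t. \<tau> i \<le> t \<Longrightarrow> t < \<tau> (Suc i) \<Longrightarrow> u t = inner_01 k (x (\<tau> i))"
      "parabolic_solution p q b1 b2 ({0..} - range \<tau>) u x"
      by (rule sampled_solutionE[OF A(2)]) (rule that; assumption)
    let ?N = "inner_01 (x (\<tau> i)) (x (\<tau> i))" and ?s = "t - \<tau> i" and ?U = "\<bar>inner_01 k (x (\<tau> i))\<bar>"
    have N: "?N \<ge> 0" by (rule inner_01_self_nonneg)
    have s: "0 \<le> ?s" "?s \<le> d" "?s \<le> d'" using A by auto
    have U: "?U\<^sup>2 \<le> ?\<kappa> * ?N"
      using inner_01_Cauchy_Schwarz_square[OF k, of "x (\<tau> i)"] x(1) tau_nonneg by (auto simp: L2_trajectory_def)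
    have "(inner_01 k (x (\<tau> i)) - inner_01 k (x t))\<^sup>2 \<le>
      2 * (\<Sum>n. (fcoeff k n * (1 - exp (- l n * ?s)))\<^sup>2) * ?N + 2 * ?U\<^sup>2 * ?\<kappa> * input_gain ?s"
    proof (rule evolution_functional[OF x(1,3) open_nonsample tau_nonneg A(3) _ finite.emptyI _ _ _ k])
      show "{\<tau> i<..<t} - {} \<subseteq> {0..} - range \<tau>"
      proof
        fix s assume "s \<in> {\<tau> i<..<t} - {}"
        then show "s \<in> {0..} - range \<tau>" using A by (intro between_samples[of i]) auto
      qed
      show "\<bar>u s\<bar> \<le> ?U" if "s \<in> {\<tau> i<..<t} - {}" for s using x(2)[of i s] that A by auto
    qed (use s d d' in auto)
    also have "\<dots> \<le> 2 * (\<epsilon> / 4) * ?N + \<epsilon> / 2 * ?N"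
    proof (intro add_mono mult_right_mono mult_left_mono)
      show "(\<Sum>n. (fcoeff k n * (1 - exp (- l n * ?s)))\<^sup>2) \<le> \<epsilon> / 4" using d'(4) s by blast
      have "?U\<^sup>2 * ?\<kappa> * input_gain ?s \<le> ((?\<kappa> * ?N) * ?\<kappa>) * (\<epsilon> / (4 * (?\<kappa>\<^sup>2 + 1)))"
      proof (intro mult_mono U d(4) s)
        show "0 \<le> input_gain ?s" unfolding input_gain_def by (rule suminf_nonneg[OF d(3)[OF s(1,2)]]) simp
      qed (use \<kappa> N in auto)
      also have "\<dots> = (?\<kappa>\<^sup>2 / (?\<kappa>\<^sup>2 + 1)) * (\<epsilon> / 4 * ?N)"
      proof -
        have "((K * N) * K) * (e / (4 * c)) = (K\<^sup>2 / c) * (e / 4 * N)" for K N e c :: real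
          by (simp add: power2_eq_square mult_ac)
        then show ?thesis .
      qed
      also have "\<dots> \<le> 1 * (\<epsilon> / 4 * ?N)"
        using \<epsilon> N by (intro mult_right_mono) (auto simp: divide_le_eq_1 add_nonneg_pos)
      finally show "2 * ?U\<^sup>2 * ?\<kappa> * input_gain ?s \<le> \<epsilon> / 2 * ?N" by simp
    qed (use N in auto)
    finally show "(inner_01 k (x (\<tau> i)) - inner_01 k (x t))\<^sup>2 \<le> \<epsilon> * ?N" by simp
  qed (use d d' in auto)
qed

end

section \<open>Volterra operators\<close>

lemma L2_01_abs: "f \<in> L2_01 \<Longrightarrow> (\<lambda>z. \<bar>f z\<bar>) \<in> L2_01"
  by (auto simp: L2_01_def)

lemma L2_01_one: "(\<lambda>z. 1) \<in> L2_01"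
  by (intro continuous_on_imp_L2_01 continuous_on_const)

lemma norm_01_one_le: "norm_01 (\<lambda>z. 1) \<le> 1"
  by (rule norm_01_bound(2)) (auto intro: L2_01_measurable L2_01_one)

lemma norm_01_abs: "norm_01 (\<lambda>z. \<bar>f z\<bar>) = norm_01 f"
  by (simp add: norm_01_def)

lemma L2_01_integrable: "f \<in> L2_01 \<Longrightarrow> integrable M01 f"
  using L2_01_mult_integrable[OF _ L2_01_one, of f] by simp

lemma integral_abs_le_norm_01:
  assumes "f \<in> L2_01"
  shows "(\<integral>z. \<bar>f z\<bar> \<partial>M01) \<le> norm_01 f"
proof -
  have "inner_01 (\<lambda>z. \<bar>f z\<bar>) (\<lambda>z. 1) \<le> norm_01 (\<lambda>z. \<bar>f z\<bar>) * norm_01 (\<lambda>z. 1)"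
    using inner_01_Cauchy_Schwarz[OF L2_01_abs[OF assms] L2_01_one] by simp
  also have "\<dots> \<le> norm_01 f * 1"
    using norm_01_one_le by (simp add: norm_01_abs mult_left_le)
  finally show ?thesis by (simp add: inner_01_def)
qed

context
  fixes K :: "real \<Rightarrow> real \<Rightarrow> real"
  assumes K: "continuous_on ({0..1} \<times> {0..1}) (\<lambda>(z, s). K z s)"
begin

lemma kernel_bounded:
  obtains B where "B \<ge> 0" "\<And>z s. z \<in> {0..1} \<Longrightarrow> s \<in> {0..1} \<Longrightarrow> \<bar>K z s\<bar> \<le> B"
proof -
  have "bounded ((\<lambda>(z, s). K z s) ` ({0..1} \<times> {0..1}))"
    by (intro compact_imp_bounded compact_continuous_image K compact_Times) auto
  then obtain B where B: "\<forall>w\<in>(\<lambda>(z, s). K z s) ` ({0..1} \<times> {0..1}). norm w \<le> B"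
    unfolding bounded_iff by blast
  have le: "\<bar>K z s\<bar> \<le> B" if "z \<in> {0..1}" "s \<in> {0..1}" for z s
    using B that by (auto dest!: bspec[where x="K z s"])
  moreover have "B \<ge> 0" using le[of 0 0] by simp
  ultimately show thesis using that by blast
qed

text \<open>Moving the limit \<open>z\<close> into an indicator leaves a measure space that does not
  depend on \<open>z\<close>, as dominated convergence requires.\<close>

lemma volterra_eq:
  assumes "z \<in> {0..1}"
  shows "volterra K f z = (\<integral>s. indicator {0..z} s * (K z s * f s) \<partial>M01)"
proof -
  have "volterra K f z = (\<integral>s. indicator {0..z} s * (K z s * f s) \<partial>lebesgue)"
    by (simp add: volterra_def integral_restrict_space)
  also have "\<dots> = (\<integral>s. indicator {0..1} s * (indicator {0..z} s * (K z s * f s)) \<partial>lebesgue)"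
    by (rule Bochner_Integration.integral_cong) (use assms in \<open>auto simp: indicator_def\<close>)
  finally show ?thesis by (simp add: integral_restrict_space)
qed

lemma volterra_integrand:
  assumes "f \<in> L2_01" "z \<in> {0..1}"
  shows "(\<lambda>s. indicator {0..z} s * (K z s * f s)) \<in> borel_measurable M01"
    "integrable M01 (\<lambda>s. indicator {0..z} s * (K z s * f s))"
proof -
  have Kz: "K z \<in> L2_01"
    by (rule continuous_on_imp_L2_01) (rule continuous_on_slice[OF K assms(2)])
  have "(indicator {0..z} :: real \<Rightarrow> real) \<in> borel_measurable M01"
    by (intro measurable_restrict_space1 borel_measurable_indicator) simp
  then show m: "(\<lambda>s. indicator {0..z} s * (K z s * f s)) \<in> borel_measurable M01"
    using L2_01_measurable[OF Kz] L2_01_measurable[OF assms(1)] by simp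
  show "integrable M01 (\<lambda>s. indicator {0..z} s * (K z s * f s))"
    by (rule Bochner_Integration.integrable_bound[OF L2_01_mult_integrable[OF Kz assms(1)] m])
      (auto simp: indicator_def)
qed

lemma volterra_diff:
  assumes "f \<in> L2_01" "g \<in> L2_01" "z \<in> {0..1}"
  shows "volterra K (\<lambda>s. f s - g s) z = volterra K f z - volterra K g z"
proof -
  have "(\<integral>s. indicator {0..z} s * (K z s * (f s - g s)) \<partial>M01) =
      (\<integral>s. indicator {0..z} s * (K z s * f s) - indicator {0..z} s * (K z s * g s) \<partial>M01)"
    by (simp add: algebra_simps)
  also have "\<dots> = (\<integral>s. indicator {0..z} s * (K z s * f s) \<partial>M01) - (\<integral>s. indicator {0..z} s * (K z s * g s) \<partial>M01)"
    by (intro Bochner_Integration.integral_diff volterra_integrand assms)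
  finally show ?thesis by (simp add: volterra_eq[OF assms(3)])
qed

lemma volterra_scale: "volterra K (\<lambda>s. a * f s) z = a * volterra K f z"
proof -
  have "(\<lambda>s. K z s * (a * f s)) = (\<lambda>s. a * (K z s * f s))" by (simp add: mult.left_commute)
  then show ?thesis by (simp add: volterra_def)
qed

lemma volterra_bound:
  assumes "f \<in> L2_01" "z \<in> {0..1}" "B \<ge> 0"
    "\<And>z s. z \<in> {0..1} \<Longrightarrow> s \<in> {0..1} \<Longrightarrow> \<bar>K z s\<bar> \<le> B"
  shows "\<bar>volterra K f z\<bar> \<le> B * norm_01 f"
proof -
  have "norm (\<integral>s. indicator {0..z} s * (K z s * f s) \<partial>M01) \<le> (\<integral>s. B * \<bar>f s\<bar> \<partial>M01)"
  proof (rule Bochner_Integration.integral_norm_bound_integral)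
    show "integrable M01 (\<lambda>s. B * \<bar>f s\<bar>)" using L2_01_integrable[OF L2_01_abs[OF assms(1)]] by simp
    show "norm (indicator {0..z} s * (K z s * f s)) \<le> B * \<bar>f s\<bar>" if "s \<in> space M01" for s
      using assms(4)[OF assms(2), of s] that assms(3)
      by (auto simp: indicator_def abs_mult intro: mult_right_mono)
  qed (rule volterra_integrand[OF assms(1,2)])
  also have "\<dots> \<le> B * norm_01 f"
    using integral_abs_le_norm_01[OF assms(1)] assms(3) by (simp add: mult_left_mono)
  finally show ?thesis by (simp add: volterra_eq[OF assms(2)])
qed

lemma volterra_continuous:
  assumes "f \<in> L2_01"
  shows "continuous_on {0..1} (volterra K f)"
  unfolding continuous_on_sequentially
proof (intro allI ballI impI)
  fix x :: "nat \<Rightarrow> real" and a :: real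
  assume a: "a \<in> {0..1}" and x: "(\<forall>n. x n \<in> {0..1}) \<and> x \<longlonglongrightarrow> a"
  obtain B where B: "B \<ge> 0" "\<And>z s. z \<in> {0..1} \<Longrightarrow> s \<in> {0..1} \<Longrightarrow> \<bar>K z s\<bar> \<le> B"
    by (rule kernel_bounded) (rule that; assumption)
  have "(\<lambda>n. \<integral>s. indicator {0..x n} s * (K (x n) s * f s) \<partial>M01) \<longlonglongrightarrow>
      (\<integral>s. indicator {0..a} s * (K a s * f s) \<partial>M01)"
  proof (rule integral_dominated_convergence[where w="\<lambda>s. B * \<bar>f s\<bar>"])
    show "integrable M01 (\<lambda>s. B * \<bar>f s\<bar>)" using L2_01_integrable[OF L2_01_abs[OF assms]] by simp
    show "(\<lambda>s. indicator {0..a} s * (K a s * f s)) \<in> borel_measurable M01"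
      by (rule volterra_integrand[OF assms a])
    show "(\<lambda>s. indicator {0..x n} s * (K (x n) s * f s)) \<in> borel_measurable M01" for n
      by (rule volterra_integrand[OF assms]) (use x in blast)
    show "AE s in M01. norm (indicator {0..x n} s * (K (x n) s * f s)) \<le> B * \<bar>f s\<bar>" for n
    proof (rule AE_I2)
      fix s assume "s \<in> space M01"
      moreover have "x n \<in> {0..1}" using x by blast
      ultimately show "norm (indicator {0..x n} s * (K (x n) s * f s)) \<le> B * \<bar>f s\<bar>"
        using B(2)[of "x n" s] B(1) by (auto simp: indicator_def abs_mult intro: mult_right_mono)
    qed
    \<comment> \<open>The point \<open>s = a\<close> is excluded: there the indicators may oscillate
      as \<open>x n\<close> passes from one side of \<open>a\<close> to the other. It is a null
      set.\<close>
    have conv: "(\<lambda>n. indicator {0..x n} s * (K (x n) s * f s)) \<longlonglongrightarrow> indicator {0..a} s * (K a s * f s)"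
      if s: "s \<in> {0..1}" "s \<noteq> a" for s
    proof -
      have "(\<lambda>n. (\<lambda>(z, s). K z s) (x n, s)) \<longlonglongrightarrow> (\<lambda>(z, s). K z s) (a, s)"
        by (rule continuous_on_tendsto_compose[OF K]) (use x a s in \<open>auto intro!: tendsto_intros\<close>)
      then have "(\<lambda>n. K (x n) s * f s) \<longlonglongrightarrow> K a s * f s" by (auto intro!: tendsto_intros)
      moreover have "(\<lambda>n. indicator {0..x n} s :: real) \<longlonglongrightarrow> indicator {0..a} s"
      proof (cases "s < a")
        case True
        have "\<forall>\<^sub>F n in sequentially. s < x n" using x True by (intro order_tendstoD) auto
        then have "\<forall>\<^sub>F n in sequentially. indicator {0..x n} s = (indicator {0..a} s :: real)"
          by eventually_elim (use s True in \<open>auto simp: indicator_def\<close>)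
        then show ?thesis by (rule tendsto_eventually)
      next
        case False
        have "\<forall>\<^sub>F n in sequentially. x n < s" using x False s by (intro order_tendstoD) auto
        then have "\<forall>\<^sub>F n in sequentially. indicator {0..x n} s = (indicator {0..a} s :: real)"
          by eventually_elim (use s False in \<open>auto simp: indicator_def\<close>)
        then show ?thesis by (rule tendsto_eventually)
      qed
      ultimately show ?thesis by (rule tendsto_mult[rotated])
    qed
    have "AE s in lebesgue. s \<noteq> a" by (rule AE_completion[OF AE_lborel_singleton])
    then have "AE s in lebesgue. s \<in> {0..1} \<longrightarrow>
        (\<lambda>n. indicator {0..x n} s * (K (x n) s * f s)) \<longlonglongrightarrow> indicator {0..a} s * (K a s * f s)"
      by eventually_elim (use conv in blast)
    then show "AE s in M01. (\<lambda>n. indicator {0..x n} s * (K (x n) s * f s)) \<longlonglongrightarrow> indicator {0..a} s * (K a s * f s)"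
      by (simp add: AE_restrict_space_iff)
  qed
  then show "(volterra K f \<circ> x) \<longlonglongrightarrow> volterra K f a"
    using a x by (simp add: volterra_eq comp_def)
qed

lemma volterra_L2: "f \<in> L2_01 \<Longrightarrow> volterra K f \<in> L2_01"
  by (rule continuous_on_imp_L2_01[OF volterra_continuous])

lemma volterra_norm_bound:
  obtains B where "B \<ge> 0" "\<And>f. f \<in> L2_01 \<Longrightarrow> norm_01 (volterra K f) \<le> B * norm_01 f"
proof -
  obtain B where B: "B \<ge> 0" "\<And>z s. z \<in> {0..1} \<Longrightarrow> s \<in> {0..1} \<Longrightarrow> \<bar>K z s\<bar> \<le> B"
    by (rule kernel_bounded) (rule that; assumption)
  show thesis
  proof (rule that[OF B(1)])
    show "norm_01 (volterra K f) \<le> B * norm_01 f" if "f \<in> L2_01" for f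
      by (rule norm_01_bound(2)[OF L2_01_measurable[OF volterra_L2[OF that]]])
        (rule volterra_bound[OF that _ B])
  qed
qed

lemma volterra_L2_trajectory:
  assumes "L2_trajectory x"
  shows "L2_trajectory (\<lambda>t z. x t z - volterra K (x t) z)"
  unfolding L2_trajectory_def
proof (intro conjI allI impI)
  have L: "x t \<in> L2_01" if "t \<ge> 0" for t using assms that by (auto simp: L2_trajectory_def)
  show "(\<lambda>z. x t z - volterra K (x t) z) \<in> L2_01" if "0 \<le> t" for t
    by (intro L2_01_diff L[OF that] volterra_L2)
  obtain B where B: "B \<ge> 0" "\<And>f. f \<in> L2_01 \<Longrightarrow> norm_01 (volterra K f) \<le> B * norm_01 f"
    by (rule volterra_norm_bound) (rule that; assumption)
  fix t :: real assume t: "0 \<le> t"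
  show "((\<lambda>s. norm_01 (\<lambda>z. x s z - volterra K (x s) z - (x t z - volterra K (x t) z))) \<longlongrightarrow> 0) (at t within {0..})"
  proof (rule Lim_null_comparison)
    have "((\<lambda>s. (1 + B) * norm_01 (\<lambda>z. x s z - x t z)) \<longlongrightarrow> (1 + B) * 0) (at t within {0..})"
      using assms t by (intro tendsto_intros) (auto simp: L2_trajectory_def)
    then show "((\<lambda>s. (1 + B) * norm_01 (\<lambda>z. x s z - x t z)) \<longlongrightarrow> 0) (at t within {0..})" by simp
    have "norm (norm_01 (\<lambda>z. x s z - volterra K (x s) z - (x t z - volterra K (x t) z))) \<le> (1 + B) * norm_01 (\<lambda>z. x s z - x t z)"
      if s: "s \<ge> 0" for s
    proof -
      let ?d = "\<lambda>z. x s z - x t z"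
      have d: "?d \<in> L2_01" by (intro L2_01_diff L s t)
      have "norm_01 (\<lambda>z. x s z - volterra K (x s) z - (x t z - volterra K (x t) z)) =
          norm_01 (\<lambda>z. ?d z + (- 1) * volterra K ?d z)"
        by (rule norm_01_cong) (simp add: volterra_diff L s t)
      also have "\<dots> \<le> norm_01 ?d + norm_01 (\<lambda>z. (- 1) * volterra K ?d z)"
        by (intro norm_01_triangle L2_01_scale volterra_L2 d)
      also have "\<dots> \<le> norm_01 ?d + B * norm_01 ?d"
        using B(2)[OF d] unfolding norm_01_scale by simp
      finally show ?thesis by (simp add: distrib_right)
    qed
    then show "\<forall>\<^sub>F s in at t within {0..}. norm (norm_01 (\<lambda>z. x s z - volterra K (x s) z - (x t z - volterra K (x t) z)))
        \<le> (1 + B) * norm_01 (\<lambda>z. x s z - x t z)"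
      unfolding eventually_at by (intro exI[of _ 1]) auto
  qed
qed

end

section \<open>A Lyapunov functional\<close>

text \<open>The substitution \<open>s = z * r\<close> fixes the domain of integration, after which
  continuity in the parameters is standard; \<open>z = 0\<close> has to be treated apart.\<close>

lemma continuous_on_primitive:
  fixes f :: "real \<Rightarrow> real \<Rightarrow> real"
  assumes "continuous_on (I \<times> {0..1}) (\<lambda>(t, z). f t z)"
  shows "continuous_on (I \<times> {0..1}) (\<lambda>(t, z). integral {0..z} (f t))"
proof -
  have "continuous_on ((I \<times> {0..1}) \<times> cbox 0 (1::real)) (\<lambda>w. (fst (fst w), snd (fst w) * snd w))"
    by (intro continuous_intros)
  then have "continuous_on ((I \<times> {0..1}) \<times> cbox 0 1) (\<lambda>w. (\<lambda>(t, z). f t z) (fst (fst w), snd (fst w) * snd w))"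
    by (rule continuous_on_compose2[OF assms]) (auto intro: mult_le_one)
  then have "continuous_on ((I \<times> {0..1}) \<times> cbox 0 1) (\<lambda>(u, r). f (fst u) (snd u * r))"
    by (simp add: case_prod_unfold)
  from integral_continuous_on_param[OF this]
  have "continuous_on (I \<times> {0..1}) (\<lambda>u. snd u * integral {0..1} (\<lambda>r. f (fst u) (snd u * r)))"
    by (auto intro!: continuous_intros)
  moreover have "snd u * integral {0..1} (\<lambda>r. f (fst u) (snd u * r)) = integral {0..snd u} (f (fst u))"
    if u: "u \<in> I \<times> {0..1}" for u
  proof (cases "snd u = 0")
    case False
    then have z: "snd u > 0" "fst u \<in> I" "snd u \<in> {0..1}" using u by (auto simp: mem_Times_iff)
    have "f (fst u) integrable_on {0..snd u}"
      by (intro integrable_continuous_real continuous_on_subset[OF continuous_on_slice[OF assms z(2)]])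
        (use z in auto)
    then have "((\<lambda>x. f (fst u) (snd u * x)) has_integral (1 / \<bar>snd u\<bar>) *\<^sub>R integral {0..snd u} (f (fst u)))
        ((\<lambda>x. x / snd u) ` {0..snd u})"
      using z by (intro has_integral_stretch_real integrable_integral) auto
    moreover have "(\<lambda>x. x / snd u) ` {0..snd u} = {0..1}"
    proof
      show "{0..1} \<subseteq> (\<lambda>x. x / snd u) ` {0..snd u}"
      proof
        fix r :: real assume "r \<in> {0..1}"
        then have "r = (r * snd u) / snd u" "r * snd u \<in> {0..snd u}" using z by (auto simp: mult_left_le_one_le)
        then show "r \<in> (\<lambda>x. x / snd u) ` {0..snd u}" by (rule image_eqI)
      qed
    qed (use z in auto)
    ultimately show ?thesis using z by (simp add: integral_unique)
  qed simp
  ultimately show ?thesis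
    by (rule_tac continuous_on_cong[THEN iffD1, rotated 2]) (auto simp: case_prod_unfold)
qed

lemma L2_mult_integrable_on:
  assumes "f \<in> L2_01" "w \<in> L2_01"
  shows "(\<lambda>s. f s * w s) integrable_on {0..1}"
  using integrable_on_lebesgue_on[OF L2_01_mult_integrable[OF assms]] by simp

lemma integral_mult_L2_bound:
  assumes "f \<in> L2_01" "w \<in> L2_01" "z \<in> {0..1}"
  shows "\<bar>integral {0..z} (\<lambda>s. f s * w s)\<bar> \<le> norm_01 f * norm_01 w"
proof -
  have z: "{0..z} \<subseteq> {0..1}" using assms(3) by auto
  note I = L2_mult_integrable_on[OF assms(1,2)] L2_mult_integrable_on[OF L2_01_abs[OF assms(1)] L2_01_abs[OF assms(2)]]
  have i: "(\<lambda>s. f s * w s) integrable_on {0..z}" "(\<lambda>s. \<bar>f s\<bar> * \<bar>w s\<bar>) integrable_on {0..z}"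
    using I z integrable_on_subinterval by blast+
  have "norm (integral {0..z} (\<lambda>s. f s * w s)) \<le> integral {0..z} (\<lambda>s. \<bar>f s\<bar> * \<bar>w s\<bar>)"
    by (rule Henstock_Kurzweil_Integration.integral_norm_bound_integral[OF i]) (simp add: abs_mult)
  also have "\<dots> \<le> integral {0..1} (\<lambda>s. \<bar>f s\<bar> * \<bar>w s\<bar>)"
    by (rule integral_subset_le[OF z i(2) I(2)]) simp
  also have "\<dots> = inner_01 (\<lambda>s. \<bar>f s\<bar>) (\<lambda>s. \<bar>w s\<bar>)"
    unfolding inner_01_def
    by (rule lebesgue_integral_eq_integral[symmetric])
      (simp_all add: L2_01_mult_integrable[OF L2_01_abs[OF assms(1)] L2_01_abs[OF assms(2)]])
  also have "\<dots> \<le> norm_01 f * norm_01 w"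
    using inner_01_Cauchy_Schwarz[OF L2_01_abs[OF assms(1)] L2_01_abs[OF assms(2)]] by (simp add: norm_01_abs)
  finally show ?thesis by simp
qed

text \<open>
  If \<open>y\<^sub>t = p y\<^sub>z\<^sub>z - c y\<close>, then \<open>F(z) = \<integral>\<^sub>0\<^sup>z \<phi> y - \<integral>\<^sub>0\<^sup>1 g y\<close> obeys
  \<open>F\<^sub>t = p \<phi>\<^sup>2 (F\<^sub>z / \<phi>\<^sup>2)\<^sub>z - \<beta> F + p g'(1) y(1)\<close>, in which the boundary value \<open>y(1)\<close> enters as a bounded
  (Neumann) input; \<open>\<integral> F\<^sup>2 / \<phi>\<^sup>2\<close> is therefore dissipated at the rate \<open>\<integral> y\<^sup>2\<close>.  The correction by \<open>g\<close> is
  needed for the Dirichlet condition at \<open>0\<close> only, where \<open>\<phi>\<close> would vanish without it.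
\<close>

locale energy_weight =
  fixes p c \<beta> b1 b2 :: real and \<phi> \<phi>1 g g1 :: "real \<Rightarrow> real"
  assumes p: "p > 0" and \<beta>: "\<beta> \<ge> 0"
    and \<phi>_D: "z \<in> {0..1} \<Longrightarrow> (\<phi> has_real_derivative \<phi>1 z) (at z within {0..1})"
    and \<phi>1_D: "z \<in> {0..1} \<Longrightarrow> (\<phi>1 has_real_derivative (c - \<beta>) / p * \<phi> z) (at z within {0..1})"
    and g_D: "z \<in> {0..1} \<Longrightarrow> (g has_real_derivative g1 z) (at z within {0..1})"
    and g1_D: "z \<in> {0..1} \<Longrightarrow> (g1 has_real_derivative (c - \<beta>) / p * g z) (at z within {0..1})"
    and \<phi>_pos: "z \<in> {0..1} \<Longrightarrow> \<phi> z > 0"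
    and g_1: "g 1 = 0"
    and bc: "b1 * a + b2 * a' = 0 \<Longrightarrow> a' * (\<phi> 0 - g 0) - a * (\<phi>1 0 - g1 0) = 0"
    and bc': "b1 * a + b2 * a' = 0 \<Longrightarrow> a = 0 \<or> (\<forall>z\<in>{0..1}. g z = 0)"
begin

lemma \<phi>_cont: "continuous_on {0..1} \<phi>"
  by (rule DERIV_continuous_on[OF \<phi>_D])

lemma g_cont: "continuous_on {0..1} g"
  by (rule DERIV_continuous_on[OF g_D])

lemma \<phi>_L2: "\<phi> \<in> L2_01" and g_L2: "g \<in> L2_01"
  by (intro continuous_on_imp_L2_01 \<phi>_cont g_cont)+

definition "weight z = 1 / (\<phi> z)\<^sup>2"

lemma \<phi>_nz: "z \<in> {0..1} \<Longrightarrow> \<phi> z \<noteq> 0"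
  using \<phi>_pos[of z] by simp

lemma weight_cont: "continuous_on {0..1} weight"
  unfolding weight_def using \<phi>_nz by (intro continuous_intros \<phi>_cont) auto

lemma weight_nonneg: "0 \<le> weight z"
  by (simp add: weight_def)

definition "mass = integral {0..1} weight"

lemma mass_nonneg: "0 \<le> mass"
  unfolding mass_def by (rule integral_nonneg) (auto intro!: integrable_continuous_real weight_cont weight_nonneg)

definition prim :: "(real \<Rightarrow> real) \<Rightarrow> real \<Rightarrow> real" where
  "prim f z = integral {0..z} (\<lambda>s. f s * \<phi> s) - integral {0..1} (\<lambda>s. f s * g s)"

definition lyap :: "(real \<Rightarrow> real) \<Rightarrow> real" where
  "lyap f = integral {0..1} (\<lambda>z. prim f z * prim f z * weight z) / 2"

definition "prim_gain = norm_01 \<phi> + norm_01 g"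

lemma prim_gain_nonneg: "0 \<le> prim_gain"
  by (simp add: prim_gain_def)

lemma prim_bound:
  assumes "f \<in> L2_01" "z \<in> {0..1}"
  shows "\<bar>prim f z\<bar> \<le> prim_gain * norm_01 f"
  using integral_mult_L2_bound[OF assms(1) \<phi>_L2 assms(2)] integral_mult_L2_bound[OF assms(1) g_L2, of 1]
  by (simp add: prim_def prim_gain_def algebra_simps)

lemma prim_cont:
  assumes "f \<in> L2_01"
  shows "continuous_on {0..1} (prim f)"
  unfolding prim_def
  by (intro continuous_intros indefinite_integral_continuous_1 L2_mult_integrable_on assms \<phi>_L2)

lemma prim_diff:
  assumes "f \<in> L2_01" "f' \<in> L2_01" "z \<in> {0..1}"
  shows "prim (\<lambda>s. f s - f' s) z = prim f z - prim f' z"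
proof -
  have z: "{0..z} \<subseteq> {0..1}" using assms(3) by auto
  have i: "(\<lambda>s. f s * \<phi> s) integrable_on {0..z}" "(\<lambda>s. f' s * \<phi> s) integrable_on {0..z}"
    using L2_mult_integrable_on[OF assms(1) \<phi>_L2] L2_mult_integrable_on[OF assms(2) \<phi>_L2] z
      integrable_on_subinterval by blast+
  show ?thesis
    using Henstock_Kurzweil_Integration.integral_diff[OF i]
      Henstock_Kurzweil_Integration.integral_diff[OF L2_mult_integrable_on[OF assms(1) g_L2] L2_mult_integrable_on[OF assms(2) g_L2]]
    by (simp add: prim_def left_diff_distrib)
qed

lemma lyap_integrand_cont:
  assumes "f \<in> L2_01" "f' \<in> L2_01"
  shows "continuous_on {0..1} (\<lambda>z. prim f z * prim f' z * weight z)"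
  by (intro continuous_intros prim_cont weight_cont assms)

lemma lyap_nonneg:
  assumes "f \<in> L2_01"
  shows "0 \<le> lyap f"
proof -
  have "0 \<le> integral {0..1} (\<lambda>z. prim f z * prim f z * weight z)"
    by (rule integral_nonneg[OF integrable_continuous_real[OF lyap_integrand_cont[OF assms assms]]])
      (simp add: weight_nonneg)
  then show ?thesis by (simp add: lyap_def)
qed

text \<open>Stated for the bilinear form, so that it controls the functional as well as its
  increments in \<open>lyap_diff\<close>.\<close>

lemma lyap_form_bound:
  assumes "f \<in> L2_01" "f' \<in> L2_01"
  shows "\<bar>integral {0..1} (\<lambda>z. prim f z * prim f' z * weight z)\<bar> \<le> prim_gain\<^sup>2 * mass * (norm_01 f * norm_01 f')"
proof -
  have "norm (integral {0..1} (\<lambda>z. prim f z * prim f' z * weight z)) \<le>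
      integral {0..1} (\<lambda>z. prim_gain\<^sup>2 * (norm_01 f * norm_01 f') * weight z)"
  proof (rule Henstock_Kurzweil_Integration.integral_norm_bound_integral)
    show "(\<lambda>z. prim f z * prim f' z * weight z) integrable_on {0..1}"
      by (rule integrable_continuous_real[OF lyap_integrand_cont[OF assms]])
    show "(\<lambda>z. prim_gain\<^sup>2 * (norm_01 f * norm_01 f') * weight z) integrable_on {0..1}"
      by (intro integrable_continuous_real continuous_intros weight_cont)
    show "norm (prim f z * prim f' z * weight z) \<le> prim_gain\<^sup>2 * (norm_01 f * norm_01 f') * weight z"
      if z: "z \<in> {0..1}" for z
    proof -
      have "\<bar>prim f z\<bar> * \<bar>prim f' z\<bar> \<le> (prim_gain * norm_01 f) * (prim_gain * norm_01 f')"
        by (intro mult_mono prim_bound assms z) (use prim_gain_nonneg in auto)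
      then have "\<bar>prim f z\<bar> * \<bar>prim f' z\<bar> * weight z \<le> (prim_gain * norm_01 f) * (prim_gain * norm_01 f') * weight z"
        by (rule mult_right_mono) (rule weight_nonneg)
      then show ?thesis using weight_nonneg[of z] by (simp add: abs_mult power2_eq_square mult_ac)
    qed
  qed
  then show ?thesis by (simp add: mass_def mult_ac)
qed

lemma lyap_bound:
  assumes "f \<in> L2_01"
  shows "lyap f \<le> prim_gain\<^sup>2 * mass / 2 * (norm_01 f)\<^sup>2"
  using lyap_form_bound[OF assms assms] by (simp add: lyap_def power2_eq_square)

lemma lyap_diff:
  assumes "f \<in> L2_01" "f' \<in> L2_01"
  shows "lyap f - lyap f' = integral {0..1} (\<lambda>z. prim (\<lambda>s. f s - f' s) z * prim (\<lambda>s. f s + f' s) z * weight z) / 2"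
proof -
  have "prim (\<lambda>s. f s + f' s) z = prim f z + prim f' z" if "z \<in> {0..1}" for z
    using prim_diff[OF L2_01_add[OF assms] assms(2) that] by simp
  then have "integral {0..1} (\<lambda>z. prim (\<lambda>s. f s - f' s) z * prim (\<lambda>s. f s + f' s) z * weight z)
     = integral {0..1} (\<lambda>z. prim f z * prim f z * weight z - prim f' z * prim f' z * weight z)"
    by (intro integral_cong) (simp add: prim_diff[OF assms] algebra_simps)
  also have "\<dots> = 2 * lyap f - 2 * lyap f'"
    unfolding lyap_def
    by (subst Henstock_Kurzweil_Integration.integral_diff)
      (auto intro!: integrable_continuous_real lyap_integrand_cont assms)
  finally show ?thesis by simp
qed

text \<open>Across sampling instants, where the functional need not be differentiable, its
  monotonicity estimate rests on this continuity.\<close>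

lemma lyap_continuous:
  assumes "L2_trajectory y"
  shows "continuous_on {0..} (\<lambda>t. lyap (y t))"
  unfolding continuous_on_def
proof
  fix t :: real assume t: "t \<in> {0..}"
  have L: "y s \<in> L2_01" if "s \<ge> 0" for s using assms that by (auto simp: L2_trajectory_def)
  let ?C = "prim_gain\<^sup>2 * mass / 2"
  have "((\<lambda>s. lyap (y s) - lyap (y t)) \<longlongrightarrow> 0) (at t within {0..})"
  proof (rule Lim_null_comparison)
    have "norm (lyap (y s) - lyap (y t)) \<le> ?C * (norm_01 (\<lambda>z. y s z - y t z) * (norm_01 (y s) + norm_01 (y t)))"
      if s: "s \<ge> 0" for s
    proof -
      note st = L[OF s] L[of t]
      have "norm (lyap (y s) - lyap (y t)) \<le> ?C * (norm_01 (\<lambda>z. y s z - y t z) * norm_01 (\<lambda>z. y s z + y t z))"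
        using lyap_form_bound[OF L2_01_diff L2_01_add, of "y s" "y t" "y s" "y t"] st t
        by (simp add: lyap_diff)
      also have "\<dots> \<le> ?C * (norm_01 (\<lambda>z. y s z - y t z) * (norm_01 (y s) + norm_01 (y t)))"
        using norm_01_triangle[of "y s" "y t"] st t mass_nonneg by (intro mult_left_mono) auto
      finally show ?thesis .
    qed
    then show "\<forall>\<^sub>F s in at t within {0..}. norm (lyap (y s) - lyap (y t))
        \<le> ?C * (norm_01 (\<lambda>z. y s z - y t z) * (norm_01 (y s) + norm_01 (y t)))"
      unfolding eventually_at by (intro exI[of _ 1]) auto
    have "((\<lambda>s. norm_01 (y s)) \<longlongrightarrow> norm_01 (y t)) (at t within {0..})"
      using L2_trajectory_norm_continuous[OF assms] t by (auto simp: continuous_on_def)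
    moreover have "((\<lambda>s. norm_01 (\<lambda>z. y s z - y t z)) \<longlongrightarrow> 0) (at t within {0..})"
      using assms t by (auto simp: L2_trajectory_def)
    ultimately have "((\<lambda>s. ?C * (norm_01 (\<lambda>z. y s z - y t z) * (norm_01 (y s) + norm_01 (y t))))
        \<longlongrightarrow> ?C * (0 * (norm_01 (y t) + norm_01 (y t)))) (at t within {0..})"
      by (intro tendsto_intros)
    then show "((\<lambda>s. ?C * (norm_01 (\<lambda>z. y s z - y t z) * (norm_01 (y s) + norm_01 (y t)))) \<longlongrightarrow> 0) (at t within {0..})"
      by simp
  qed
  then show "((\<lambda>s. lyap (y s)) \<longlongrightarrow> lyap (y t)) (at t within {0..})" by (simp add: LIM_zero_iff)
qed

text \<open>The two summands belong to the two places where the boundary value enters: the boundary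
  term at \<open>z = 1\<close> of an integration by parts, and the correction by
  \<open>g\<close>.\<close>

definition "input_weight = prim_gain * (1 / \<phi> 1 + \<bar>g1 1\<bar> * mass)"

section \<open>Dissipation of the functional along solutions\<close>

context
  fixes I :: "real set" and w :: "real \<Rightarrow> real" and y :: "real \<Rightarrow> real \<Rightarrow> real" and t :: real
  assumes y: "parabolic_solution p (\<lambda>_. c) b1 b2 I w y" and I: "open I" and t: "t \<in> I"
begin

lemma y_D: "s \<in> I \<Longrightarrow> C2_01 (y s)" "s \<in> I \<Longrightarrow> y s \<in> L2_01" "s \<in> I \<Longrightarrow> continuous_on {0..1} (y s)"
  using parabolic_solutionD(1)[OF y] C2_01D(3) continuous_on_imp_L2_01 by blast+

text \<open>Since \<open>p \<psi>'' - c \<psi> = - \<beta> \<psi>\<close>, Green's identity leaves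
  boundary terms and a multiple of the same integral. It is used for \<open>\<phi>\<close> up to
  \<open>z\<close> and for \<open>g\<close> up to 1.\<close>

lemma weighted_derivative:
  assumes \<psi>: "\<And>z. z \<in> {0..1} \<Longrightarrow> (\<psi> has_real_derivative \<psi>1 z) (at z within {0..1})"
    "\<And>z. z \<in> {0..1} \<Longrightarrow> (\<psi>1 has_real_derivative (c - \<beta>) / p * \<psi> z) (at z within {0..1})"
    and a: "a \<in> {0..1}"
  shows "integral {0..a} (\<lambda>z. (p * dz (dz (y t)) z - c * y t z) * \<psi> z) =
    p * (dz (y t) a * \<psi> a - y t a * \<psi>1 a) - p * (dz (y t) 0 * \<psi> 0 - y t 0 * \<psi>1 0)
    - \<beta> * integral {0..a} (\<lambda>z. y t z * \<psi> z)"
proof -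
  note D = C2_01D[OF y_D(1)[OF t]]
  have \<psi>_cont: "continuous_on {0..1} \<psi>" using \<psi>(1) by (rule DERIV_continuous_on)
  have "((\<lambda>z. dz (dz (y t)) z * \<psi> z - y t z * ((c - \<beta>) / p * \<psi> z)) has_integral
      (dz (y t) a * \<psi> a - y t a * \<psi>1 a) - (dz (y t) 0 * \<psi> 0 - y t 0 * \<psi>1 0)) {0..a}"
    by (rule Green_01[OF D(1,2) \<psi> a])
  from has_integral_mult_right[OF this, of p]
  have A: "((\<lambda>z. p * (dz (dz (y t)) z * \<psi> z - y t z * ((c - \<beta>) / p * \<psi> z))) has_integral
      p * ((dz (y t) a * \<psi> a - y t a * \<psi>1 a) - (dz (y t) 0 * \<psi> 0 - y t 0 * \<psi>1 0))) {0..a}" .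
  have "(\<lambda>z. y t z * \<psi> z) integrable_on {0..a}"
    by (rule integrable_continuous_real, rule continuous_on_subset[where s="{0..1}"])
      (use a in \<open>auto intro!: continuous_intros D \<psi>_cont\<close>)
  then have B: "((\<lambda>z. \<beta> * (y t z * \<psi> z)) has_integral \<beta> * integral {0..a} (\<lambda>z. y t z * \<psi> z)) {0..a}"
    by (intro has_integral_mult_right integrable_integral)
  have "((\<lambda>z. (p * dz (dz (y t)) z - c * y t z) * \<psi> z) has_integral
      p * ((dz (y t) a * \<psi> a - y t a * \<psi>1 a) - (dz (y t) 0 * \<psi> 0 - y t 0 * \<psi>1 0))
      - \<beta> * integral {0..a} (\<lambda>z. y t z * \<psi> z)) {0..a}"
    by (rule has_integral_eq[OF _ has_integral_diff[OF A B]]) (use p in \<open>simp add: field_simps\<close>)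
  then show ?thesis by (simp add: integral_unique right_diff_distrib)
qed

lemma lyap_derivative:
  obtains V' where "((\<lambda>s. lyap (y s)) has_real_derivative V') (at t)"
    "V' \<le> - (p / 2) * (norm_01 (y t))\<^sup>2 + p / 2 * input_weight\<^sup>2 * (w t)\<^sup>2"
proof -
  obtain y1 where y1: "continuous_on (I \<times> {0..1}) (\<lambda>(t, z). y1 t z)"
    "\<And>t z. t \<in> I \<Longrightarrow> z \<in> {0..1} \<Longrightarrow> ((\<lambda>s. y s z) has_real_derivative y1 t z) (at t)"
    "\<And>t z. t \<in> I \<Longrightarrow> z \<in> {0..1} \<Longrightarrow> y1 t z = p * dz (dz (y t)) z - c * y t z"
    by (rule parabolic_time_derivative[OF y I continuous_on_const]) (rule that; assumption)
  note D = C2_01D[OF y_D(1)[OF t]]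
  have yJ: "continuous_on (I \<times> {0..1}) (\<lambda>(t, z). y t z)"
    using y unfolding parabolic_solution_def C1_on_Times_def by blast
  define A where "A s z = prim (y s) z" for s z
  define A1 where "A1 s z = prim (y1 s) z" for s z
  have joint: "continuous_on (I \<times> {0..1}) (\<lambda>(s, z). prim (u s) z)"
    if u: "continuous_on (I \<times> {0..1}) (\<lambda>(t, z). u t z)" for u
  proof -
    have *: "continuous_on (I \<times> {0..1}) (\<lambda>(t, z). u t z * \<psi> z)" if "continuous_on {0..1} \<psi>" for \<psi> :: "real \<Rightarrow> real"
      unfolding case_prod_unfold using u
      by (intro continuous_intros continuous_on_compose2[OF that]) (auto simp: case_prod_unfold)
    have "continuous_on I (\<lambda>s. integral (cbox 0 1) (\<lambda>z. u s z * g z))"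
      using *[OF g_cont] by (intro integral_continuous_on_param) simp
    from continuous_on_compose2[OF this continuous_on_fst[OF continuous_on_id], of "I \<times> {0..1::real}"]
    have "continuous_on (I \<times> {0..1::real}) (\<lambda>v. integral {0..1} (\<lambda>z. u (fst v) z * g z))"
      by force
    moreover have "continuous_on (I \<times> {0..1}) (\<lambda>v. integral {0..snd v} (\<lambda>z. u (fst v) z * \<phi> z))"
      using continuous_on_primitive[OF *[OF \<phi>_cont]] by (simp add: case_prod_unfold)
    ultimately show ?thesis
      unfolding prim_def case_prod_unfold by (intro continuous_intros)
  qed
  have A_t: "((\<lambda>s. A s z) has_real_derivative A1 s z) (at s)" if "s \<in> I" "z \<in> {0..1}" for s z
    unfolding A_def A1_def prim_def
  proof (rule DERIV_diff)
    show "((\<lambda>s. integral {0..z} (\<lambda>r. y s r * \<phi> r)) has_real_derivative integral {0..z} (\<lambda>r. y1 s r * \<phi> r)) (at s)"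
      by (rule integral_has_parameter_derivative[OF I that(1)])
        (use that(2) y1(2) in \<open>auto intro: continuous_on_subset[OF y1(1)] continuous_on_subset[OF y_D(3)]
            continuous_on_subset[OF \<phi>_cont]\<close>)
    show "((\<lambda>s. integral {0..1} (\<lambda>r. y s r * g r)) has_real_derivative integral {0..1} (\<lambda>r. y1 s r * g r)) (at s)"
      by (rule integral_has_parameter_derivative[OF I that(1) y1(1,2) y_D(3) g_cont])
  qed
  have AJ: "continuous_on (I \<times> {0..1}) (\<lambda>(s, z). A s z)" "continuous_on (I \<times> {0..1}) (\<lambda>(s, z). A1 s z)"
    unfolding A_def A1_def by (rule joint[OF yJ], rule joint[OF y1(1)])
  have A_cont: "continuous_on {0..1} (A s)" if "s \<in> I" for s
    by (rule continuous_on_slice[OF AJ(1) that])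
  have "((\<lambda>s. integral {0..1} (\<lambda>z. A s z * A s z * weight z)) has_real_derivative
      integral {0..1} (\<lambda>z. (A1 t z * A t z + A1 t z * A t z) * weight z)) (at t)"
  proof (rule integral_has_parameter_derivative[OF I t _ _ _ weight_cont])
    show "continuous_on (I \<times> {0..1}) (\<lambda>(s, z). A1 s z * A s z + A1 s z * A s z)"
      using AJ unfolding case_prod_unfold by (intro continuous_intros)
    show "((\<lambda>s. A s z * A s z) has_real_derivative A1 s z * A s z + A1 s z * A s z) (at s)"
      if "s \<in> I" "z \<in> {0..1}" for s z
      using A_t[OF that] by (auto intro!: derivative_eq_intros)
    show "continuous_on {0..1} (\<lambda>z. A s z * A s z)" if "s \<in> I" for s
      by (intro continuous_intros A_cont that)
  qed
  then have V: "((\<lambda>s. lyap (y s)) has_real_derivative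
      integral {0..1} (\<lambda>z. (A1 t z * A t z + A1 t z * A t z) * weight z) / 2) (at t)"
    unfolding lyap_def A_def by (rule DERIV_cdivide)
  have bct: "b1 * y t 0 + b2 * dz (y t) 0 = 0" and wt: "y t 1 = w t"
    using parabolic_solutionD(2,3)[OF y t] by auto
  \<comment> \<open>At 0 the boundary terms of \<open>\<phi>\<close> and \<open>g\<close> cancel by
    \<open>bc\<close>. At 1 the unknown flux of \<open>y\<close> is multiplied by
    \<open>g 1 = 0\<close>, so only the boundary value \<open>w t\<close> remains.\<close>
  have A1_eq: "A1 t z = p * (dz (y t) z * \<phi> z - y t z * \<phi>1 z) + p * w t * g1 1 - \<beta> * A t z" if z: "z \<in> {0..1}" for z
  proof -
    have "integral {0..z} (\<lambda>s. y1 t s * \<phi> s) = integral {0..z} (\<lambda>s. (p * dz (dz (y t)) s - c * y t s) * \<phi> s)"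
      using z t by (intro integral_cong) (simp add: y1(3))
    moreover have "integral {0..1} (\<lambda>s. y1 t s * g s) = integral {0..1} (\<lambda>s. (p * dz (dz (y t)) s - c * y t s) * g s)"
      using t by (intro integral_cong) (simp add: y1(3))
    moreover have "p * (dz (y t) 0 * (\<phi> 0 - g 0) - y t 0 * (\<phi>1 0 - g1 0)) = 0" using bc[OF bct] by simp
    ultimately show ?thesis
      using weighted_derivative[OF \<phi>_D \<phi>1_D z] weighted_derivative[OF g_D g1_D, of 1]
      by (simp add: A1_def A_def prim_def g_1 wt algebra_simps)
  qed
  have A_z: "(A t has_real_derivative y t z * \<phi> z) (at z within {0..1})" if "z \<in> {0..1}" for z
    unfolding A_def prim_def
    using integral_has_real_derivative[OF continuous_on_mult[OF D(3) \<phi>_cont] that]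
    by (auto intro!: derivative_eq_intros)
  \<comment> \<open>Either the boundary condition forces \<open>y\<close> to vanish at 0, or
    \<open>g\<close> is zero and the primitive itself starts from 0.\<close>
  have A0: "A t 0 * y t 0 = 0"
  proof (cases "y t 0 = 0")
    case False
    then have g0: "\<And>z. z \<in> {0..1} \<Longrightarrow> g z = 0" using bc'[OF bct] by blast
    have "integral {0..1} (\<lambda>s. y t s * g s) = integral {0..1} (\<lambda>s::real. 0)"
      by (rule integral_cong) (simp add: g0)
    then show ?thesis by (simp add: A_def prim_def)
  qed simp
  \<comment> \<open>The flux term times the weight is the derivative of \<open>y / \<phi>\<close>,
    and the derivative of the primitive is \<open>y * \<phi>\<close>. Differentiating the product
    \<open>A * (y / \<phi>)\<close> therefore exhibits the square of \<open>y\<close> and leaves a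
    boundary term at 1 only.\<close>
  have "((\<lambda>z. y t z * y t z + A t z * (dz (y t) z * \<phi> z - y t z * \<phi>1 z) * weight z) has_integral
      A t 1 * (y t 1 / \<phi> 1) - A t 0 * (y t 0 / \<phi> 0)) {0..1}"
  proof (rule fundamental_theorem_of_calculus)
    fix z :: real assume z: "z \<in> {0..1}"
    have "((\<lambda>z. A t z * (y t z / \<phi> z)) has_real_derivative
        y t z * \<phi> z * (y t z / \<phi> z) + A t z * ((dz (y t) z * \<phi> z - y t z * \<phi>1 z) / (\<phi> z * \<phi> z))) (at z within {0..1})"
      by (rule DERIV_cong[OF DERIV_mult[OF A_z[OF z] DERIV_divide[OF D(1)[OF z] \<phi>_D[OF z] \<phi>_nz[OF z]]]])
        (simp only: mult.commute)
    moreover have "y t z * \<phi> z * (y t z / \<phi> z) + A t z * ((dz (y t) z * \<phi> z - y t z * \<phi>1 z) / (\<phi> z * \<phi> z))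
        = y t z * y t z + A t z * (dz (y t) z * \<phi> z - y t z * \<phi>1 z) * weight z"
      using \<phi>_nz[OF z] by (simp add: weight_def power2_eq_square)
    ultimately show "((\<lambda>z. A t z * (y t z / \<phi> z)) has_vector_derivative
        y t z * y t z + A t z * (dz (y t) z * \<phi> z - y t z * \<phi>1 z) * weight z) (at z within {0..1})"
      by (simp add: has_real_derivative_iff_has_vector_derivative)
  qed simp
  then have T1: "((\<lambda>z. p * (y t z * y t z + A t z * (dz (y t) z * \<phi> z - y t z * \<phi>1 z) * weight z)) has_integral
      p * (A t 1 * (w t / \<phi> 1))) {0..1}"
    using A0 by (intro has_integral_mult_right) (simp add: wt)
  have T2: "((\<lambda>z. p * w t * g1 1 * (A t z * weight z)) has_integral
      p * w t * g1 1 * integral {0..1} (\<lambda>z. A t z * weight z)) {0..1}"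
    by (intro has_integral_mult_right integrable_integral integrable_continuous_real continuous_intros
        A_cont t weight_cont)
  have T3: "((\<lambda>z. \<beta> * (A t z * A t z * weight z)) has_integral \<beta> * (2 * lyap (y t))) {0..1}"
    unfolding lyap_def A_def
    using has_integral_mult_right[OF integrable_integral[OF integrable_continuous_real[OF
        lyap_integrand_cont[OF y_D(2)[OF t] y_D(2)[OF t]]]], of \<beta>] by simp
  have T4: "((\<lambda>z. p * (y t z * y t z)) has_integral p * (norm_01 (y t))\<^sup>2) {0..1}"
    unfolding norm_01_squared inner_01_continuous[OF D(3) D(3)]
    by (intro has_integral_mult_right integrable_integral integrable_continuous_real continuous_intros D)
  have "((\<lambda>z. (A1 t z * A t z + A1 t z * A t z) * weight z) has_integral
     2 * (p * (A t 1 * (w t / \<phi> 1)) + p * w t * g1 1 * integral {0..1} (\<lambda>z. A t z * weight z)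
        - \<beta> * (2 * lyap (y t)) - p * (norm_01 (y t))\<^sup>2)) {0..1}"
    by (rule has_integral_eq[OF _ has_integral_mult_right[OF has_integral_diff[OF has_integral_diff[OF has_integral_add[OF T1 T2] T3] T4]]])
      (simp add: A1_eq algebra_simps)
  then have V'_eq: "integral {0..1} (\<lambda>z. (A1 t z * A t z + A1 t z * A t z) * weight z) / 2 =
      p * (A t 1 * (w t / \<phi> 1)) + p * w t * g1 1 * integral {0..1} (\<lambda>z. A t z * weight z)
        - \<beta> * (2 * lyap (y t)) - p * (norm_01 (y t))\<^sup>2"
    by (simp add: integral_unique)
  let ?n = "norm_01 (y t)"
  have b1: "\<bar>A t 1 * (w t / \<phi> 1)\<bar> \<le> prim_gain * ?n * (\<bar>w t\<bar> / \<phi> 1)"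
    using prim_bound[OF y_D(2)[OF t], of 1] \<phi>_pos[of 1]
    by (simp add: A_def abs_mult divide_right_mono mult_right_mono)
  have "norm (integral {0..1} (\<lambda>z. A t z * weight z)) \<le> integral {0..1} (\<lambda>z. prim_gain * ?n * weight z)"
  proof (rule Henstock_Kurzweil_Integration.integral_norm_bound_integral)
    show "norm (A t z * weight z) \<le> prim_gain * ?n * weight z" if "z \<in> {0..1}" for z
      using mult_right_mono[OF prim_bound[OF y_D(2)[OF t] that] weight_nonneg[of z]] weight_nonneg[of z]
      by (simp add: A_def abs_mult)
  qed (auto intro!: integrable_continuous_real continuous_intros A_cont t weight_cont)
  then have "\<bar>integral {0..1} (\<lambda>z. A t z * weight z)\<bar> \<le> prim_gain * ?n * mass" by (simp add: mass_def)
  then have b2: "\<bar>w t * g1 1 * integral {0..1} (\<lambda>z. A t z * weight z)\<bar> \<le> \<bar>w t\<bar> * \<bar>g1 1\<bar> * (prim_gain * ?n * mass)"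
    by (simp add: abs_mult mult_left_mono)
  have "A t 1 * (w t / \<phi> 1) + w t * g1 1 * integral {0..1} (\<lambda>z. A t z * weight z)
      \<le> prim_gain * ?n * (\<bar>w t\<bar> / \<phi> 1) + \<bar>w t\<bar> * \<bar>g1 1\<bar> * (prim_gain * ?n * mass)"
    using b1 b2 by linarith
  also have "\<dots> = ?n * (input_weight * \<bar>w t\<bar>)" by (simp add: input_weight_def algebra_simps)
  \<comment> \<open>Young's inequality: half of the dissipation \<open>p * ?n\<^sup>2\<close> is
    spent on the input.\<close>
  also have "\<dots> \<le> (?n\<^sup>2 + (input_weight * \<bar>w t\<bar>)\<^sup>2) / 2"
    using sum_squares_bound[of ?n "input_weight * \<bar>w t\<bar>"] by simp
  finally have "p * (A t 1 * (w t / \<phi> 1) + w t * g1 1 * integral {0..1} (\<lambda>z. A t z * weight z))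
      \<le> p * ((?n\<^sup>2 + input_weight\<^sup>2 * (w t)\<^sup>2) / 2)"
    using p by (intro mult_left_mono) (simp_all add: power_mult_distrib)
  moreover have "0 \<le> \<beta> * (2 * lyap (y t))" using \<beta> lyap_nonneg[OF y_D(2)[OF t]] by simp
  ultimately have "p * (A t 1 * (w t / \<phi> 1)) + p * w t * g1 1 * integral {0..1} (\<lambda>z. A t z * weight z)
        - \<beta> * (2 * lyap (y t)) - p * ?n\<^sup>2 \<le> - (p / 2) * ?n\<^sup>2 + p / 2 * input_weight\<^sup>2 * (w t)\<^sup>2"
    by (simp add: distrib_left add_divide_distrib mult.assoc)
  then show thesis
    by (intro that[OF V]) (simp only: V'_eq)
qed

end

text \<open>As long as the squared norm of \<open>y\<close> stays above \<open>m\<close>, the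
  functional falls at least at the rate \<open>r\<close> below. It is nonnegative and initially
  bounded by the norm of \<open>y a\<close>, so \<open>m\<close> cannot be large when
  \<open>b - a\<close> is.\<close>

lemma dissipation:
  assumes "L2_trajectory y" "parabolic_solution p (\<lambda>_. c) b1 b2 I w y" "open I"
    and "0 \<le> a" "a < b" "finite S" "{a<..<b} - S \<subseteq> I"
    and "\<And>t. t \<in> {a<..<b} - S \<Longrightarrow> (w t)\<^sup>2 \<le> E"
    and "\<And>t. t \<in> {a<..<b} - S \<Longrightarrow> m \<le> (norm_01 (y t))\<^sup>2"
  shows "m \<le> input_weight\<^sup>2 * E + prim_gain\<^sup>2 * mass / (p * (b - a)) * (norm_01 (y a))\<^sup>2"
proof -
  define r where "r = p / 2 * (m - input_weight\<^sup>2 * E)"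
  have "\<exists>V'. ((\<lambda>s. lyap (y s)) has_real_derivative V') (at t) \<and> V' \<le> - r" if t: "t \<in> {a<..<b} - S" for t
  proof -
    have tI: "t \<in> I" using assms(7) t by blast
    obtain V' where V': "((\<lambda>s. lyap (y s)) has_real_derivative V') (at t)"
      "V' \<le> - (p / 2) * (norm_01 (y t))\<^sup>2 + p / 2 * input_weight\<^sup>2 * (w t)\<^sup>2"
      by (rule lyap_derivative[OF assms(2,3) tI]) (rule that; assumption)
    have "- (p / 2) * (norm_01 (y t))\<^sup>2 \<le> - (p / 2) * m" using assms(9)[OF t] p by simp
    moreover have "p / 2 * input_weight\<^sup>2 * (w t)\<^sup>2 \<le> p / 2 * input_weight\<^sup>2 * E"
      using assms(8)[OF t] p by (intro mult_left_mono) auto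
    ultimately have "V' \<le> - r" using V'(2) by (simp add: r_def algebra_simps)
    then show ?thesis using V'(1) by blast
  qed
  then obtain V' where V': "\<And>t. t \<in> {a<..<b} - S \<Longrightarrow> ((\<lambda>s. lyap (y s)) has_real_derivative V' t) (at t)"
    "\<And>t. t \<in> {a<..<b} - S \<Longrightarrow> V' t \<le> - r" by metis
  have "- r * a - lyap (y a) \<le> - r * b - lyap (y b)"
  proof (rule nonneg_derivative_except_finite[where f="\<lambda>t. - r * t - lyap (y t)" and f'="\<lambda>t. - r - V' t" and S=S])
    show "continuous_on {a..b} (\<lambda>t. - r * t - lyap (y t))"
      using assms(4) by (intro continuous_intros continuous_on_subset[OF lyap_continuous[OF assms(1)]]) auto
    show "((\<lambda>t. - r * t - lyap (y t)) has_real_derivative - r - V' t) (at t)" if "t \<in> {a<..<b} - S" for t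
      using V'(1)[OF that] by (auto intro!: derivative_eq_intros)
    show "0 \<le> - r - V' t" if "t \<in> {a<..<b} - S" for t using V'(2)[OF that] by simp
  qed (use assms in auto)
  moreover have "0 \<le> lyap (y b)" "lyap (y a) \<le> prim_gain\<^sup>2 * mass / 2 * (norm_01 (y a))\<^sup>2"
    using lyap_nonneg[of "y b"] lyap_bound[of "y a"] assms(1,4,5) by (auto simp: L2_trajectory_def)
  ultimately have "r * (b - a) \<le> prim_gain\<^sup>2 * mass / 2 * (norm_01 (y a))\<^sup>2"
    unfolding right_diff_distrib by linarith
  then have "2 * (r * (b - a)) \<le> 2 * (prim_gain\<^sup>2 * mass / 2 * (norm_01 (y a))\<^sup>2)"
    by (rule mult_left_mono) simp
  moreover have "2 * (r * (b - a)) = (m - input_weight\<^sup>2 * E) * (p * (b - a))" by (simp add: r_def)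
  ultimately have "(m - input_weight\<^sup>2 * E) * (p * (b - a)) \<le> prim_gain\<^sup>2 * mass * (norm_01 (y a))\<^sup>2"
    by simp
  then have "m - input_weight\<^sup>2 * E \<le> prim_gain\<^sup>2 * mass * (norm_01 (y a))\<^sup>2 / (p * (b - a))"
    using p assms(5) by (subst pos_le_divide_eq) auto
  then show ?thesis by simp
qed

end

section \<open>Consequences of stability of the continuous-time system\<close>

lemma C2_on_Times_continuous: "C2_on_Times U V f \<Longrightarrow> continuous_on (U \<times> V) (\<lambda>(t, z). f t z)"
  by (simp add: C2_on_Times_def)

lemma backstepping_solution_iff:
  assumes "backstepping_kernels p q b1 b2 c K L" "open I" "I \<subseteq> {0<..}" "\<And>t. t \<in> I \<Longrightarrow> x t \<in> L2_01"
  shows "parabolic_solution p q b1 b2 I u x \<longleftrightarrow>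
    parabolic_solution p (\<lambda>_. c) b1 b2 I (\<lambda>t. u t - (\<integral>s. K 1 s * x t s \<partial>M01)) (\<lambda>t z. x t z - volterra K (x t) z)"
  using assms unfolding backstepping_kernels_def by blast

text \<open>The separated solution \<open>exp (- \<mu> * t) * \<psi> z\<close> of the target system
  is pulled back by the inverse transformation. It becomes a solution of the continuous closed loop
  whose norm does not decay.\<close>

lemma no_unstable_mode:
  assumes kernels: "backstepping_kernels p q b1 b2 c K L"
    and stable: "continuous_time_exp_stable p q b1 b2 (K 1)"
    and p: "p > 0" and \<mu>: "\<mu> \<le> 0"
    and \<psi>: "\<And>z. z \<in> {0..1} \<Longrightarrow> (\<psi> has_real_derivative \<psi>' z) (at z within {0..1})"
    and \<psi>': "\<And>z. z \<in> {0..1} \<Longrightarrow> (\<psi>' has_real_derivative (c - \<mu>) / p * \<psi> z) (at z within {0..1})"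
    and bc: "b1 * \<psi> 0 + b2 * \<psi>' 0 = 0" "\<psi> 1 = 0"
    and a: "a \<in> {0..1}" "\<psi> a \<noteq> 0"
  shows False
proof -
  have K: "continuous_on ({0..1} \<times> {0..1}) (\<lambda>(z, s). K z s)" and L: "continuous_on ({0..1} \<times> {0..1}) (\<lambda>(z, s). L z s)"
    using kernels unfolding backstepping_kernels_def by (auto intro: C2_on_Times_continuous)
  have \<psi>_cont: "continuous_on {0..1} \<psi>" by (rule DERIV_continuous_on[OF \<psi>])
  have \<psi>'_cont: "continuous_on {0..1} \<psi>'" by (rule DERIV_continuous_on[OF \<psi>'])
  have \<psi>_L2: "\<psi> \<in> L2_01" by (rule continuous_on_imp_L2_01[OF \<psi>_cont])
  define \<xi> where "\<xi> = (\<lambda>z. \<psi> z + volterra L \<psi> z)"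
  have \<xi>_cont: "continuous_on {0..1} \<xi>"
    unfolding \<xi>_def by (intro continuous_intros \<psi>_cont volterra_continuous[OF L \<psi>_L2])
  have \<xi>_L2: "\<xi> \<in> L2_01" by (rule continuous_on_imp_L2_01[OF \<xi>_cont])
  have inv: "\<psi> z = \<xi> z - volterra K \<xi> z" if "z \<in> {0..1}" for z
  proof -
    have "\<forall>f\<in>L2_01. \<forall>g\<in>L2_01. (\<forall>z\<in>{0..1}. g z = f z - volterra K f z) \<longleftrightarrow> (\<forall>z\<in>{0..1}. f z = g z + volterra L g z)"
      using kernels unfolding backstepping_kernels_def by simp
    then have "(\<forall>z\<in>{0..1}. \<psi> z = \<xi> z - volterra K \<xi> z) \<longleftrightarrow> (\<forall>z\<in>{0..1}. \<xi> z = \<psi> z + volterra L \<psi> z)"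
      using \<psi>_L2 \<xi>_L2 by blast
    then show ?thesis using that by (simp add: \<xi>_def)
  qed
  define x where "x t z = exp (- \<mu> * t) * \<xi> z" for t z
  \<comment> \<open>With the feedback as input, the boundary input of the target system is zero,
    which matches \<open>\<psi> 1 = 0\<close>.\<close>
  define u where "u t = (\<integral>s. K 1 s * x t s \<partial>M01)" for t
  define y where "y t z = x t z - volterra K (x t) z" for t z
  have y_eq: "y t z = exp (- \<mu> * t) * \<psi> z" if "z \<in> {0..1}" for t z
    unfolding y_def x_def volterra_scale[OF K] by (simp add: inv[OF that] right_diff_distrib)
  have x_L2: "x t \<in> L2_01" for t unfolding x_def by (rule L2_01_scale[OF \<xi>_L2])
  have y_C2: "C2_01 (y t)" "\<And>z. z \<in> {0..1} \<Longrightarrow> dz (y t) z = exp (- \<mu> * t) * \<psi>' z"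
    "\<And>z. z \<in> {0..1} \<Longrightarrow> dz (dz (y t)) z = exp (- \<mu> * t) * ((c - \<mu>) / p * \<psi> z)" for t
  proof -
    have 1: "((\<lambda>z. exp (- \<mu> * t) * \<psi> z) has_real_derivative exp (- \<mu> * t) * \<psi>' z) (at z within {0..1})" if "z \<in> {0..1}" for z
      using \<psi>[OF that] by (auto intro!: derivative_eq_intros)
    have 2: "((\<lambda>z. exp (- \<mu> * t) * \<psi>' z) has_real_derivative exp (- \<mu> * t) * ((c - \<mu>) / p * \<psi> z)) (at z within {0..1})" if "z \<in> {0..1}" for z
      using DERIV_cmult[OF \<psi>'[OF that], of "exp (- \<mu> * t)"] by simp
    have 3: "continuous_on {0..1} (\<lambda>z. exp (- \<mu> * t) * ((c - \<mu>) / p * \<psi> z))"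
      using p by (intro continuous_intros \<psi>_cont) auto
    note I = C2_01I[OF 1 2 3]
    have C: "C2_01 (\<lambda>z. exp (- \<mu> * t) * \<psi> z)" using I(1) by auto
    note J = C2_01_cong[OF y_eq[symmetric] C]
    show "C2_01 (y t)" using J(1) by auto
    show "dz (y t) z = exp (- \<mu> * t) * \<psi>' z" if "z \<in> {0..1}" for z using J(2)[of z] I(2)[of z] that by auto
    show "dz (dz (y t)) z = exp (- \<mu> * t) * ((c - \<mu>) / p * \<psi> z)" if "z \<in> {0..1}" for z
      using J(3)[of z] I(3)[of z] that by auto
  qed
  have y_t: "((\<lambda>s. y s z) has_real_derivative - \<mu> * (exp (- \<mu> * t) * \<psi> z)) (at t)" if "z \<in> {0..1}" for t z
    unfolding y_eq[OF that] by (auto intro!: derivative_eq_intros)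
  have joint: "continuous_on ({0<..} \<times> {0..1}) (\<lambda>(t, z). exp (- \<mu> * t) * g z)" if "continuous_on {0..1} g" for g :: "real \<Rightarrow> real"
    unfolding case_prod_unfold by (intro continuous_intros continuous_on_compose2[OF that]) auto
  have "parabolic_solution p (\<lambda>_. c) b1 b2 {0<..} (\<lambda>t. u t - (\<integral>s. K 1 s * x t s \<partial>M01)) y"
    unfolding parabolic_solution_def
  proof (intro conjI ballI)
    show "C1_on_Times {0<..} {0..1} y"
      unfolding C1_on_Times_def
    proof (intro conjI exI)
      show "continuous_on ({0<..} \<times> {0..1}) (\<lambda>(t, z). y t z)"
        by (rule continuous_on_cong[THEN iffD1, OF refl _ joint[OF \<psi>_cont]]) (auto simp: y_eq)
      show "continuous_on ({0<..} \<times> {0..1}) (\<lambda>(t, z). - \<mu> * (exp (- \<mu> * t) * \<psi> z))"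
        using continuous_on_mult[OF continuous_on_const[of _ "- \<mu>"] joint[OF \<psi>_cont]] by (simp add: case_prod_unfold)
      show "continuous_on ({0<..} \<times> {0..1}) (\<lambda>(t, z). exp (- \<mu> * t) * \<psi>' z)"
        by (rule joint[OF \<psi>'_cont])
      show "has_partials_on {0<..} {0..1} y (\<lambda>t z. - \<mu> * (exp (- \<mu> * t) * \<psi> z)) (\<lambda>t z. exp (- \<mu> * t) * \<psi>' z)"
        unfolding has_partials_on_def
      proof (intro ballI conjI)
        fix t z :: real assume z: "z \<in> {0..1}"
        show "((\<lambda>s. y s z) has_real_derivative - \<mu> * (exp (- \<mu> * t) * \<psi> z)) (at t within {0<..})"
          by (rule has_field_derivative_at_within[OF y_t[OF z]])
        show "(y t has_real_derivative exp (- \<mu> * t) * \<psi>' z) (at z within {0..1})"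
          using C2_01D(1)[OF y_C2(1) z, of t] y_C2(2)[OF z] by simp
      qed
    qed
    fix t :: real
    show "C2_01 (y t)" by (rule y_C2)
    show "b1 * y t 0 + b2 * dz (y t) 0 = 0"
    proof -
      have "b1 * y t 0 + b2 * dz (y t) 0 = exp (- \<mu> * t) * (b1 * \<psi> 0 + b2 * \<psi>' 0)"
        by (simp add: y_eq y_C2(2) algebra_simps)
      then show ?thesis by (simp add: bc)
    qed
    show "y t 1 - (u t - (\<integral>s. K 1 s * x t s \<partial>M01)) = 0" by (simp add: y_eq bc u_def)
    fix z :: real assume "z \<in> {0<..<1}"
    then have z: "z \<in> {0..1}" by auto
    show "deriv (\<lambda>s. y s z) t = p * dz (dz (y t)) z - c * y t z"
      using DERIV_imp_deriv[OF y_t[OF z, of t]] p by (simp add: y_C2(3)[OF z] y_eq[OF z] field_simps)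
  qed
  then have "parabolic_solution p q b1 b2 {0<..} u x"
    unfolding y_def by (subst backstepping_solution_iff[OF kernels]) (auto simp: x_L2)
  moreover have "L2_trajectory x"
    unfolding L2_trajectory_def
  proof (intro conjI allI impI)
    show "x t \<in> L2_01" for t by (rule x_L2)
    fix t :: real
    have "norm_01 (\<lambda>z. x s z - x t z) = \<bar>exp (- \<mu> * s) - exp (- \<mu> * t)\<bar> * norm_01 \<xi>" for s
      using norm_01_scale[of "exp (- \<mu> * s) - exp (- \<mu> * t)" \<xi>] by (simp add: x_def left_diff_distrib)
    moreover have "((\<lambda>s. \<bar>exp (- \<mu> * s) - exp (- \<mu> * t)\<bar> * norm_01 \<xi>) \<longlongrightarrow>
        \<bar>exp (- \<mu> * t) - exp (- \<mu> * t)\<bar> * norm_01 \<xi>) (at t within {0..})"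
      by (intro tendsto_intros)
    ultimately show "((\<lambda>s. norm_01 (\<lambda>z. x s z - x t z)) \<longlongrightarrow> 0) (at t within {0..})" by simp
  qed
  ultimately have "continuous_time_solution p q b1 b2 (K 1) x"
    unfolding continuous_time_solution_def u_def by simp
  then obtain M \<sigma> where M: "M > 0" "\<sigma> > 0"
    "\<And>t. t \<ge> 0 \<Longrightarrow> norm_01 (x t) \<le> M * exp (- \<sigma> * t) * norm_01 (x 0)"
    using stable unfolding continuous_time_exp_stable_def by blast
  have nx: "norm_01 (x t) = exp (- \<mu> * t) * norm_01 \<xi>" for t
    unfolding x_def norm_01_scale by simp
  have \<xi>_pos: "norm_01 \<xi> > 0"
  proof (rule ccontr)
    assume "\<not> norm_01 \<xi> > 0"
    then have 0: "norm_01 \<xi> = 0" using norm_01_nonneg[of \<xi>] by simp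
    obtain B where B: "B \<ge> 0" "\<And>z s. z \<in> {0..1} \<Longrightarrow> s \<in> {0..1} \<Longrightarrow> \<bar>K z s\<bar> \<le> B"
      by (rule kernel_bounded[OF K]) (rule that; assumption)
    have "\<xi> a = 0" by (rule continuous_norm_01_eq_0[OF \<xi>_cont 0 a(1)])
    moreover have "volterra K \<xi> a = 0"
      using volterra_bound[OF K \<xi>_L2 a(1) B] by (simp add: 0)
    ultimately show False using inv[OF a(1)] a(2) by simp
  qed
  \<comment> \<open>At this time the assumed decay factor is \<open>M * exp (- M)\<close>, which is
    below 1 because \<open>exp M \<ge> 1 + M\<close>.\<close>
  let ?t = "M / \<sigma>"
  have t: "?t \<ge> 0" using M by simp
  have "0 \<le> - \<mu> * ?t" by (rule mult_nonneg_nonneg) (use \<mu> t in auto)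
  then have "1 \<le> exp (- \<mu> * ?t)" by (simp only: one_le_exp_iff)
  then have "norm_01 \<xi> \<le> norm_01 (x ?t)" unfolding nx using \<xi>_pos by simp
  also have "\<dots> \<le> M * exp (- M) * norm_01 \<xi>" using M(3)[OF t] M(2) nx[of 0] by simp
  finally have "1 \<le> M * exp (- M)" using \<xi>_pos by simp
  then have "exp M \<le> M" by (simp add: exp_minus field_simps)
  then show False using exp_ge_add_one_self[of M] by simp
qed

text \<open>A zero \<open>w\<close> of \<open>?F\<close> makes \<open>sinh (w * (1 - z))\<close> a
  mode with decay rate \<open>c - p * w\<^sup>2\<close>. If the inequality failed, the intermediate
  value theorem would give such a zero at or beyond \<open>\<omega>\<close>, where this rate is not
  positive.\<close>

lemma Robin_subcritical:
  assumes kernels: "backstepping_kernels p q b1 b2 c K L"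
    and stable: "continuous_time_exp_stable p q b1 b2 (K 1)"
    and p: "p > 0" and b2: "b2 \<noteq> 0" and \<omega>: "\<omega> > 0" "c \<le> p * \<omega>\<^sup>2"
  shows "b1 / b2 * sinh \<omega> < \<omega> * cosh \<omega>"
proof (rule ccontr)
  let ?\<rho> = "b1 / b2"
  let ?F = "\<lambda>w. w * cosh w - ?\<rho> * sinh w"
  assume "\<not> ?\<rho> * sinh \<omega> < \<omega> * cosh \<omega>"
  then have le: "?F \<omega> \<le> 0" by simp
  \<comment> \<open>Beyond \<open>?\<rho>\<close> the sign of \<open>?F\<close> follows from
    \<open>sinh v < cosh v\<close>, which supplies the upper end for the intermediate value
    theorem.\<close>
  define v where "v = max \<omega> ?\<rho>"
  have v: "\<omega> \<le> v" "?\<rho> \<le> v" "v > 0" using \<omega> by (auto simp: v_def)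
  have "?\<rho> * sinh v \<le> v * sinh v" using v by (intro mult_right_mono) auto
  also have "\<dots> \<le> v * cosh v" using v sinh_less_cosh_real[of v] by simp
  finally have ge: "0 \<le> ?F v" by simp
  have "\<exists>w. \<omega> \<le> w \<and> w \<le> v \<and> ?F w = 0"
    by (rule IVT[OF le ge v(1)]) (use b2 in \<open>auto intro!: continuous_intros isCont_cosh isCont_sinh\<close>)
  then obtain w where w: "\<omega> \<le> w" "?F w = 0" by blast
  have wp: "w > 0" using w \<omega> by simp
  show False
  proof (rule no_unstable_mode[OF kernels stable p, where \<mu>="c - p * w\<^sup>2" and \<psi>="\<lambda>z. sinh (w * (1 - z))"
        and \<psi>'="\<lambda>z. - w * cosh (w * (1 - z))" and a=0])
    have "p * \<omega>\<^sup>2 \<le> p * w\<^sup>2" using w \<omega> p by (intro mult_left_mono power_mono) auto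
    then show "c - p * w\<^sup>2 \<le> 0" using \<omega> by simp
    show "((\<lambda>z. sinh (w * (1 - z))) has_real_derivative - w * cosh (w * (1 - z))) (at z within {0..1})" for z
      by (auto intro!: derivative_eq_intros)
    show "((\<lambda>z. - w * cosh (w * (1 - z))) has_real_derivative (c - (c - p * w\<^sup>2)) / p * sinh (w * (1 - z))) (at z within {0..1})" for z
      using p by (auto intro!: derivative_eq_intros simp: power2_eq_square)
    have "b1 * sinh w = b2 * (?\<rho> * sinh w)" using b2 by simp
    then show "b1 * sinh (w * (1 - 0)) + b2 * (- w * cosh (w * (1 - 0))) = 0" using w(2) by simp
    show "sinh (w * (1 - 0)) \<noteq> 0" using wp by simp
  qed auto
qed

text \<open>For \<open>b2 \<noteq> 0\<close> the weight is the solution of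
  \<open>p \<phi>'' = c \<phi>\<close> with \<open>\<phi> 0 = 1\<close> that satisfies the boundary
  condition at 0, and the issue is its positivity up to \<open>z = 1\<close>. Its value at 1 is
  controlled by the absence of unstable modes.\<close>

lemma energy_weight_exists:
  assumes kernels: "backstepping_kernels p q b1 b2 c K L"
    and stable: "continuous_time_exp_stable p q b1 b2 (K 1)"
    and p: "p > 0" and b: "\<bar>b1\<bar> + \<bar>b2\<bar> > 0" and c: "c \<ge> 0"
  obtains \<beta> \<phi> \<phi>1 g g1 where "energy_weight p c \<beta> b1 b2 \<phi> \<phi>1 g g1"
proof (cases "b2 = 0")
  case True
  \<comment> \<open>Under the Dirichlet condition \<open>\<beta> = c\<close> admits the constant
    weight 1, and the affine \<open>g\<close> matches it at 0, which cancels the unknown flux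
    there.\<close>
  then have "energy_weight p c c b1 b2 (\<lambda>_. 1) (\<lambda>_. 0) (\<lambda>z. 1 - z) (\<lambda>_. - 1)"
    using p c b by unfold_locales (auto intro!: derivative_eq_intros)
  then show thesis by (rule that)
next
  case b2: False
  define \<rho> where "\<rho> = b1 / b2"
  note sub = Robin_subcritical[OF kernels stable p b2, folded \<rho>_def]
  have bc: "a' * (1 - 0) - a * (- \<rho> - 0) = 0" if "b1 * a + b2 * a' = 0" for a a' :: real
    using that b2 by (simp add: \<rho>_def field_simps)
  show thesis
  proof (cases "c = 0")
    case True
    have r1: "\<rho> < 1"
    proof (rule ccontr)
      assume "\<not> \<rho> < 1"
      then consider "\<rho> = 1" | "\<rho> > 1" by linarith
      then show False
      proof cases
        case 1
        show False
          by (rule no_unstable_mode[OF kernels stable p, where \<mu>=0 and \<psi>="\<lambda>z. 1 - z" and \<psi>'="\<lambda>z. - 1" and a=0])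
            (use True 1 b2 \<rho>_def in \<open>auto intro!: derivative_eq_intros\<close>)
      next
        case 2
        let ?F = "\<lambda>w. w * cosh w - \<rho> * sinh w"
        \<comment> \<open>For \<open>\<rho> > 1\<close> the function decreases from 0, so it is
          negative at some small positive frequency; for \<open>c = 0\<close> every positive
          frequency is covered by \<open>Robin_subcritical\<close>.\<close>
        have "(?F has_real_derivative 1 - \<rho>) (at 0)" using b2 by (auto intro!: derivative_eq_intros)
        then obtain d where "d > 0" "\<And>h. h > 0 \<Longrightarrow> h < d \<Longrightarrow> ?F (0 + h) < ?F 0"
          using DERIV_neg_dec_right[of ?F "1 - \<rho>" 0] 2 by auto
        then have "?F (d / 2) < 0" "d / 2 > 0" by (metis add_0 half_gt_zero field_sum_of_halves less_add_same_cancel1 mult_zero_left sinh_0 mult_zero_right diff_self)+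
        then show False using sub[of "d / 2"] True p by simp
      qed
    qed
    have "energy_weight p c 0 b1 b2 (\<lambda>z. 1 - \<rho> * z) (\<lambda>_. - \<rho>) (\<lambda>_. 0) (\<lambda>_. 0)"
    proof
      show "0 < 1 - \<rho> * z" if "z \<in> {0..1}" for z
      proof -
        have "\<rho> * z < 1"
        proof (cases "\<rho> \<le> 0")
          case True
          then have "\<rho> * z \<le> 0" using that by (intro mult_nonpos_nonneg) auto
          then show ?thesis by simp
        next
          case False
          then have "\<rho> * z \<le> \<rho> * 1" using that by (intro mult_left_mono) auto
          then show ?thesis using r1 by simp
        qed
        then show ?thesis by simp
      qed
      show "a' * (1 - \<rho> * 0 - 0) - a * (- \<rho> - 0) = 0" if "b1 * a + b2 * a' = 0" for a a'
        using bc[OF that] by simp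
    qed (use p True b2 in \<open>auto intro!: derivative_eq_intros\<close>)
    then show thesis by (rule that)
  next
    case False
    define \<omega> where "\<omega> = sqrt (c / p)"
    have \<omega>: "\<omega> > 0" "\<omega>\<^sup>2 = c / p" using False c p by (auto simp: \<omega>_def)
    have sub': "\<rho> * sinh \<omega> < \<omega> * cosh \<omega>" by (rule sub) (use \<omega> p in auto)
    have "energy_weight p c 0 b1 b2 (\<lambda>z. cosh (\<omega> * z) - \<rho> / \<omega> * sinh (\<omega> * z))
        (\<lambda>z. \<omega> * sinh (\<omega> * z) - \<rho> * cosh (\<omega> * z)) (\<lambda>_. 0) (\<lambda>_. 0)"
    proof
      show "((\<lambda>z. cosh (\<omega> * z) - \<rho> / \<omega> * sinh (\<omega> * z)) has_real_derivative
          \<omega> * sinh (\<omega> * z) - \<rho> * cosh (\<omega> * z)) (at z within {0..1})" for z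
        using \<omega>(1) by (auto intro!: derivative_eq_intros simp: field_simps)
      have "((\<lambda>z. \<omega> * sinh (\<omega> * z) - \<rho> * cosh (\<omega> * z)) has_real_derivative
          \<omega>\<^sup>2 * (cosh (\<omega> * z) - \<rho> / \<omega> * sinh (\<omega> * z))) (at z within {0..1})" for z
        using \<omega>(1) by (auto intro!: derivative_eq_intros simp: power2_eq_square right_diff_distrib)
      then show "((\<lambda>z. \<omega> * sinh (\<omega> * z) - \<rho> * cosh (\<omega> * z)) has_real_derivative
          (c - 0) / p * (cosh (\<omega> * z) - \<rho> / \<omega> * sinh (\<omega> * z))) (at z within {0..1})" for z
        by (simp add: \<omega>(2))
      show "0 < cosh (\<omega> * z) - \<rho> / \<omega> * sinh (\<omega> * z)" if z: "z \<in> {0..1}" for z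
      proof (cases "z = 0")
        case nz: False
        have sz: "sinh (\<omega> * z) > 0" and s1: "sinh \<omega> > 0" using z nz \<omega>(1) by auto
        \<comment> \<open>The subtraction formula says that \<open>coth\<close> at
          \<open>\<omega> * z\<close> is at least \<open>coth\<close> at \<open>\<omega>\<close>, so
          the strict inequality known at \<open>z = 1\<close> implies positivity at every
          \<open>z\<close>.\<close>
        have "0 \<le> sinh (\<omega> - \<omega> * z)" using z \<omega>(1) by (simp add: mult_left_le)
        then have "cosh \<omega> * sinh (\<omega> * z) \<le> sinh \<omega> * cosh (\<omega> * z)" by (simp add: sinh_diff)
        then have "\<omega> * (cosh \<omega> * sinh (\<omega> * z)) \<le> \<omega> * (sinh \<omega> * cosh (\<omega> * z))"
          using \<omega>(1) by (intro mult_left_mono) auto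
        moreover have "\<rho> * sinh \<omega> * sinh (\<omega> * z) < \<omega> * cosh \<omega> * sinh (\<omega> * z)"
          using sub' sz by (rule mult_strict_right_mono)
        ultimately have "sinh \<omega> * (\<rho> * sinh (\<omega> * z)) < sinh \<omega> * (\<omega> * cosh (\<omega> * z))"
          by (simp add: mult_ac)
        then have "\<rho> * sinh (\<omega> * z) < \<omega> * cosh (\<omega> * z)"
          using s1 by (simp only: mult_less_cancel_left_pos)
        then have "\<rho> * sinh (\<omega> * z) / \<omega> < cosh (\<omega> * z)"
          using \<omega>(1) by (simp add: pos_divide_less_eq mult.commute)
        then show ?thesis by simp
      qed simp
      show "a' * (cosh (\<omega> * 0) - \<rho> / \<omega> * sinh (\<omega> * 0) - 0) - a * (\<omega> * sinh (\<omega> * 0) - \<rho> * cosh (\<omega> * 0) - 0) = 0"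
        if "b1 * a + b2 * a' = 0" for a a'
        using bc[OF that] by simp
    qed (use p b2 in auto)
    then show thesis by (rule that)
  qed
qed

section \<open>Exponential stability under sampling\<close>

text \<open>The chosen weak second derivative agrees almost everywhere with the continuous function
  that the equation dictates. Their indefinite integrals coincide, so this function is the classical
  second derivative.\<close>

lemma eigenfunction_classical:
  assumes "p > 0" "continuous_on {0..1} q" "C2_01 f" "sl_eigen_eq p q b1 b2 \<mu> f" "z \<in> {0..1}"
  shows "p * dz (dz f) z = (q z - \<mu>) * f z"
proof -
  note D = C2_01D[OF assms(3)]
  define G where "G s = (q s - \<mu>) * f s / p" for s
  define w where "w = weak_dz2 f"
  have G_cont: "continuous_on {0..1} G"
    unfolding G_def using assms(1) by (intro continuous_intros assms(2) D) auto
  have "\<exists>g. is_weak_dz2 f g" using assms(4) by (auto simp: sl_eigen_eq_def sl_domain_def H2_01_def)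
  then have "is_weak_dz2 f w" unfolding w_def weak_dz2_def by (rule someI_ex)
  then have w: "w \<in> L2_01" "\<And>z. z \<in> {0..1} \<Longrightarrow> dz f z = dz f 0 + (\<integral>s. w s \<partial>lebesgue_on {0..z})"
    unfolding is_weak_dz2_def by blast+
  have "AE s in M01. - p * w s + q s * f s = \<mu> * f s"
    using assms(4) by (simp add: sl_eigen_eq_def sl_op_def w_def)
  then have wG: "AE s in M01. w s = G s"
    by eventually_elim (use assms(1) in \<open>simp add: G_def field_simps\<close>)
  have "(\<integral>s. w s \<partial>lebesgue_on {0..z}) = integral {0..z} G" if z: "z \<in> {0..1}" for z
  proof -
    have sub: "{0..z} \<subseteq> {0..1}" using z by auto
    have c: "continuous_on {0..z} G" by (rule continuous_on_subset[OF G_cont sub])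
    have "AE s in lebesgue. s \<in> {0..1} \<longrightarrow> w s = G s"
      using wG by (simp add: AE_restrict_space_iff)
    then have "AE s in lebesgue. s \<in> {0..z} \<longrightarrow> w s = G s"
      by eventually_elim (use sub in blast)
    then have "AE s in lebesgue_on {0..z}. w s = G s"
      by (simp add: AE_restrict_space_iff)
    moreover have "w \<in> borel_measurable (lebesgue_on {0..z})"
      by (rule measurable_restrict_mono[OF L2_01_measurable[OF w(1)] sub])
    moreover have i: "integrable (lebesgue_on {0..z}) G" by (rule continuous_imp_integrable_real[OF c])
    ultimately have "(\<integral>s. w s \<partial>lebesgue_on {0..z}) = (\<integral>s. G s \<partial>lebesgue_on {0..z})"
      by (intro integral_cong_AE) auto
    also have "\<dots> = integral {0..z} G" by (rule lebesgue_integral_eq_integral[OF i]) simp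
    finally show ?thesis .
  qed
  then have eq: "dz f z = dz f 0 + integral {0..z} G" if "z \<in> {0..1}" for z
    using w(2)[OF that] that by simp
  have "((\<lambda>z. dz f 0 + integral {0..z} G) has_real_derivative G z) (at z within {0..1})"
    using integral_has_real_derivative[OF G_cont assms(5)] by (auto intro!: derivative_eq_intros)
  then have "(dz f has_real_derivative G z) (at z within {0..1})"
    by (rule has_real_derivative_transform[OF _ assms(5) eq])
  then have "dz (dz f) z = G z" by (rule dz_eqI[OF _ assms(5)])
  then show ?thesis using assms(1) by (simp add: G_def)
qed

lemma eigensystem_sturm_liouville:
  assumes "p > 0" "\<bar>b1\<bar> + \<bar>b2\<bar> > 0" "continuous_on {0..1} q" "sl_eigensystem p q b1 b2 lam phi"
    and "\<exists>N>0. lam N > 0 \<and>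
           summable (\<lambda>n. inverse (lam (n + N)) * (SUP z\<in>{0..1}. \<bar>phi (n + N) z\<bar>))"
  shows "sturm_liouville p b1 b2 q (\<lambda>n. lam (Suc n)) (\<lambda>n. phi (Suc n))"
proof -
  have mono: "strict_mono_on {1..} lam" and lim: "filterlim lam at_top sequentially"
    and ef: "\<And>n. n \<ge> 1 \<Longrightarrow> C2_01 (phi n)" "\<And>n. n \<ge> 1 \<Longrightarrow> sl_eigen_eq p q b1 b2 (lam n) (phi n)"
    and orth: "\<And>m n. m \<ge> 1 \<Longrightarrow> n \<ge> 1 \<Longrightarrow> inner_01 (phi m) (phi n) = (if m = n then 1 else 0)"
    and compl: "\<And>f. f \<in> L2_01 \<Longrightarrow>
        (\<lambda>m. norm_01 (\<lambda>z. f z - (\<Sum>n=1..m. inner_01 f (phi n) * phi n z))) \<longlonglongrightarrow> 0"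
    using assms(4) unfolding sl_eigensystem_def by blast+
  have bc: "b1 * phi (Suc n) 0 + b2 * dz (phi (Suc n)) 0 = 0" "phi (Suc n) 1 = 0" for n
    using ef(2)[of "Suc n"] by (auto simp: sl_eigen_eq_def sl_domain_def)
  obtain N where N: "N > 0" "lam N > 0" "summable (\<lambda>n. inverse (lam (n + N)) * (SUP z\<in>{0..1}. \<bar>phi (n + N) z\<bar>))"
    using assms(5) by blast
  then obtain N' where N': "N = Suc N'" using gr0_implies_Suc by blast
  show ?thesis
  proof
    show "p * dz (dz (phi (Suc n))) z = (q z - lam (Suc n)) * phi (Suc n) z" if "z \<in> {0..1}" for n z
      by (rule eigenfunction_classical[OF assms(1,3) ef(1,2) that]) auto
    show "(\<lambda>m. norm_01 (\<lambda>z. f z - (\<Sum>n<m. inner_01 f (phi (Suc n)) * phi (Suc n) z))) \<longlonglongrightarrow> 0" if "f \<in> L2_01" for f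
      using compl[OF that] by (simp add: sum.atLeast1_atMost_eq)
    show "strict_mono (\<lambda>n. lam (Suc n))"
      using mono by (auto simp: strict_mono_def strict_mono_on_def)
    show "filterlim (\<lambda>n. lam (Suc n)) at_top sequentially"
      using lim by (simp add: filterlim_sequentially_Suc)
    show "\<exists>N. lam (Suc N) > 0 \<and> summable (\<lambda>n. inverse (lam (Suc (n + N))) * (SUP z\<in>{0..1}. \<bar>phi (Suc (n + N)) z\<bar>))"
      using N(2,3) by (intro exI[of _ N']) (simp add: N')
  qed (use assms ef(1) bc orth in auto)
qed

context sturm_liouville
begin

text \<open>If \<open>y\<close> stayed large over the window, \<open>dissipation\<close> would be
  violated, its feedback error being small for fast sampling. Hence \<open>y\<close>, and with it
  \<open>x\<close>, is small at some instant, and little is lost until the next sampling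
  instant.\<close>

lemma sampled_contraction:
  assumes kernels: "backstepping_kernels p q b1 b2 c K L"
    and weight: "energy_weight p c \<beta> b1 b2 \<phi> \<phi>1 g g1"
  obtains R C T where "R > 0" "C \<ge> 1" "T > 0"
    "\<And>\<tau> x0 x i s. sampling \<tau> \<Longrightarrow> sampled_solution p q b1 b2 (K 1) \<tau> x0 x \<Longrightarrow> \<tau> i \<le> s \<Longrightarrow> s \<le> \<tau> i + R \<Longrightarrow>
       inner_01 (x s) (x s) \<le> C * inner_01 (x (\<tau> i)) (x (\<tau> i))"
    "\<And>\<tau> x0 x i. sampling \<tau> \<Longrightarrow> \<forall>i. \<tau> (Suc i) - \<tau> i \<le> T \<Longrightarrow> sampled_solution p q b1 b2 (K 1) \<tau> x0 x \<Longrightarrow>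
       \<exists>j>i. \<tau> j \<le> \<tau> i + R \<and> inner_01 (x (\<tau> j)) (x (\<tau> j)) \<le> inner_01 (x (\<tau> i)) (x (\<tau> i)) / 2"
proof -
  interpret energy_weight p c \<beta> b1 b2 \<phi> \<phi>1 g g1 by fact
  have K: "continuous_on ({0..1} \<times> {0..1}) (\<lambda>(z, s). K z s)" and L: "continuous_on ({0..1} \<times> {0..1}) (\<lambda>(z, s). L z s)"
    using kernels unfolding backstepping_kernels_def by (auto intro: C2_on_Times_continuous)
  have k: "K 1 \<in> L2_01" by (rule continuous_on_imp_L2_01) (rule continuous_on_slice[OF K], simp)
  let ?\<kappa> = "inner_01 (K 1) (K 1)"
  have \<kappa>: "?\<kappa> \<ge> 0" by (rule inner_01_self_nonneg)
  obtain BK where BK: "BK \<ge> 0" "\<And>f. f \<in> L2_01 \<Longrightarrow> norm_01 (volterra K f) \<le> BK * norm_01 f"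
    by (rule volterra_norm_bound[OF K]) (rule that; assumption)
  obtain BL where BL: "BL \<ge> 0" "\<And>f. f \<in> L2_01 \<Longrightarrow> norm_01 (volterra L f) \<le> BL * norm_01 f"
    by (rule volterra_norm_bound[OF L]) (rule that; assumption)
  let ?Y = "\<lambda>f z. f z - volterra K f z"
  have Y_L2: "?Y f \<in> L2_01" if "f \<in> L2_01" for f by (intro L2_01_diff that volterra_L2[OF K])
  have Y_le: "(norm_01 (?Y f))\<^sup>2 \<le> (1 + BK)\<^sup>2 * inner_01 f f" if "f \<in> L2_01" for f
  proof -
    have "norm_01 (?Y f) \<le> norm_01 f + norm_01 (\<lambda>z. (- 1) * volterra K f z)"
      using norm_01_triangle[OF that L2_01_scale[OF volterra_L2[OF K that], of "- 1"]] by simp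
    also have "\<dots> \<le> (1 + BK) * norm_01 f"
      using BK(2)[OF that] unfolding norm_01_scale by (simp add: distrib_right)
    finally have "(norm_01 (?Y f))\<^sup>2 \<le> ((1 + BK) * norm_01 f)\<^sup>2" by (intro power_mono) auto
    then show ?thesis by (simp add: power_mult_distrib norm_01_squared)
  qed
  have le_Y: "inner_01 f f \<le> (1 + BL)\<^sup>2 * (norm_01 (?Y f))\<^sup>2" if f: "f \<in> L2_01" for f
  proof -
    note Yf = Y_L2[OF f]
    have "\<forall>f\<in>L2_01. \<forall>g\<in>L2_01. (\<forall>z\<in>{0..1}. g z = f z - volterra K f z) \<longleftrightarrow> (\<forall>z\<in>{0..1}. f z = g z + volterra L g z)"
      using kernels unfolding backstepping_kernels_def by simp
    from this[rule_format, OF f Yf]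
    have "\<forall>z\<in>{0..1}. f z = ?Y f z + volterra L (?Y f) z" by simp
    then have "norm_01 f = norm_01 (\<lambda>z. ?Y f z + volterra L (?Y f) z)" by (intro norm_01_cong) blast
    also have "\<dots> \<le> norm_01 (?Y f) + norm_01 (volterra L (?Y f))"
      by (rule norm_01_triangle[OF Yf volterra_L2[OF L Yf]])
    also have "\<dots> \<le> (1 + BL) * norm_01 (?Y f)" using BL(2)[OF Yf] by (simp add: distrib_right)
    finally have "(norm_01 f)\<^sup>2 \<le> ((1 + BL) * norm_01 (?Y f))\<^sup>2" by (intro power_mono) auto
    then show ?thesis by (simp add: power_mult_distrib norm_01_squared)
  qed
  define a where "a = (1 + BL)\<^sup>2"
  have a: "a > 0" using BL(1) by (simp add: a_def)
  \<comment> \<open>Smallness of \<open>y\<close> by \<open>\<eta>\<close> at the good instant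
    contributes one quarter of the initial squared norm at the next sampling time, after conversion
    to \<open>x\<close> by \<open>a\<close> and growth over one step.\<close>
  define \<eta> where "\<eta> = 1 / (8 * growth\<^sup>2 * a)"
  have gr: "growth\<^sup>2 > 0" using growth_ge_1 by simp
  have \<eta>: "\<eta> > 0" "2 * growth\<^sup>2 * (a * \<eta>) = 1 / 4" using a gr by (auto simp: \<eta>_def)
  define D2 where "D2 = prim_gain\<^sup>2 * mass / p * (1 + BK)\<^sup>2"
  have D2: "D2 \<ge> 0" unfolding D2_def using mass_nonneg p by simp
  \<comment> \<open>The window is long enough for the initial value to contribute at most
    \<open>\<eta> / 4\<close> in the dissipation estimate.\<close>
  define R0 where "R0 = 4 * (D2 + 1) / \<eta>"
  have R0: "R0 > 0" "D2 / R0 \<le> \<eta> / 4"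
  proof -
    show "R0 > 0" using D2 \<eta> by (simp add: R0_def)
    have "D2 / R0 = D2 / (D2 + 1) * (\<eta> / 4)" by (simp add: R0_def)
    also have "\<dots> \<le> 1 * (\<eta> / 4)" using D2 \<eta> by (intro mult_right_mono) auto
    finally show "D2 / R0 \<le> \<eta> / 4" by simp
  qed
  \<comment> \<open>The horizon is one unit longer than \<open>R0\<close>, since the sampling
    instant that follows the good instant may lie beyond the window by up to
    \<open>T \<le> 1\<close>.\<close>
  obtain C where C: "C \<ge> 1"
    "\<And>\<tau> x0 x i s. sampling \<tau> \<Longrightarrow> sampled_solution p q b1 b2 (K 1) \<tau> x0 x \<Longrightarrow> \<tau> i \<le> s \<Longrightarrow> s \<le> \<tau> i + (R0 + 1) \<Longrightarrow>
       inner_01 (x s) (x s) \<le> C * inner_01 (x (\<tau> i)) (x (\<tau> i))"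
    by (rule horizon_bound[OF k]) (rule that; assumption)
  \<comment> \<open>The feedback error also contributes at most \<open>\<eta> / 4\<close>. Both
    terms together stay below \<open>\<eta>\<close>, which yields the contradiction.\<close>
  define \<epsilon> where "\<epsilon> = \<eta> / (4 * C * (input_weight\<^sup>2 + 1))"
  have iw: "input_weight\<^sup>2 + 1 > 0" by (simp add: add_nonneg_pos)
  have \<epsilon>: "\<epsilon> > 0" "input_weight\<^sup>2 * (\<epsilon> * C) \<le> \<eta> / 4"
  proof -
    show "\<epsilon> > 0" using \<eta> C(1) iw by (auto simp: \<epsilon>_def intro!: divide_pos_pos mult_pos_pos)
    have "input_weight\<^sup>2 * (\<epsilon> * C) = input_weight\<^sup>2 / (input_weight\<^sup>2 + 1) * (\<eta> / 4)"
      using C(1) by (simp add: \<epsilon>_def)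
    also have "\<dots> \<le> 1 * (\<eta> / 4)" using \<eta> iw by (intro mult_right_mono) auto
    finally show "input_weight\<^sup>2 * (\<epsilon> * C) \<le> \<eta> / 4" by simp
  qed
  obtain \<delta>1 where \<delta>1: "0 < \<delta>1" "\<delta>1 \<le> 1"
    "\<And>\<tau> x0 x i t. sampling \<tau> \<Longrightarrow> sampled_solution p q b1 b2 (K 1) \<tau> x0 x \<Longrightarrow> \<tau> i \<le> t \<Longrightarrow> t < \<tau> (Suc i) \<Longrightarrow> t - \<tau> i \<le> \<delta>1 \<Longrightarrow>
       (inner_01 (K 1) (x (\<tau> i)) - inner_01 (K 1) (x t))\<^sup>2 \<le> \<epsilon> * inner_01 (x (\<tau> i)) (x (\<tau> i))"
    by (rule feedback_error_bound[OF k \<epsilon>(1)]) (rule that; assumption)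
  \<comment> \<open>The input held after the good instant contributes the second quarter, so the
    squared norm is halved.\<close>
  define \<epsilon>2 where "\<epsilon>2 = 1 / (8 * C * (?\<kappa> + 1))"
  have \<epsilon>2: "\<epsilon>2 > 0" "2 * (?\<kappa> * C) * \<epsilon>2 \<le> 1 / 4"
  proof -
    show "\<epsilon>2 > 0" using C(1) \<kappa> by (auto simp: \<epsilon>2_def)
    have "2 * (k * C) * (1 / (8 * C * d)) = k / d * (1 / 4)" for k d :: real using C(1) by simp
    then have "2 * (?\<kappa> * C) * \<epsilon>2 = ?\<kappa> / (?\<kappa> + 1) * (1 / 4)" unfolding \<epsilon>2_def .
    also have "\<dots> \<le> 1 * (1 / 4)" using \<kappa> by (intro mult_right_mono) auto
    finally show "2 * (?\<kappa> * C) * \<epsilon>2 \<le> 1 / 4" by simp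
  qed
  obtain \<delta>2 where \<delta>2: "0 < \<delta>2" "\<delta>2 \<le> 1"
    "\<And>s. 0 \<le> s \<Longrightarrow> s \<le> \<delta>2 \<Longrightarrow> summable (\<lambda>n. (input_coeff n * exp_integral (l n) s)\<^sup>2)"
    "\<And>s. 0 \<le> s \<Longrightarrow> s \<le> \<delta>2 \<Longrightarrow> input_gain s \<le> \<epsilon>2"
    by (rule input_gain_small[OF \<epsilon>2(1)]) (rule that; assumption)
  define T where "T = min \<delta>1 \<delta>2"
  have T: "T > 0" "T \<le> \<delta>1" "T \<le> \<delta>2" "T \<le> 1" using \<delta>1 \<delta>2 by (auto simp: T_def)
  show thesis
  proof (rule that[of "R0 + 1" C T])
    show "R0 + 1 > 0" "C \<ge> 1" "T > 0" using R0 C T by auto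
    show "inner_01 (x s) (x s) \<le> C * inner_01 (x (\<tau> i)) (x (\<tau> i))"
      if "sampling \<tau>" "sampled_solution p q b1 b2 (K 1) \<tau> x0 x" "\<tau> i \<le> s" "s \<le> \<tau> i + (R0 + 1)" for \<tau> x0 x i s
      by (rule C(2)[OF that])
    fix \<tau> x0 x i
    assume samp: "sampling \<tau>" and step: "\<forall>i. \<tau> (Suc i) - \<tau> i \<le> T" and sol: "sampled_solution p q b1 b2 (K 1) \<tau> x0 x"
    interpret sampling \<tau> by fact
    obtain u where x: "L2_trajectory x"
      "\<And>i t. \<tau> i \<le> t \<Longrightarrow> t < \<tau> (Suc i) \<Longrightarrow> u t = inner_01 (K 1) (x (\<tau> i))"
      "parabolic_solution p q b1 b2 ({0..} - range \<tau>) u x"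
      by (rule sampled_solutionE[OF sol]) (rule that; assumption)
    let ?I = "{0..} - range \<tau>" and ?N = "\<lambda>t. inner_01 (x t) (x t)"
    have xL: "x t \<in> L2_01" if "t \<ge> 0" for t using x(1) that by (auto simp: L2_trajectory_def)
    have N0: "?N t \<ge> 0" for t by (rule inner_01_self_nonneg)
    have hor: "?N s \<le> C * ?N (\<tau> i)" if "\<tau> i \<le> s" "s \<le> \<tau> i + (R0 + 1)" for s
      by (rule C(2)[OF samp sol that])
    let ?w = "\<lambda>t. u t - (\<integral>s. K 1 s * x t s \<partial>M01)" and ?y = "\<lambda>t z. x t z - volterra K (x t) z"
    have y: "parabolic_solution p (\<lambda>_. c) b1 b2 ?I ?w ?y"
      using x(3) backstepping_solution_iff[OF kernels open_nonsample nonsample_pos, of x u] xL by auto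
    have yT: "L2_trajectory ?y" by (rule volterra_L2_trajectory[OF K x(1)])
    have w: "(?w t)\<^sup>2 \<le> \<epsilon> * (C * ?N (\<tau> i))" if t: "\<tau> i \<le> t" "t \<le> \<tau> i + R0" for t
    proof -
      have t0: "0 \<le> t" using t tau_nonneg[of i] by simp
      let ?j = "idx t"
      note j = idx_bounds[OF t0]
      have "t - \<tau> ?j \<le> \<delta>1" using j step[rule_format, of ?j] T by simp
      from \<delta>1(3)[OF samp sol j this]
      have "(?w t)\<^sup>2 \<le> \<epsilon> * ?N (\<tau> ?j)" using x(2)[OF j] by (simp add: inner_01_def)
      moreover have "\<tau> i \<le> \<tau> ?j" using idx_mono[OF tau_nonneg t(1)] idx_eqI[of i "\<tau> i"] tau_less[of i] by (simp add: tau_le_iff)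
      then have "?N (\<tau> ?j) \<le> C * ?N (\<tau> i)" using j t by (intro hor) auto
      ultimately show ?thesis using \<epsilon>(1) by (meson mult_left_mono less_imp_le order_trans)
    qed
    have "\<exists>t. \<tau> i < t \<and> t < \<tau> i + R0 \<and> ?N t \<le> a * \<eta> * ?N (\<tau> i)"
    proof (cases "?N (\<tau> i) = 0")
      \<comment> \<open>The strict contradiction below requires a nonzero state; from a zero state
        the horizon bound keeps the solution zero, and any instant of the window serves.\<close>
      case True
      have "?N (\<tau> i + R0 / 2) \<le> C * ?N (\<tau> i)" using R0 by (intro hor) auto
      then show ?thesis using True R0(1) by (intro exI[of _ "\<tau> i + R0 / 2"]) simp
    next
      case False
      then have Np: "?N (\<tau> i) > 0" using N0[of "\<tau> i"] by simp
      have "\<exists>t. t \<in> {\<tau> i<..<\<tau> i + R0} \<and> (norm_01 (?y t))\<^sup>2 < \<eta> * ?N (\<tau> i)"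
      proof (rule ccontr)
        assume "\<nexists>t. t \<in> {\<tau> i<..<\<tau> i + R0} \<and> (norm_01 (?y t))\<^sup>2 < \<eta> * ?N (\<tau> i)"
        then have big: "\<eta> * ?N (\<tau> i) \<le> (norm_01 (?y t))\<^sup>2" if "t \<in> {\<tau> i<..<\<tau> i + R0}" for t
          using that by (meson not_le)
        have "\<eta> * ?N (\<tau> i) \<le> input_weight\<^sup>2 * (\<epsilon> * (C * ?N (\<tau> i)))
            + prim_gain\<^sup>2 * mass / (p * ((\<tau> i + R0) - \<tau> i)) * (norm_01 (?y (\<tau> i)))\<^sup>2"
        proof (rule dissipation[OF yT y open_nonsample tau_nonneg _ finite_samples[of "\<tau> i" "\<tau> i + R0"]])
          show "{\<tau> i<..<\<tau> i + R0} - range \<tau> \<inter> {\<tau> i..\<tau> i + R0} \<subseteq> ?I"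
            using tau_nonneg[of i] by auto
          show "(?w t)\<^sup>2 \<le> \<epsilon> * (C * ?N (\<tau> i))" if "t \<in> {\<tau> i<..<\<tau> i + R0} - range \<tau> \<inter> {\<tau> i..\<tau> i + R0}" for t
            using that by (intro w) auto
        qed (use R0 big in auto)
        also have "\<dots> \<le> (input_weight\<^sup>2 * (\<epsilon> * C)) * ?N (\<tau> i) + D2 / R0 * ?N (\<tau> i)"
        proof (rule add_mono)
          have "prim_gain\<^sup>2 * mass / (p * R0) * (norm_01 (?y (\<tau> i)))\<^sup>2 \<le>
              prim_gain\<^sup>2 * mass / (p * R0) * ((1 + BK)\<^sup>2 * ?N (\<tau> i))"
            using mass_nonneg p R0(1) by (intro mult_left_mono Y_le xL tau_nonneg) auto
          also have "\<dots> = D2 / R0 * ?N (\<tau> i)" by (simp add: D2_def)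
          finally show "prim_gain\<^sup>2 * mass / (p * ((\<tau> i + R0) - \<tau> i)) * (norm_01 (?y (\<tau> i)))\<^sup>2 \<le> D2 / R0 * ?N (\<tau> i)" by simp
        qed (simp add: mult.assoc)
        also have "\<dots> \<le> \<eta> / 4 * ?N (\<tau> i) + \<eta> / 4 * ?N (\<tau> i)"
          by (intro add_mono mult_right_mono \<epsilon> R0 N0)
        finally have "\<eta> * ?N (\<tau> i) \<le> \<eta> * ?N (\<tau> i) / 2" by simp
        moreover have "\<eta> * ?N (\<tau> i) > 0" using \<eta>(1) Np by simp
        ultimately show False by linarith
      qed
      then obtain t where t: "\<tau> i < t" "t < \<tau> i + R0" "(norm_01 (?y t))\<^sup>2 \<le> \<eta> * ?N (\<tau> i)" by auto
      have "?N t \<le> a * (norm_01 (?y t))\<^sup>2"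
        unfolding a_def using t tau_nonneg[of i] by (intro le_Y xL) simp
      also have "\<dots> \<le> a * (\<eta> * ?N (\<tau> i))" using t(3) a by (intro mult_left_mono) auto
      finally show ?thesis using t by (intro exI[of _ t]) (simp add: mult.assoc)
    qed
    then obtain t where t: "\<tau> i < t" "t < \<tau> i + R0" "?N t \<le> a * \<eta> * ?N (\<tau> i)" by blast
    have t0: "0 \<le> t" using t tau_nonneg[of i] by simp
    \<comment> \<open>The decrease must be recorded at a sampling instant, because the next window
      has to start at one.\<close>
    let ?j = "Suc (idx t)"
    have j: "t < \<tau> ?j" "\<tau> ?j - t \<le> T" using idx_bounds[OF t0] step[rule_format, of "idx t"] by auto
    have jR: "\<tau> ?j \<le> \<tau> i + (R0 + 1)" using j t T by simp
    have "i < ?j" using t(1) j(1) by (simp add: tau_less_iff[symmetric])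
    moreover have "?N (\<tau> ?j) \<le> ?N (\<tau> i) / 2"
    proof -
      have "?N (\<tau> ?j) \<le> 2 * growth\<^sup>2 * ?N t + 2 * (sqrt (?\<kappa> * (C * ?N (\<tau> i))))\<^sup>2 * input_gain (\<tau> ?j - t)"
      proof (rule evolution_norm[OF x(1,3) open_nonsample t0 less_imp_le[OF j(1)] _ finite.emptyI])
        show "{t<..<\<tau> ?j} - {} \<subseteq> ?I"
        proof
          fix s assume s: "s \<in> {t<..<\<tau> ?j} - {}"
          show "s \<in> ?I" by (rule between_samples[of "idx t"]) (use s idx_bounds[OF t0] in auto)
        qed
        show "\<bar>u s\<bar> \<le> sqrt (?\<kappa> * (C * ?N (\<tau> i)))" if s: "s \<in> {t<..<\<tau> ?j} - {}" for s
          by (rule sampled_input_bound[OF samp k x(1,2), where i=i and b="\<tau> ?j"])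
            (use s t jR hor in auto)
        show "summable (\<lambda>n. (input_coeff n * exp_integral (l n) (\<tau> ?j - t))\<^sup>2)"
          using \<delta>2(3)[of "\<tau> ?j - t"] j T by simp
      qed (use j T in auto)
      also have "(sqrt (?\<kappa> * (C * ?N (\<tau> i))))\<^sup>2 = ?\<kappa> * (C * ?N (\<tau> i))"
        using \<kappa> C(1) N0[of "\<tau> i"] by simp
      also have "2 * growth\<^sup>2 * ?N t + 2 * (?\<kappa> * (C * ?N (\<tau> i))) * input_gain (\<tau> ?j - t) \<le>
          2 * growth\<^sup>2 * (a * \<eta> * ?N (\<tau> i)) + 2 * (?\<kappa> * (C * ?N (\<tau> i))) * \<epsilon>2"
        using t(3) \<delta>2(4)[of "\<tau> ?j - t"] j T \<kappa> C(1) N0[of "\<tau> i"]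
        by (intro add_mono mult_left_mono) auto
      also have "\<dots> = (2 * growth\<^sup>2 * (a * \<eta>)) * ?N (\<tau> i) + (2 * (?\<kappa> * C) * \<epsilon>2) * ?N (\<tau> i)"
        by (simp only: mult_ac)
      also have "\<dots> \<le> 1 / 4 * ?N (\<tau> i) + 1 / 4 * ?N (\<tau> i)"
        by (intro add_mono mult_right_mono \<epsilon>2 N0) (simp add: \<eta>(2))
      finally show ?thesis by simp
    qed
    ultimately show "\<exists>j>i. \<tau> j \<le> \<tau> i + (R0 + 1) \<and> ?N (\<tau> j) \<le> ?N (\<tau> i) / 2"
      using jR by blast
  qed
qed

text \<open>Strong induction on the number of sampling intervals between \<open>\<tau> i\<close> and
  \<open>t\<close>. A halving within time at most \<open>R\<close> is matched by the exponential,
  which drops by \<open>1 / 2\<close> over \<open>R\<close>; the factor 2 pays for the last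
  incomplete window.\<close>

lemma halving_imp_exponential_decay:
  assumes "sampling \<tau>" "R > 0" "C \<ge> 1"
    and N0: "\<And>t. 0 \<le> N t"
    and bound: "\<And>i s. \<tau> i \<le> s \<Longrightarrow> s \<le> \<tau> i + R \<Longrightarrow> N s \<le> C * N (\<tau> i)"
    and half: "\<And>i. \<exists>j>i. \<tau> j \<le> \<tau> i + R \<and> N (\<tau> j) \<le> N (\<tau> i) / 2"
    and "\<tau> i \<le> t"
  shows "N t \<le> 2 * C * exp (- (ln 2 / R) * (t - \<tau> i)) * N (\<tau> i)"
  using assms(7)
proof (induction "sampling.idx \<tau> t - i" arbitrary: i rule: less_induct)
  case (less i)
  interpret sampling \<tau> by fact
  let ?e = "\<lambda>s. exp (- (ln 2 / R) * s)"
  have eR: "?e R = 1 / 2" using assms(2) by (simp add: exp_minus)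
  have t0: "0 \<le> t" using less.prems tau_nonneg[of i] by simp
  have dec: "?e s \<le> ?e r" if "r \<le> s" for r s
    using that assms(2) by (simp add: divide_right_mono mult_left_mono)
  show ?case
  proof (cases "t \<le> \<tau> i + R")
    case True
    have "?e R \<le> ?e (t - \<tau> i)" by (rule dec) (use True in simp)
    then have "1 / 2 \<le> ?e (t - \<tau> i)" unfolding eR .
    then have "1 * (C * N (\<tau> i)) \<le> (2 * ?e (t - \<tau> i)) * (C * N (\<tau> i))"
      using assms(3) N0[of "\<tau> i"] by (intro mult_right_mono) auto
    then show ?thesis using bound[OF less.prems True] by (simp add: mult_ac)
  next
    case False
    obtain j where j: "j > i" "\<tau> j \<le> \<tau> i + R" "N (\<tau> j) \<le> N (\<tau> i) / 2" using half by blast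
    have tj: "\<tau> j \<le> t" using j False by simp
    have "\<tau> j < \<tau> (Suc (idx t))" using idx_bounds[OF t0] tj by simp
    then have "j \<le> idx t" by (simp add: tau_less_iff)
    then have "N t \<le> 2 * C * ?e (t - \<tau> j) * N (\<tau> j)" using j(1) tj by (intro less.hyps) auto
    also have "\<dots> \<le> 2 * C * ?e (t - \<tau> j) * (N (\<tau> i) / 2)"
      using j(3) assms(3) by (intro mult_left_mono) auto
    also have "\<dots> = 2 * C * (?e (t - \<tau> j) * ?e R) * N (\<tau> i)" unfolding eR by simp
    also have "?e (t - \<tau> j) * ?e R = ?e (t - \<tau> j + R)"
      by (simp only: exp_add[symmetric] distrib_left)
    also have "2 * C * ?e (t - \<tau> j + R) * N (\<tau> i) \<le> 2 * C * ?e (t - \<tau> i) * N (\<tau> i)"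
      using j(2) assms(3) N0[of "\<tau> i"] by (intro mult_right_mono mult_left_mono dec) auto
    finally show ?thesis .
  qed
qed

end

theorem theorem3p2:
  fixes p b1 b2 c :: real
    and q :: "real \<Rightarrow> real"
    and lam :: "nat \<Rightarrow> real"
    and phi :: "nat \<Rightarrow> real \<Rightarrow> real"
    and K L :: "real \<Rightarrow> real \<Rightarrow> real"
  assumes "p > 0"
    and "\<bar>b1\<bar> + \<bar>b2\<bar> > 0"
    and "continuous_on {0..1} q"
    and "sl_eigensystem p q b1 b2 lam phi"
    and "\<exists>N>0. lam N > 0 \<and>
           summable (\<lambda>n. inverse (lam (n + N)) * (SUP z\<in>{0..1}. \<bar>phi (n + N) z\<bar>))"
    and "c \<ge> 0"
    and "backstepping_kernels p q b1 b2 c K L"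
    and "continuous_time_exp_stable p q b1 b2 (K 1)"
  shows "\<exists>M>0. \<exists>\<sigma>>0. \<exists>T>0. \<forall>\<tau> :: nat \<Rightarrow> real.
           strict_mono \<tau> \<and> \<tau> 0 = 0 \<and> (\<forall>i. \<tau> (Suc i) - \<tau> i \<le> T) \<and>
           filterlim \<tau> at_top sequentially \<longrightarrow>
           (\<forall>x0\<in>L2_01. \<exists>x.
              sampled_solution p q b1 b2 (K 1) \<tau> x0 x \<and>
              (\<forall>y. sampled_solution p q b1 b2 (K 1) \<tau> x0 y \<longrightarrow>
                 (\<forall>t\<ge>0. \<forall>z\<in>{0..1}. y t z = x t z)) \<and>
              (\<forall>t\<ge>0. norm_01 (x t) \<le> M * exp (- \<sigma> * t) * norm_01 x0))"
proof -
  let ?l = "\<lambda>n. lam (Suc n)" and ?e = "\<lambda>n. phi (Suc n)"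
  interpret sturm_liouville p b1 b2 q ?l ?e by (rule eigensystem_sturm_liouville[OF assms(1-5)])
  obtain h r where "C2_01 h" "b1 * h 0 + b2 * dz h 0 = 0" "h 1 = 1"
    "\<And>z. z \<in> {0..1} \<Longrightarrow> p * dz (dz h) z - q z * h z = r z"
    "C2_01 r" "b1 * r 0 + b2 * dz r 0 = 0" "r 1 = 0"
    "\<And>z. z \<in> {0..1} \<Longrightarrow> p * dz (dz r) z - q z * r z = 0"
    by (rule lifting_exists) (rule that; assumption)
  then interpret lifted_sturm_liouville p b1 b2 q ?l ?e h r by unfold_locales
  obtain \<beta> \<phi> \<phi>1 g g1 where weight: "energy_weight p c \<beta> b1 b2 \<phi> \<phi>1 g g1"
    by (rule energy_weight_exists[OF assms(7,8,1,2,6)])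
  obtain R C T where R: "R > 0" "C \<ge> 1" "T > 0"
    "\<And>\<tau> x0 x i s. sampling \<tau> \<Longrightarrow> sampled_solution p q b1 b2 (K 1) \<tau> x0 x \<Longrightarrow> \<tau> i \<le> s \<Longrightarrow> s \<le> \<tau> i + R \<Longrightarrow>
       inner_01 (x s) (x s) \<le> C * inner_01 (x (\<tau> i)) (x (\<tau> i))"
    "\<And>\<tau> x0 x i. sampling \<tau> \<Longrightarrow> \<forall>i. \<tau> (Suc i) - \<tau> i \<le> T \<Longrightarrow> sampled_solution p q b1 b2 (K 1) \<tau> x0 x \<Longrightarrow>
       \<exists>j>i. \<tau> j \<le> \<tau> i + R \<and> inner_01 (x (\<tau> j)) (x (\<tau> j)) \<le> inner_01 (x (\<tau> i)) (x (\<tau> i)) / 2"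
    by (rule sampled_contraction[OF assms(7) weight]) (rule that; assumption)
  have K: "continuous_on ({0..1} \<times> {0..1}) (\<lambda>(z, s). K z s)"
    using assms(7) unfolding backstepping_kernels_def by (auto intro: C2_on_Times_continuous)
  have k: "K 1 \<in> L2_01" by (rule continuous_on_imp_L2_01) (rule continuous_on_slice[OF K], simp)
  \<comment> \<open>The squared norm decays at the rate \<open>ln 2 / R\<close>, the norm itself at
    half that rate; likewise \<open>2 * C\<close> becomes \<open>sqrt (2 * C)\<close>.\<close>
  define \<sigma> where "\<sigma> = ln 2 / R / 2"
  show ?thesis
  proof (rule exI[of _ "sqrt (2 * C)"], rule conjI[rotated], rule exI[of _ \<sigma>], rule conjI[rotated],
      rule exI[of _ T], rule conjI[rotated], intro allI impI ballI)
    show "0 < sqrt (2 * C)" "0 < \<sigma>" "0 < T" using R by (auto simp: \<sigma>_def)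
    fix \<tau> :: "nat \<Rightarrow> real" and x0
    assume \<tau>: "strict_mono \<tau> \<and> \<tau> 0 = 0 \<and> (\<forall>i. \<tau> (Suc i) - \<tau> i \<le> T) \<and> filterlim \<tau> at_top sequentially"
      and x0: "x0 \<in> L2_01"
    have samp: "sampling \<tau>" using \<tau> by unfold_locales auto
    interpret sampled_system p b1 b2 q ?l ?e h r \<tau> "K 1"
      using \<tau> k by unfold_locales auto
    let ?x = "trajectory x0"
    note sol = trajectory_sampled_solution[OF x0]
    have "norm_01 (?x t) \<le> sqrt (2 * C) * exp (- \<sigma> * t) * norm_01 x0" if "t \<ge> 0" for t
    proof -
      have "inner_01 (?x t) (?x t) \<le> 2 * C * exp (- (ln 2 / R) * (t - \<tau> 0)) * inner_01 (?x (\<tau> 0)) (?x (\<tau> 0))"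
        by (rule halving_imp_exponential_decay[OF samp R(1,2) inner_01_self_nonneg])
          (use R(4)[OF samp sol] R(5)[OF samp _ sol] \<tau> that in auto)
      then have "sqrt (inner_01 (?x t) (?x t)) \<le> sqrt (2 * C * exp (- (ln 2 / R) * t) * inner_01 x0 x0)"
        using trajectory_sample[OF x0, of 0] by (simp only: state.simps tau_0 diff_0_right real_sqrt_le_iff)
      also have "exp (- (ln 2 / R) * t) = (exp (- \<sigma> * t))\<^sup>2"
        by (simp add: \<sigma>_def exp_double[symmetric])
      finally show ?thesis by (simp add: norm_01_eq_inner real_sqrt_mult)
    qed
    then show "\<exists>x. sampled_solution p q b1 b2 (K 1) \<tau> x0 x \<and>
        (\<forall>y. sampled_solution p q b1 b2 (K 1) \<tau> x0 y \<longrightarrow> (\<forall>t\<ge>0. \<forall>z\<in>{0..1}. y t z = x t z)) \<and>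
        (\<forall>t\<ge>0. norm_01 (x t) \<le> sqrt (2 * C) * exp (- \<sigma> * t) * norm_01 x0)"
      using sol sampled_solution_unique[OF sol] by (intro exI[of _ ?x]) blast
  qed
qed

end
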